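(* Let $N=2$ or $N\ge5$ be an integer, let $K\ge0$ be an integer, and let $1\le\alpha,\beta\le N$ be integers with $\alpha\ne\beta$, all fixed. Then, as $n\to\infty$, $$d_{\alpha,\beta;N}^{[K]}(n)=\frac{e^{\pi\sqrt{n/3}}}{2^{K+3}\cdot3^{1/4}n^{3/4}}\left(1+\frac{-N+\beta-\alpha+N(e_\beta-e_\alpha)}{2\cdot3^{1/4}\sqrt N\,n^{1/4}}+O\!\left(\frac1{\sqrt n}\right)\right).$$
   Context: $d_{\alpha,\beta;N}^{[K]}(n)$ denotes the number of partitions of $n$ into distinct parts, all of whose parts are greater than $K$, having strictly more parts congruent to $\alpha$ modulo $N$ than parts congruent to $\beta$ modulo $N$. Let $\boldsymbol e=(e_1,\dots,e_N)^T:=\lfloor K/N\rfloor(1,\dots,1)^T+(1,\dots,1,0,\dots,0)^T$, where the second vector starts with exactly $K-N\lfloor K/N\rfloor$ ones (so $\sum_j e_j=K$). Implied constants may depend on $N,K,\alpha,\beta$. *)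

theory Defs
  imports
    Complex_Main
    "HOL-Library.Multiset"
    "HOL-Library.Landau_Symbols"
    "HOL-Number_Theory.Cong"
begin

definition is_partition_of :: "nat \<Rightarrow> nat multiset \<Rightarrow> bool" where
  "is_partition_of n p \<longleftrightarrow> 0 \<notin># p \<and> \<Sum>\<^sub># p = n"

definition distinct_parts :: "nat multiset \<Rightarrow> bool" where
  "distinct_parts p \<longleftrightarrow> (\<forall>x. count p x \<le> 1)"

definition parts_congruent :: "nat \<Rightarrow> nat \<Rightarrow> nat multiset \<Rightarrow> nat" where
  "parts_congruent a N p = size {#x \<in># p. [x = a] (mod N)#}"

definition bias_partitions :: "nat \<Rightarrow> nat \<Rightarrow> nat \<Rightarrow> nat \<Rightarrow> nat \<Rightarrow> nat multiset set" where
  "bias_partitions K a b N n =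
     {p. is_partition_of n p \<and> distinct_parts p \<and> (\<forall>x \<in># p. K < x) \<and>
         parts_congruent a N p > parts_congruent b N p}"

definition d :: "nat \<Rightarrow> nat \<Rightarrow> nat \<Rightarrow> nat \<Rightarrow> nat \<Rightarrow> nat" where
  "d K a b N n = card (bias_partitions K a b N n)"

(* Entry e_j of the vector e, meaningful for 1 <= j <= N. *)
definition e_vec :: "nat \<Rightarrow> nat \<Rightarrow> nat \<Rightarrow> nat" where
  "e_vec K N j = K div N + (if j \<le> K - N * (K div N) then 1 else 0)"

(* The cardinality defining d is that of a finite set. *)
lemma finite_bias_partitions: "finite (bias_partitions K a b N n)"
proof -
  have size_le: "size p \<le> \<Sum>\<^sub># p" if "0 \<notin># p" for p :: "nat multiset"
    using that by (induction p) auto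
  have "bias_partitions K a b N n \<subseteq> mset ` {xs. set xs \<subseteq> {..n} \<and> length xs \<le> n}"
  proof
    fix p assume p: "p \<in> bias_partitions K a b N n"
    obtain xs where xs: "p = mset xs" using ex_mset by metis
    have "0 \<notin># p" "\<Sum>\<^sub># p = n"
      using p by (auto simp: bias_partitions_def is_partition_of_def)
    moreover from this have "length xs \<le> n"
      using size_le[of p] xs by simp
    moreover have "x \<le> n" if "x \<in> set xs" for x
      using member_le_sum_list[of x xs] that \<open>\<Sum>\<^sub># p = n\<close> xs by (simp add: sum_mset_sum_list)
    ultimately show "p \<in> mset ` {xs. set xs \<subseteq> {..n} \<and> length xs \<le> n}"
      using xs by auto
  qed
  then show ?thesis
    by (rule finite_subset) (intro finite_imageI finite_lists_length_le finite_atMost)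
qed

end

theory Submission
  imports Defs "HOL-Probability.Distributions"
begin

text \<open>
  Write \<open>X\<close> for the number of parts congruent to \<open>\<alpha>\<close> minus the number congruent to \<open>\<beta>\<close>,
  and let \<open>F(\<theta>, w)\<close> be the product of \<open>1 + exp (i \<theta> \<epsilon>(m) - m w)\<close> over the allowed parts \<open>m\<close>,
  where \<open>\<epsilon>(m)\<close> is \<open>1\<close>, \<open>-1\<close> or \<open>0\<close> according to the residue class of \<open>m\<close>. Twice the wanted number is the
  number of all partitions of \<open>n\<close> into distinct allowed parts plus the sum of \<open>sgn (X - 1/2)\<close>, and the latter is an integral of
  \<open>sin ((X - 1/2) \<theta>) / sin (\<theta> / 2)\<close>; this leads to a two-dimensional circle method for \<open>F\<close> at
  \<open>w = t - i \<phi>\<close> with \<open>t = \<pi> / \<surd>(12 n)\<close>.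

  For \<open>|\<phi>| \<le> t\<close> Euler-Maclaurin summation gives \<open>F(0, w) \<approx> 2\<^sup>-\<^sup>K\<^sup>-\<^sup>1\<^sup>/\<^sup>2 exp (\<pi>\<^sup>2 / (12 w))\<close>. The logarithmic
  \<open>\<theta>\<close>-derivative of \<open>F\<close> is a difference of two sums of the logistic function along arithmetic progressions
  with the same step \<open>N\<close>, whose leading terms combine exactly, so that
  \<open>F(\<theta>, w) = F(0, w) exp (- \<theta>\<^sup>2 / (2 N w) + i \<theta> (b - a) / (2 N) + O(\<theta>\<^sup>2 + t |\<theta>|))\<close>, where \<open>a\<close> and \<open>b\<close> are the
  smallest allowed parts in the two classes. Everywhere else \<open>F\<close> is exponentially smaller, which is
  where \<open>N = 2\<close> or \<open>N \<ge> 5\<close> is needed. What remains are Gaussian integrals in \<open>\<phi>\<close> and \<open>\<theta>\<close>.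
\<close>

section \<open>The logistic function and Euler-Maclaurin summation\<close>

text \<open>Heuristically, among the sets of allowed parts with sum n the excess X is nearly
  Gaussian with mean (b - a) / (2 N) and variance 1 / (N t). Ties count against \<alpha>, so the
  sign is taken about 1/2, and the relative correction is twice the Gaussian density at 0 times (b -
  a) / (2 N) - 1/2; inserting a and b gives the numerator of the theorem. The required accuracy
  shapes the rest. With W = exp (2 n t) the relevant scales are t^(3/2) for \<phi> and t^(1/2) for
  \<theta>, the main term has size W t^(3/2), and a relative error O(1 / sqrt n) permits absolute
  errors of size W t^(5/2). The \<theta>-integral returns only a factor t^(1/2), so on the central
  arc the error before division by sin (\<theta>/2) has to be O(W t^2 |\<theta>|): a factor \<theta>
  must survive in every estimate. Hence the dependence on \<theta> is obtained by integrating a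
  derivative from 0. Replacing w by t in the \<theta>-Gaussian is wrong by a relative t^(1/2)
  without a factor \<theta>; this is affordable only because the \<phi>-integral is real, so that it
  is multiplied by a sine that vanishes at \<theta> = 0.\<close>

text \<open>Contains all points \<open>m w\<close> shifted by \<open>i \<theta>\<close> with \<open>w = t - i \<phi>\<close>, \<open>|\<phi>| \<le> t\<close>, \<open>|\<theta>| \<le> 1/2\<close>, and stays away from the zeros of
  \<open>1 + exp (- z)\<close>.\<close>

definition sigdom :: "complex set" where
  "sigdom = {z. 0 \<le> Re z \<and> \<bar>Im z\<bar> \<le> Re z + 1/2}"

text \<open>\<open>sig1 z\<close> is the logistic function 1 / (1 + exp z) and minus the derivative
  of \<open>lfun\<close>; \<open>sig2\<close> and \<open>sig3\<close> are the first two derivatives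
  of \<open>sig1\<close>. Writing everything in exp (- z) makes the decay for large Re z
  visible.\<close>

definition lfun :: "complex \<Rightarrow> complex" where "lfun z = Ln (1 + exp (- z))"
definition sig1 :: "complex \<Rightarrow> complex" where "sig1 z = exp (- z) / (1 + exp (- z))"
definition sig2 :: "complex \<Rightarrow> complex" where "sig2 z = - exp (- z) / (1 + exp (- z))\<^sup>2"
definition sig3 :: "complex \<Rightarrow> complex" where
  "sig3 z = exp (- z) * (1 - exp (- z)) / (1 + exp (- z)) ^ 3"

lemma convex_sigdom: "convex sigdom"
proof -
  have "sigdom = {z. (- 1) * Re z + 0 * Im z \<le> 0} \<inter> ({z. (- 1) * Re z + 1 * Im z \<le> 1/2} \<inter> {z. (- 1) * Re z + (- 1) * Im z \<le> 1/2})"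
    unfolding sigdom_def by auto
  have lin: "convex {z. a * Re z + b * Im z \<le> c}" for a b c :: real
  proof -
    have "{z. a * Re z + b * Im z \<le> c} = {z. inner (Complex a b) z \<le> c}"
      by (simp add: inner_complex_def)
    then show ?thesis by (simp add: convex_halfspace_le)
  qed
  show ?thesis
    unfolding \<open>sigdom = _\<close> by (intro convex_Int lin)
qed

text \<open>While Re z \<le> 1, |Im z| is at most 3/2 < pi/2 and the cosine is nonnegative; beyond
  that exp (- Re z) is below 1/2. This keeps \<open>Ln\<close> off its cut and all denominators away
  from 0.\<close>

lemma Re_one_plus_exp_ge:
  assumes "z \<in> sigdom"
  shows "1/2 \<le> Re (1 + exp (- z))"
proof (cases "Re z \<le> 1")
  case True
  have "\<bar>Im z\<bar> \<le> pi / 2" using True assms pi_gt3 by (auto simp: sigdom_def)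
  then have "cos (Im z) \<ge> 0" using cos_ge_zero[of "Im z"] by auto
  then show ?thesis by (simp add: Re_exp)
next
  case False
  have "exp (- Re z) \<le> exp (-1)" using False by simp
  also have "exp (-1::real) \<le> 1/2"
  proof -
    have "2 \<le> exp (1::real)" using exp_ge_add_one_self[of 1] by simp
    then show ?thesis by (simp add: exp_minus field_simps)
  qed
  finally have e: "exp (- Re z) \<le> 1/2" .
  have "- exp (- Re z) \<le> exp (- Re z) * cos (Im z)"
    using mult_left_mono[of "-1" "cos (Im z)" "exp (- Re z)"] by simp
  then show ?thesis using e by (simp add: Re_exp)
qed

lemma norm_one_plus_exp_ge: "z \<in> sigdom \<Longrightarrow> 1/2 \<le> cmod (1 + exp (- z))"
  using Re_one_plus_exp_ge complex_Re_le_cmod order_trans by blast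

lemma one_plus_exp_nz: "z \<in> sigdom \<Longrightarrow> 1 + exp (- z) \<noteq> 0"
  using norm_one_plus_exp_ge by force

lemma lfun_deriv: "z \<in> sigdom \<Longrightarrow> (lfun has_field_derivative - sig1 z) (at z within S)"
  unfolding lfun_def [abs_def] sig1_def
  using Re_one_plus_exp_ge[of z] one_plus_exp_nz[of z]
  by (auto intro!: derivative_eq_intros simp: complex_nonpos_Reals_iff field_simps)

lemma sig1_deriv: "z \<in> sigdom \<Longrightarrow> (sig1 has_field_derivative sig2 z) (at z within S)"
  unfolding sig1_def [abs_def] sig2_def
  using one_plus_exp_nz[of z]
  by (auto intro!: derivative_eq_intros simp: divide_simps) (simp add: algebra_simps power2_eq_square)?

lemma sig2_deriv: "z \<in> sigdom \<Longrightarrow> (sig2 has_field_derivative sig3 z) (at z within S)"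
proof -
  assume z: "z \<in> sigdom"
  note nz = one_plus_exp_nz[OF z]
  define u where "u = exp (- z)"
  have "(sig2 has_field_derivative (- (- u) * (1 + u)\<^sup>2 - (- u) * (2 * (1 + u) * (- u))) / ((1 + u)\<^sup>2 * (1 + u)\<^sup>2)) (at z within S)"
    unfolding sig2_def [abs_def] u_def using nz
    by (auto intro!: derivative_eq_intros simp: algebra_simps diff_divide_distrib add_divide_distrib)
  also have "(- (- u) * (1 + u)\<^sup>2 - (- u) * (2 * (1 + u) * (- u))) / ((1 + u)\<^sup>2 * (1 + u)\<^sup>2) = sig3 z"
    using nz unfolding sig3_def u_def[symmetric] by (simp add: divide_simps power2_eq_square power3_eq_cube) (simp add: algebra_simps)
  finally show ?thesis .
qed

lemma norm_sig1_le: assumes "z \<in> sigdom" shows "cmod (sig1 z) \<le> 2 * exp (- Re z)"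
proof -
  have "exp (- Re z) / cmod (1 + exp (- z)) \<le> exp (- Re z) / (1/2)"
    by (rule divide_left_mono) (use norm_one_plus_exp_ge[OF assms] in auto)
  then show ?thesis by (simp add: sig1_def norm_divide)
qed

lemma norm_sig2_le: assumes "z \<in> sigdom" shows "cmod (sig2 z) \<le> 4 * exp (- Re z)"
proof -
  have "(1/2)^2 \<le> cmod (1 + exp (- z)) ^ 2"
    by (rule power_mono[OF norm_one_plus_exp_ge[OF assms]]) auto
  then have "exp (- Re z) / cmod (1 + exp (- z)) ^ 2 \<le> exp (- Re z) / (1/2)^2"
    by (intro divide_left_mono mult_pos_pos zero_less_power) (use norm_one_plus_exp_ge[OF assms] in auto)
  then show ?thesis by (simp add: sig2_def norm_divide norm_power power_divide)
qed

lemma norm_sig3_le: assumes "z \<in> sigdom" shows "cmod (sig3 z) \<le> 16 * exp (- Re z)"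
proof -
  have r: "0 \<le> Re z" using assms by (auto simp: sigdom_def)
  have p: "(1/2)^3 \<le> cmod (1 + exp (- z)) ^ 3"
    by (rule power_mono[OF norm_one_plus_exp_ge[OF assms]]) auto
  have "cmod (1 - exp (- z)) \<le> 1 + cmod (exp (- z))" by (metis norm_one norm_triangle_ineq4)
  then have q: "cmod (1 - exp (- z)) \<le> 2" using r by simp (smt (verit) exp_le_one_iff)
  have "cmod (sig3 z) = exp (- Re z) * cmod (1 - exp (- z)) / cmod (1 + exp (- z)) ^ 3"
    by (simp add: sig3_def norm_divide norm_power norm_mult)
  also have "\<dots> \<le> exp (- Re z) * 2 / (1/2)^3"
    by (intro frac_le mult_left_mono) (use p q in auto)
  finally show ?thesis by (simp add: power3_eq_cube)
qed

text \<open>Eliminates the second derivative between the Taylor expansions of \<open>g0\<close> and \<open>g1\<close>.\<close>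

lemma euler_maclaurin_step:
  fixes g0 g1 g2 g3 :: "complex \<Rightarrow> complex"
  assumes d0: "\<And>x. x \<in> closed_segment z (z + h) \<Longrightarrow> (g0 has_field_derivative g1 x) (at x within closed_segment z (z + h))"
    and d1: "\<And>x. x \<in> closed_segment z (z + h) \<Longrightarrow> (g1 has_field_derivative g2 x) (at x within closed_segment z (z + h))"
    and d2: "\<And>x. x \<in> closed_segment z (z + h) \<Longrightarrow> (g2 has_field_derivative g3 x) (at x within closed_segment z (z + h))"
    and B: "\<And>x. x \<in> closed_segment z (z + h) \<Longrightarrow> cmod (g3 x) \<le> B"
  shows "cmod (h * g1 z - (g0 (z + h) - g0 z) + h / 2 * (g1 (z + h) - g1 z)) \<le> B * cmod h ^ 3"
proof -
  let ?S = "closed_segment z (z + h)"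
  define f where "f i = (if i = 0 then g0 else if i = 1 then g1 else if i = 2 then g2 else g3)" for i :: nat
  have t0: "cmod (f 0 (z + h) - (\<Sum>i\<le>2. f i z * (z + h - z) ^ i / fact i)) \<le> B * cmod (z + h - z) ^ Suc 2 / fact 2"
  proof (rule complex_Taylor[of ?S])
    fix i :: nat and x assume x: "x \<in> ?S" and i: "i \<le> 2"
    consider "i = 0" | "i = 1" | "i = 2" using i by linarith
    then show "(f i has_field_derivative f (Suc i) x) (at x within ?S)"
      by cases (use x d0 d1 d2 in \<open>auto simp: f_def\<close>)
  qed (use B in \<open>auto simp: f_def\<close>)
  define e where "e i = (if i = 0 then g1 else if i = 1 then g2 else g3)" for i :: nat
  have t1: "cmod (e 0 (z + h) - (\<Sum>i\<le>1. e i z * (z + h - z) ^ i / fact i)) \<le> B * cmod (z + h - z) ^ Suc 1 / fact 1"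
  proof (rule complex_Taylor[of ?S])
    fix i :: nat and x assume x: "x \<in> ?S" and i: "i \<le> 1"
    consider "i = 0" | "i = 1" using i by linarith
    then show "(e i has_field_derivative e (Suc i) x) (at x within ?S)"
      by cases (use x d1 d2 in \<open>auto simp: e_def\<close>)
  qed (use B in \<open>auto simp: e_def\<close>)
  define R0 where "R0 = g0 (z + h) - (g0 z + g1 z * h + g2 z * h\<^sup>2 / 2)"
  define R1 where "R1 = g1 (z + h) - (g1 z + g2 z * h)"
  have R0: "cmod R0 \<le> B * cmod h ^ 3 / 2"
    using t0 by (simp add: R0_def f_def numeral_2_eq_2 numeral_3_eq_3 algebra_simps)
  have R1: "cmod R1 \<le> B * cmod h ^ 2"
    using t1 by (simp add: R1_def e_def numeral_2_eq_2 algebra_simps)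
  have "h * g1 z - (g0 (z + h) - g0 z) + h / 2 * (g1 (z + h) - g1 z) = - R0 + h / 2 * R1"
    by (simp add: R0_def R1_def algebra_simps power2_eq_square)
  also have "cmod \<dots> \<le> cmod R0 + cmod h / 2 * cmod R1"
    using norm_triangle_ineq[of "- R0" "h / 2 * R1"] by (simp add: norm_mult norm_divide)
  also have "\<dots> \<le> B * cmod h ^ 3 / 2 + cmod h / 2 * (B * cmod h ^ 2)"
    using R0 R1 by (intro add_mono mult_left_mono) auto
  also have "\<dots> = B * cmod h ^ 3" by (simp add: power2_eq_square power3_eq_cube)
  finally show ?thesis .
qed

lemma sum_exp_decay_le:
  fixes c r :: real
  assumes "0 < r" "r \<le> 1"
  shows "(\<Sum>k<L. exp (- (c + of_nat k * r))) \<le> 2 * exp (- c) / r"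
proof -
  have e: "exp (- r) \<le> 1 - r / 2"
  proof -
    have "1 + r \<le> exp r" by simp
    then have "exp (- r) \<le> 1 / (1 + r)" using assms by (simp add: exp_minus field_simps)
    also have "\<dots> \<le> 1 - r / 2"
      using assms mult_left_le[of r r] by (simp add: divide_simps) (simp add: algebra_simps)
    finally show ?thesis .
  qed
  have "(\<Sum>k<L. exp (- (c + of_nat k * r))) = exp (- c) * (\<Sum>k<L. exp (- r) ^ k)"
    by (simp add: sum_distrib_left exp_add exp_diff exp_minus exp_of_nat_mult exp_of_nat2_mult field_simps)
  also have "(\<Sum>k<L. exp (- r) ^ k) = (1 - exp (- r) ^ L) / (1 - exp (- r))"
    using assms by (subst sum_gp_strict) auto
  also have "\<dots> \<le> 1 / (r / 2)"
    by (rule frac_le) (use assms e in auto)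
  finally show ?thesis by (simp add: field_simps)
qed

text \<open>The trapezoidal rule along the direction \<open>h\<close>. The local errors decay like
  exp (- Re), so summing them costs a factor 1 / Re h however large \<open>L\<close> is. Convexity
  of \<open>S\<close> keeps the segments between consecutive nodes inside the domain.\<close>

lemma euler_maclaurin_sum:
  fixes g0 g1 g2 g3 :: "complex \<Rightarrow> complex"
  assumes S: "convex S"
    and d0: "\<And>x. x \<in> S \<Longrightarrow> (g0 has_field_derivative g1 x) (at x within S)"
    and d1: "\<And>x. x \<in> S \<Longrightarrow> (g1 has_field_derivative g2 x) (at x within S)"
    and d2: "\<And>x. x \<in> S \<Longrightarrow> (g2 has_field_derivative g3 x) (at x within S)"
    and B: "\<And>x. x \<in> S \<Longrightarrow> cmod (g3 x) \<le> B * exp (- Re x)" and "0 \<le> B"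
    and inS: "\<And>k. k \<le> L \<Longrightarrow> z + of_nat k * h \<in> S"
    and h: "0 < Re h" "Re h \<le> 1"
  shows "cmod (h * (\<Sum>k<L. g1 (z + of_nat k * h)) - (g0 (z + of_nat L * h) - g0 z)
             + h / 2 * (g1 (z + of_nat L * h) - g1 z)) \<le> B * cmod h ^ 3 * (2 * exp (- Re z) / Re h)"
proof -
  define Z where "Z k = z + of_nat k * h" for k
  have ZS: "Z (Suc k) = Z k + h" for k by (simp add: Z_def algebra_simps)
  have step: "cmod (h * g1 (Z k) - (g0 (Z (Suc k)) - g0 (Z k)) + h / 2 * (g1 (Z (Suc k)) - g1 (Z k))) \<le> (B * exp (- Re (Z k))) * cmod h ^ 3"
    if k: "k < L" for k
  proof -
    have sub: "closed_segment (Z k) (Z k + h) \<subseteq> S"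
      using inS[of k] inS[of "Suc k"] k unfolding ZS[symmetric] Z_def[symmetric]
      by (intro closed_segment_subset S) auto
    show ?thesis unfolding ZS
    proof (rule euler_maclaurin_step)
      fix x assume x: "x \<in> closed_segment (Z k) (Z k + h)"
      then have xS: "x \<in> S" using sub by auto
      show "(g0 has_field_derivative g1 x) (at x within closed_segment (Z k) (Z k + h))"
        "(g1 has_field_derivative g2 x) (at x within closed_segment (Z k) (Z k + h))"
        "(g2 has_field_derivative g3 x) (at x within closed_segment (Z k) (Z k + h))"
        using DERIV_subset[OF d0[OF xS] sub] DERIV_subset[OF d1[OF xS] sub] DERIV_subset[OF d2[OF xS] sub] by auto
      obtain u where u: "0 \<le> u" "u \<le> 1" "x = (1 - u) *\<^sub>R Z k + u *\<^sub>R (Z k + h)"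
        using x by (auto simp: in_segment)
      have "Re x = Re (Z k) + u * Re h" using u(3) by (simp add: algebra_simps)
      then have "Re (Z k) \<le> Re x" using u h by simp
      then show "cmod (g3 x) \<le> B * exp (- Re (Z k))"
        using B[OF xS] mult_left_mono[of "exp (- Re x)" "exp (- Re (Z k))" B] \<open>0 \<le> B\<close> by auto
    qed
  qed
  have "h * (\<Sum>k<L. g1 (Z k)) - (g0 (Z L) - g0 (Z 0)) + h / 2 * (g1 (Z L) - g1 (Z 0))
     = (\<Sum>k<L. h * g1 (Z k) - (g0 (Z (Suc k)) - g0 (Z k)) + h / 2 * (g1 (Z (Suc k)) - g1 (Z k)))"
    using sum_lessThan_telescope[of "\<lambda>k. g0 (Z k)" L] sum_lessThan_telescope[of "\<lambda>k. g1 (Z k)" L]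
    by (simp only: sum.distrib sum_subtractf sum_distrib_left[symmetric])
  also have "cmod \<dots> \<le> (\<Sum>k<L. (B * exp (- Re (Z k))) * cmod h ^ 3)"
    by (rule order_trans[OF norm_sum sum_mono]) (use step in auto)
  also have "\<dots> = B * cmod h ^ 3 * (\<Sum>k<L. exp (- (Re z + of_nat k * Re h)))"
    by (simp add: Z_def sum_distrib_left mult_ac)
  also have "\<dots> \<le> B * cmod h ^ 3 * (2 * exp (- Re z) / Re h)"
    by (intro mult_left_mono sum_exp_decay_le h) (use \<open>0 \<le> B\<close> in auto)
  finally show ?thesis by (simp add: Z_def)
qed

section \<open>Major arc: the generating function of all partitions\<close>

definition dilogc :: "nat \<Rightarrow> complex" where
  "dilogc n = (if n = 0 then 0 else (- 1) ^ Suc n / (of_nat n)\<^sup>2)"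

text \<open>This is -Li_2(-u), the antiderivative of Ln (1 + u) / u vanishing at 0.\<close>

definition dilog :: "complex \<Rightarrow> complex" where "dilog u = (\<Sum>n. dilogc n * u ^ n)"

lemma norm_dilogc: "cmod (dilogc n) \<le> 1 / (real n)\<^sup>2"
  by (simp add: dilogc_def norm_divide norm_power)

lemma dilogc_summable_norm: "cmod u \<le> 1 \<Longrightarrow> summable (\<lambda>n. cmod (dilogc n * u ^ n))"
proof (rule summable_comparison_test'[where N = 0])
  show "summable (\<lambda>n. 1 / (real n)\<^sup>2)"
    using inverse_power_summable[of 2, where ?'a = real] by (simp add: inverse_eq_divide)
  fix n assume u: "cmod u \<le> 1"
  have "cmod (dilogc n) * cmod u ^ n \<le> 1 / (real n)\<^sup>2 * 1"
    by (intro mult_mono norm_dilogc power_le_one u) auto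
  then show "norm (cmod (dilogc n * u ^ n)) \<le> 1 / (real n)\<^sup>2"
    by (simp add: norm_mult norm_power)
qed

lemma dilog_sums: "cmod u \<le> 1 \<Longrightarrow> (\<lambda>n. dilogc n * u ^ n) sums dilog u"
  unfolding dilog_def by (rule summable_sums[OF summable_norm_cancel[OF dilogc_summable_norm]])

lemma continuous_on_dilog: "continuous_on (cball 0 1) dilog"
proof -
  have "uniform_limit (cball 0 1) (\<lambda>N u. \<Sum>n<N. dilogc n * u ^ n) (\<lambda>u. \<Sum>n. dilogc n * u ^ n) sequentially"
  proof (rule Weierstrass_m_test)
    show "summable (\<lambda>n. 1 / (real n)\<^sup>2)"
      using inverse_power_summable[of 2, where ?'a = real] by (simp add: inverse_eq_divide)
    fix n and u :: complex assume u: "u \<in> cball 0 1"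
    have "cmod (dilogc n) * cmod u ^ n \<le> 1 / (real n)\<^sup>2 * 1"
      by (intro mult_mono norm_dilogc power_le_one) (use u in auto)
    then show "norm (dilogc n * u ^ n) \<le> 1 / (real n)\<^sup>2"
      by (simp add: norm_mult norm_power)
  qed
  then have "continuous_on (cball 0 1) (\<lambda>u. \<Sum>n. dilogc n * u ^ n)"
    by (rule uniform_limit_theorem[rotated]) (auto intro!: always_eventually continuous_intros)
  then show ?thesis unfolding dilog_def [abs_def] .
qed

text \<open>Source of the constant pi^2 / 12. Half of the Basel series, spread over the odd indices,
  equals twice its terms with even denominator; subtracting it makes the series alternate.\<close>

lemma dilog_1: "dilog 1 = of_real (pi\<^sup>2 / 12)"
proof -
  define a where "a n = 1 / (real (n + 1))\<^sup>2" for n :: nat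
  have a: "a sums (pi\<^sup>2 / 6)" using inverse_squares_sums by (simp add: a_def [abs_def] add.commute)
  have b: "(\<lambda>n. if even n then 0 else a ((n - 1) div 2)) sums (pi\<^sup>2 / 6)"
    by (rule sums_if'[OF a])
  have "(\<lambda>n. a n - 1/2 * (if even n then 0 else a ((n - 1) div 2))) sums (pi\<^sup>2 / 6 - 1/2 * (pi\<^sup>2 / 6))"
    by (intro sums_diff a sums_mult b)
  moreover have "a n - 1/2 * (if even n then 0 else a ((n - 1) div 2)) = (- 1) ^ n / (real (n + 1))\<^sup>2" for n
  proof (cases "even n")
    case True then show ?thesis by (simp add: a_def)
  next
    case False
    then obtain k where "n = 2 * k + 1" by (metis oddE)
    then show ?thesis by (simp add: a_def divide_simps) (simp add: power2_eq_square algebra_simps)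
  qed
  ultimately have "(\<lambda>n. (- 1) ^ n / (real (n + 1))\<^sup>2) sums (pi\<^sup>2 / 12)" by simp
  then have "(\<lambda>n. of_real ((- 1) ^ n / (real (n + 1))\<^sup>2) :: complex) sums of_real (pi\<^sup>2 / 12)"
    by (rule sums_of_real)
  then have "(\<lambda>n. dilogc (Suc n) * 1 ^ Suc n) sums of_real (pi\<^sup>2 / 12)"
    by (simp add: dilogc_def)
  then have "(\<lambda>n. dilogc n * 1 ^ n) sums (of_real (pi\<^sup>2 / 12) + dilogc 0 * 1 ^ 0)"
    by (rule iffD1[OF sums_Suc_iff])
  then have "(\<lambda>n. dilogc n * 1 ^ n) sums of_real (pi\<^sup>2 / 12)" by (simp add: dilogc_def)
  moreover have "(\<lambda>n. dilogc n * 1 ^ n) sums dilog 1" by (rule dilog_sums) simp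
  ultimately show ?thesis by (rule sums_unique2[symmetric])
qed

lemma dilog_deriv:
  assumes "cmod u < 1" "u \<noteq> 0"
  shows "(dilog has_field_derivative Ln (1 + u) / u) (at u)"
proof -
  have s: "summable (\<lambda>n. dilogc n * z ^ n)" if "cmod z < 1" for z
  proof -
    have "cmod z \<le> 1" using that by linarith
    then show ?thesis by (rule sums_summable[OF dilog_sums])
  qed
  have d: "(dilog has_field_derivative (\<Sum>n. diffs dilogc n * u ^ n)) (at u)"
    unfolding dilog_def [abs_def]
    by (rule termdiffs_strong'[where K = 1]) (rule s assms(1), assumption?)+
  have "(\<lambda>n. (-1) ^ Suc n / of_nat n * u ^ n) sums Ln (1 + u)" using Ln_series[OF assms(1)] .
  then have "(\<lambda>n. (-1) ^ Suc n / of_nat n * u ^ n) sums (Ln (1 + u) + (-1) ^ Suc 0 / of_nat 0 * u ^ 0)"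
    by simp
  then have "(\<lambda>n. (-1) ^ Suc (Suc n) / of_nat (Suc n) * u ^ Suc n) sums Ln (1 + u)"
    by (rule iffD2[OF sums_Suc_iff])
  then have "(\<lambda>n. (-1) ^ Suc (Suc n) / of_nat (Suc n) * u ^ Suc n / u) sums (Ln (1 + u) / u)"
    by (rule sums_divide)
  moreover have "(-1) ^ Suc (Suc n) / of_nat (Suc n) * u ^ Suc n / u = diffs dilogc n * u ^ n" for n
    using assms(2) by (simp add: diffs_def dilogc_def power2_eq_square divide_simps)
  ultimately have "(\<lambda>n. diffs dilogc n * u ^ n) sums (Ln (1 + u) / u)" by (simp only:)
  then show ?thesis using d sums_unique by metis
qed

text \<open>The antiderivative of \<open>lfun\<close> that vanishes at infinity, so that in
  Euler-Maclaurin summation only the near endpoint contributes.\<close>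

definition dlog :: "complex \<Rightarrow> complex" where "dlog z = - dilog (exp (- z))"

lemma dlog_deriv: "0 < Re z \<Longrightarrow> (dlog has_field_derivative lfun z) (at z within S)"
proof -
  assume z: "0 < Re z"
  have e: "((\<lambda>z. exp (- z)) has_field_derivative - exp (- z)) (at z)"
    by (auto intro!: derivative_eq_intros)
  have d: "(dilog has_field_derivative Ln (1 + exp (- z)) / exp (- z)) (at (exp (- z)))"
    by (rule dilog_deriv) (use z in auto)
  have "((\<lambda>z. - dilog (exp (- z))) has_field_derivative - (- exp (- z) * (Ln (1 + exp (- z)) / exp (- z)))) (at z)"
    by (rule DERIV_minus[OF DERIV_chain2[OF d e, THEN DERIV_cong]]) simp
  moreover have "(\<lambda>z. - dilog (exp (- z))) = dlog" by (simp add: dlog_def [abs_def])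
  ultimately have "(dlog has_field_derivative lfun z) (at z)" by (simp add: lfun_def)
  then show ?thesis by (rule has_field_derivative_at_within)
qed

lemma norm_dlog_le: assumes "0 \<le> Re z" shows "cmod (dlog z) \<le> 2 * exp (- Re z)"
proof -
  define u where "u = exp (- z)"
  have u: "cmod u \<le> 1" using assms by (simp add: u_def)
  define g where "g n = (if n = 0 then 0 else 1 / (real n)\<^sup>2)" for n :: nat
  have "(\<lambda>n. g (Suc n)) sums (pi\<^sup>2 / 6)" using inverse_squares_sums by (simp add: g_def add.commute)
  then have "g sums (pi\<^sup>2 / 6 + g 0)" by (rule iffD1[OF sums_Suc_iff])
  then have g: "g sums (pi\<^sup>2 / 6)" by (simp add: g_def)
  have "cmod (dilog u) \<le> (\<Sum>n. cmod (dilogc n * u ^ n))"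
    unfolding dilog_def by (rule summable_norm[OF dilogc_summable_norm[OF u]])
  also have "\<dots> \<le> (\<Sum>n. g n * cmod u)"
  proof (intro suminf_le dilogc_summable_norm u)
    fix n show "cmod (dilogc n * u ^ n) \<le> g n * cmod u"
    proof (cases n)
      case (Suc m)
      have "cmod (dilogc n) * (cmod u * cmod u ^ m) \<le> 1 / (real n)\<^sup>2 * (cmod u * 1)"
        by (intro mult_mono norm_dilogc power_le_one u) auto
      then show ?thesis using Suc by (simp add: norm_mult norm_power g_def)
    qed (simp add: dilogc_def g_def)
    show "summable (\<lambda>n. g n * cmod u)" by (intro summable_mult2 sums_summable[OF g])
  qed
  also have "\<dots> = pi\<^sup>2 / 6 * cmod u" by (rule sums_unique[symmetric, OF sums_mult2[OF g]])
  also have "\<dots> \<le> 2 * cmod u"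
  proof (rule mult_right_mono)
    have "pi < 3.2" using pi_approx by simp
    then have "pi * pi \<le> 3.2 * 3.2" using pi_gt_zero by (intro mult_mono) auto
    then show "pi\<^sup>2 / 6 \<le> 2" by (simp add: power2_eq_square)
  qed auto
  finally show ?thesis by (simp add: dlog_def u_def)
qed

lemma lfun_0: "lfun 0 = of_real (ln 2)"
  unfolding lfun_def by (simp add: Ln_of_real[of 2, simplified])

lemma lfun_lipschitz:
  assumes "y \<in> sigdom" "z \<in> sigdom"
  shows "cmod (lfun y - lfun z) \<le> 2 * cmod (y - z)"
proof (rule field_differentiable_bound[OF convex_sigdom])
  fix x assume x: "x \<in> sigdom"
  then show "(lfun has_field_derivative - sig1 x) (at x within sigdom)" by (rule lfun_deriv)
  have "exp (- Re x) \<le> 1" using x by (simp add: sigdom_def)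
  then have "2 * exp (- Re x) \<le> 2" by simp
  then show "cmod (- sig1 x) \<le> 2" unfolding norm_minus_cancel by (rule order_trans[OF norm_sig1_le[OF x]])
qed (use assms in auto)

lemma zero_sigdom: "0 \<in> sigdom" by (simp add: sigdom_def)

lemma ray_sigdom: "\<bar>\<phi>\<bar> \<le> t \<Longrightarrow> 0 \<le> x \<Longrightarrow> of_real x * Complex t (- \<phi>) \<in> sigdom"
  using mult_left_mono[of "\<bar>\<phi>\<bar>" t x] by (auto simp: sigdom_def abs_mult)

text \<open>A first-order Taylor expansion at a point where only continuity of \<open>dlog\<close>
  is known: the mean value inequality is applied on the open ray 0 < x < a, with the Lipschitz bound
  of \<open>lfun\<close> controlling the derivative of the remainder.\<close>

lemma dlog_near_0:
  assumes t: "0 < t" "\<bar>\<phi>\<bar> \<le> t" and a: "0 < (a::real)" and w: "w = Complex t (- \<phi>)"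
  shows "cmod (dlog (of_real a * w) - (- of_real (pi\<^sup>2 / 12) + of_real a * w * of_real (ln 2))) \<le> 2 * a\<^sup>2 * (cmod w)\<^sup>2"
proof -
  define g where "g x = dlog (of_real x * w) - of_real x * w * of_real (ln 2)" for x :: real
  have c: "continuous_on {0..a} g"
    unfolding g_def dlog_def
    by (intro continuous_intros continuous_on_compose2[OF continuous_on_dilog]) (use t w in auto)
  have der: "(g has_vector_derivative (w * (lfun (of_real x * w) - of_real (ln 2)))) (at x)" if x: "0 < x" for x
  proof -
    have "((\<lambda>z. dlog (z * w) - z * w * of_real (ln 2)) has_field_derivative (lfun (of_real x * w) * w - w * of_real (ln 2))) (at (of_real x))"
    proof -
      have m: "((\<lambda>z. z * w) has_field_derivative w) (at (of_real x))"
        by (auto intro!: derivative_eq_intros)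
      have d: "(dlog has_field_derivative lfun (of_real x * w)) (at (of_real x * w))"
        by (rule dlog_deriv) (use x t w in simp)
      have l: "((\<lambda>z. z * w * of_real (ln 2)) has_field_derivative w * of_real (ln 2)) (at (of_real x))"
        by (auto intro!: derivative_eq_intros)
      show ?thesis by (rule DERIV_diff[OF DERIV_chain2[OF d m] l])
    qed
    then have "((\<lambda>x. dlog (of_real x * w) - of_real x * w * of_real (ln 2)) has_vector_derivative (lfun (of_real x * w) * w - w * of_real (ln 2))) (at x)"
      by (rule has_vector_derivative_real_field)
    then show ?thesis by (simp add: g_def [abs_def] algebra_simps)
  qed
  have "cmod (g a - g 0) \<le> 2 * a * (cmod w)\<^sup>2 * a - 2 * a * (cmod w)\<^sup>2 * 0"
  proof (rule differentiable_bound_general[where f = g and \<phi> = "\<lambda>x. 2 * a * (cmod w)\<^sup>2 * x" and f' = "\<lambda>x. w * (lfun (of_real x * w) - of_real (ln 2))" and \<phi>' = "\<lambda>x. 2 * a * (cmod w)\<^sup>2"])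
    show "continuous_on {0..a} (\<lambda>x. 2 * a * (cmod w)\<^sup>2 * x)" by (intro continuous_intros)
    fix x assume x: "0 < x" "x < a"
    show "(g has_vector_derivative w * (lfun (of_real x * w) - of_real (ln 2))) (at x)" by (rule der[OF x(1)])
    show "((\<lambda>x. 2 * a * (cmod w)\<^sup>2 * x) has_vector_derivative 2 * a * (cmod w)\<^sup>2) (at x)"
      by (auto intro!: derivative_eq_intros simp: has_real_derivative_iff_has_vector_derivative[symmetric])
    have "cmod (lfun (of_real x * w) - lfun 0) \<le> 2 * cmod (of_real x * w - 0)"
      by (rule lfun_lipschitz) (use ray_sigdom[OF t(2), of x] x w zero_sigdom in auto)
    also have "\<dots> \<le> 2 * (a * cmod w)" using x by (auto simp: norm_mult intro!: mult_right_mono)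
    finally have "cmod w * cmod (lfun (of_real x * w) - of_real (ln 2)) \<le> cmod w * (2 * (a * cmod w))"
      by (intro mult_left_mono) (auto simp: lfun_0)
    then show "cmod (w * (lfun (of_real x * w) - of_real (ln 2))) \<le> 2 * a * (cmod w)\<^sup>2"
      by (simp add: norm_mult power2_eq_square mult_ac)
  qed (use a c in auto)
  moreover have "g 0 = - of_real (pi\<^sup>2 / 12)" using dilog_1 by (simp add: g_def dlog_def)
  moreover have "g a - g 0 = dlog (of_real a * w) - (- of_real (pi\<^sup>2 / 12) + of_real a * w * of_real (ln 2))"
    unfolding calculation(2) by (simp add: g_def)
  moreover have "2 * a * (cmod w)\<^sup>2 * a - 2 * a * (cmod w)\<^sup>2 * 0 = 2 * a\<^sup>2 * (cmod w)\<^sup>2"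
    by (simp add: power2_eq_square)
  ultimately show ?thesis by metis
qed

lemma norm_Complex_le: "0 < t \<Longrightarrow> \<bar>\<phi>\<bar> \<le> t \<Longrightarrow> cmod (Complex t (- \<phi>)) \<le> 2 * t"
  using cmod_le[of "Complex t (- \<phi>)"] by simp

lemma norm_Complex_ge: "0 < t \<Longrightarrow> t \<le> cmod (Complex t (- \<phi>))"
  using complex_Re_le_cmod[of "Complex t (- \<phi>)"] by simp

text \<open>Summation starts at z0 = (K + 1) w. The term - dlog z0 / w gives pi^2 / (12 w) - (K + 1)
  ln 2 and the endpoint correction lfun z0 / 2 gives ln 2 / 2. The condition on \<open>M\<close>
  makes the far endpoint O(t) even after division by w.\<close>

lemma log_product_asymp:
  fixes K M :: nat
  assumes t: "0 < t" "t \<le> 1" "\<bar>\<phi>\<bar> \<le> t" and w: "w = Complex t (- \<phi>)"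
    and M: "exp (- (real M * t)) \<le> t\<^sup>2 / 2"
  shows "cmod ((\<Sum>m = K + 1..K + M. lfun (of_nat m * w))
            - (of_real (pi\<^sup>2 / 12) / w - of_real ((real K + 1/2) * ln 2))) \<le> (80 + 20 * (real K + 1)\<^sup>2) * t"
proof -
  \<comment> \<open>The antiderivative \<open>dlog\<close> is differentiable only for Re z > 0, so 0
    has to be removed from the domain.\<close>
  define S where "S = sigdom \<inter> {z. 0 < Re z}"
  define z0 where "z0 = of_nat (K + 1) * w"
  define zM where "zM = z0 + of_nat M * w"
  have w0: "w \<noteq> 0" "Re w = t" using t w by (auto simp: complex_eq_iff)
  have nw: "cmod w \<le> 2 * t" "t \<le> cmod w" using norm_Complex_le norm_Complex_ge t w by auto
  have ray: "z0 + of_nat k * w \<in> S" for k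
  proof -
    have e: "z0 + of_nat k * w = of_real (real (K + 1 + k)) * w" by (simp add: z0_def algebra_simps)
    have "0 < Re (of_real (real (K + 1 + k)) * w)" using t(1) w0 by simp
    then show ?thesis unfolding e S_def using ray_sigdom[OF t(3), of "real (K + 1 + k)"] w by simp
  qed
  have "cmod (w * (\<Sum>k<M. lfun (z0 + of_nat k * w)) - (dlog (z0 + of_nat M * w) - dlog z0)
             + w / 2 * (lfun (z0 + of_nat M * w) - lfun z0)) \<le> 4 * cmod w ^ 3 * (2 * exp (- Re z0) / Re w)"
  proof (rule euler_maclaurin_sum[where S = S and ?g2.0 = "\<lambda>z. - sig1 z" and ?g3.0 = "\<lambda>z. - sig2 z"])
    show "convex S" unfolding S_def by (intro convex_Int convex_sigdom) (simp add: convex_halfspace_Re_gt)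
  qed (use ray w0 t in \<open>auto simp: S_def intro!: dlog_deriv lfun_deriv sig1_deriv DERIV_minus norm_sig2_le\<close>)
  also have "\<dots> \<le> 4 * cmod w ^ 3 * (2 * 1 / t)"
  proof -
    have "0 \<le> (real K + 1) * t" using t by simp
    then have "exp (- Re z0) \<le> 1" using w0 by (simp add: z0_def algebra_simps)
    then show ?thesis unfolding w0(2) using t by (intro mult_left_mono divide_right_mono) auto
  qed
  also have "\<dots> = cmod w * (8 * (cmod w * cmod w) / t)" by (simp add: power3_eq_cube)
  also have "\<dots> \<le> cmod w * (8 * (2 * t * (2 * t)) / t)"
    by (intro mult_left_mono divide_right_mono mult_mono) (use nw t in auto)
  also have "\<dots> = cmod w * (32 * t)" using t by simp
  finally have e1: "cmod (w * (\<Sum>k<M. lfun (z0 + of_nat k * w)) - (dlog zM - dlog z0) + w / 2 * (lfun zM - lfun z0)) \<le> cmod w * (32 * t)"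
    unfolding zM_def .
  have reM: "Re zM \<ge> real M * t" using t w0 by (simp add: zM_def z0_def)
  then have eM: "exp (- Re zM) \<le> t\<^sup>2 / 2" using M by (meson exp_le_cancel_iff neg_le_iff_le order_trans)
  have t2: "t\<^sup>2 \<le> t" using t by (simp add: power2_eq_square)
  have e2: "cmod (dlog zM) \<le> cmod w * t"
  proof -
    have "cmod (dlog zM) \<le> 2 * exp (- Re zM)"
      by (rule norm_dlog_le) (use t w0 in \<open>simp add: zM_def z0_def\<close>)
    also have "\<dots> \<le> t * t" using eM by (simp add: power2_eq_square)
    also have "\<dots> \<le> cmod w * t" using nw t by (intro mult_right_mono) auto
    finally show ?thesis .
  qed
  have e3: "cmod (lfun zM) \<le> t"
  proof -
    have "Re zM > real M * t" using t w0 by (simp add: zM_def z0_def)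
    then have "exp (- Re zM) < exp (- (real M * t))" by simp
    then have "exp (- Re zM) < t\<^sup>2 / 2" using M by linarith
    moreover have "t\<^sup>2 / 2 \<le> 1/2" using t2 t by simp
    ultimately have "cmod (exp (- zM)) < 1/2" by simp
    then have "cmod (lfun zM) \<le> 2 * exp (- Re zM)"
      unfolding lfun_def by (rule order_trans[OF norm_Ln_le]) auto
    then show ?thesis using eM t2 by simp
  qed
  define k1 where "k1 = real K + 1"
  have k1: "1 \<le> k1" by (simp add: k1_def)
  have z0k: "z0 = of_real k1 * w" by (simp add: z0_def k1_def)
  have e4: "cmod (dlog z0 - (- of_real (pi\<^sup>2 / 12) + of_real k1 * w * of_real (ln 2))) \<le> cmod w * (4 * k1\<^sup>2 * t)"
  proof -
    have "cmod (dlog z0 - (- of_real (pi\<^sup>2 / 12) + of_real k1 * w * of_real (ln 2))) \<le> 2 * k1\<^sup>2 * (cmod w)\<^sup>2"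
      unfolding z0k by (rule dlog_near_0) (use t w k1 in auto)
    also have "\<dots> = cmod w * (2 * k1\<^sup>2 * cmod w)" by (simp add: power2_eq_square)
    also have "\<dots> \<le> cmod w * (2 * k1\<^sup>2 * (2 * t))" by (intro mult_left_mono nw) auto
    finally show ?thesis by simp
  qed
  have e5: "cmod (lfun z0 - of_real (ln 2)) \<le> 4 * k1 * t"
  proof -
    have "cmod (lfun z0 - lfun 0) \<le> 2 * cmod (z0 - 0)"
      by (rule lfun_lipschitz) (use ray[of 0] zero_sigdom in \<open>auto simp: S_def\<close>)
    also have "\<dots> \<le> 2 * (k1 * (2 * t))" using k1 nw by (auto simp: z0k norm_mult intro!: mult_left_mono)
    finally show ?thesis by (simp add: lfun_0)
  qed
  define R1 where "R1 = w * (\<Sum>k<M. lfun (z0 + of_nat k * w)) - (dlog zM - dlog z0) + w / 2 * (lfun zM - lfun z0)"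
  define R4 where "R4 = dlog z0 - (- of_real (pi\<^sup>2 / 12) + of_real k1 * w * of_real (ln 2))"
  define R5 where "R5 = lfun z0 - of_real (ln 2)"
  have half: "cmod (w / 2 * x) \<le> cmod w * c" if "cmod x \<le> c" for x c
  proof -
    have "cmod (w / 2 * x) \<le> cmod w * cmod x" by (simp add: norm_mult norm_divide)
    also have "\<dots> \<le> cmod w * c" using that by (intro mult_left_mono) auto
    finally show ?thesis .
  qed
  define X where "X = (\<Sum>k<M. lfun (z0 + of_nat k * w)) - (of_real (pi\<^sup>2 / 12) / w - of_real ((real K + 1/2) * ln 2))"
  have "w * X = R1 + dlog zM - R4 - w / 2 * lfun zM + w / 2 * R5"
    using w0 by (simp add: X_def R1_def R4_def R5_def k1_def algebra_simps diff_divide_distrib)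
  also have "cmod \<dots> \<le> cmod R1 + cmod (dlog zM) + cmod R4 + cmod (w / 2 * lfun zM) + cmod (w / 2 * R5)"
    by (intro norm_triangle_le norm_triangle_le_diff add_mono order_refl)
  also have "\<dots> \<le> cmod w * (32 * t) + cmod w * t + cmod w * (4 * k1\<^sup>2 * t) + cmod w * t + cmod w * (4 * k1 * t)"
  proof (intro add_mono)
    show "cmod (w / 2 * lfun zM) \<le> cmod w * t" by (rule half[OF e3])
    show "cmod (w / 2 * R5) \<le> cmod w * (4 * k1 * t)" unfolding R5_def by (rule half[OF e5])
  qed (use e1 e2 e4 in \<open>auto simp: R1_def R4_def\<close>)
  also have "\<dots> = cmod w * ((34 + 4 * k1\<^sup>2 + 4 * k1) * t)" by (simp add: algebra_simps)
  finally have "cmod w * cmod X \<le> cmod w * ((34 + 4 * k1\<^sup>2 + 4 * k1) * t)" by (simp add: norm_mult)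
  then have "cmod X \<le> (34 + 4 * k1\<^sup>2 + 4 * k1) * t" using w0 by (simp add: mult_le_cancel_left)
  also have "\<dots> \<le> (80 + 20 * k1\<^sup>2) * t"
  proof (intro mult_right_mono)
    have "k1 * 1 \<le> k1 * k1" using k1 by (intro mult_left_mono) auto
    then have "k1 \<le> k1\<^sup>2" by (simp only: mult_1_right power2_eq_square)
    then show "34 + 4 * k1\<^sup>2 + 4 * k1 \<le> 80 + 20 * k1\<^sup>2" using k1 by linarith
  qed (use t in auto)
  finally have X: "cmod X \<le> (80 + 20 * k1\<^sup>2) * t" .
  have "(\<Sum>k<M. lfun (z0 + of_nat k * w)) = (\<Sum>m = K + 1..K + M. lfun (of_nat m * w))"
    by (rule sum.reindex_bij_witness[of _ "\<lambda>m. m - (K + 1)" "\<lambda>k. k + (K + 1)"]) (auto simp: z0_def algebra_simps of_nat_diff)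
  then show ?thesis using X unfolding X_def k1_def by (simp only:)
qed

section \<open>Major arc: dependence on the bias variable\<close>

text \<open>The logarithm of 1 + exp (i \<theta>) = exp (i \<theta>) (1 + exp (- i \<theta>)). No
  multiple of 2 pi i appears, because the last factor has argument below pi/2 in absolute value and
  |\<theta>| \<le> 1/2.\<close>

lemma lfun_reflect:
  assumes "\<bar>\<theta>\<bar> \<le> 1/2"
  shows "lfun (- (\<i> * of_real \<theta>)) - lfun (\<i> * of_real \<theta>) = \<i> * of_real \<theta>"
proof -
  let ?z = "1 + exp (- (\<i> * of_real \<theta>))"
  have dom: "\<i> * of_real \<theta> \<in> sigdom" using assms by (simp add: sigdom_def)
  have "0 < Re ?z" using Re_one_plus_exp_ge[OF dom] by simp
  then have im: "\<bar>Im (Ln ?z)\<bar> < pi / 2" using Re_Ln_pos_lt one_plus_exp_nz[OF dom] by blast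
  have "Ln (1 + exp (\<i> * of_real \<theta>)) = Ln ?z + \<i> * of_real \<theta>"
  proof (rule Ln_unique)
    show "exp (Ln ?z + \<i> * of_real \<theta>) = 1 + exp (\<i> * of_real \<theta>)"
      using one_plus_exp_nz[OF dom] by (simp add: exp_add exp_minus field_simps)
    show "- pi < Im (Ln ?z + \<i> * of_real \<theta>)" "Im (Ln ?z + \<i> * of_real \<theta>) \<le> pi"
      using im assms pi_gt3 by auto
  qed
  then show ?thesis by (simp add: lfun_def)
qed

lemma sig1_lipschitz:
  assumes "y \<in> sigdom" "z \<in> sigdom"
  shows "cmod (sig1 y - sig1 z) \<le> 4 * cmod (y - z)"
proof (rule field_differentiable_bound[OF convex_sigdom])
  fix x assume x: "x \<in> sigdom"
  then show "(sig1 has_field_derivative sig2 x) (at x within sigdom)" by (rule sig1_deriv)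
  have "exp (- Re x) \<le> 1" using x by (simp add: sigdom_def)
  then have "4 * exp (- Re x) \<le> 4" by simp
  then show "cmod (sig2 x) \<le> 4" by (rule order_trans[OF norm_sig2_le[OF x]])
qed (use assms in auto)

lemma sig1_0: "sig1 0 = 1/2" by (simp add: sig1_def)

lemma lfun_linear_approx:
  assumes "y \<in> sigdom" "z \<in> sigdom"
  shows "cmod (lfun z - (lfun y - (z - y) * sig1 y)) \<le> 4 * (cmod (z - y))\<^sup>2"
proof -
  define f where "f i = (if i = 0 then lfun else if i = 1 then (\<lambda>x. - sig1 x) else (\<lambda>x. - sig2 x))" for i :: nat
  have "cmod (f 0 z - (\<Sum>i\<le>1. f i y * (z - y) ^ i / fact i)) \<le> 4 * cmod (z - y) ^ Suc 1 / fact 1"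
  proof (rule complex_Taylor[OF convex_sigdom])
    fix i :: nat and x assume x: "x \<in> sigdom"
    have "4 * exp (- Re x) \<le> 4" using x by (simp add: sigdom_def)
    then have "cmod (sig2 x) \<le> 4" by (rule order_trans[OF norm_sig2_le[OF x]])
    then show "cmod (f (Suc 1) x) \<le> 4" by (simp add: f_def)
    assume "i \<le> 1"
    then consider "i = 0" | "i = 1" by linarith
    then show "(f i has_field_derivative f (Suc i) x) (at x within sigdom)"
      by cases (use x in \<open>auto simp: f_def intro!: lfun_deriv DERIV_minus sig1_deriv\<close>)
  qed (use assms in auto)
  then show ?thesis by (simp add: f_def power2_eq_square algebra_simps)
qed

lemma shifted_ray_sigdom:
  assumes "\<bar>\<phi>\<bar> \<le> t" "0 \<le> x" "\<bar>\<theta>\<bar> \<le> 1/2"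
  shows "of_real x * Complex t (- \<phi>) - \<i> * of_real \<theta> \<in> sigdom"
proof -
  have "x * \<bar>\<phi>\<bar> \<le> x * t" using assms by (intro mult_left_mono) auto
  moreover have "0 \<le> x * t" using assms by simp
  moreover have "\<bar>x * \<phi> + \<theta>\<bar> \<le> x * \<bar>\<phi>\<bar> + \<bar>\<theta>\<bar>" using assms(2) by (metis abs_mult abs_of_nonneg abs_triangle_ineq)
  ultimately show ?thesis using assms(3) by (auto simp: sigdom_def)
qed

text \<open>Euler-Maclaurin with step N w for - \<open>sig1\<close>, the derivative of
  \<open>lfun\<close>, from a w - i \<theta>. Expanding \<open>lfun\<close> there about - i \<theta>
  produces the term with a / N, and the endpoint correction the 1/2. Only w is treated as small, so
  the error is uniform in \<theta>.\<close>

lemma sig1_sum_asymp: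
  fixes a N L :: nat and t \<phi> \<theta> :: real
  assumes t: "0 < t" "real N * t \<le> 1" "\<bar>\<phi>\<bar> \<le> t" and w: "w = Complex t (- \<phi>)" and N: "1 \<le> N"
    and L: "exp (- (real L * t)) \<le> t\<^sup>2 / 2" and a: "1 \<le> a" and \<theta>: "\<bar>\<theta>\<bar> \<le> 1/2"
  shows "cmod ((\<Sum>k<L. sig1 (of_nat (a + k * N) * w - \<i> * of_real \<theta>))
     - (lfun (- (\<i> * of_real \<theta>)) / (of_nat N * w) + (1/2 - of_nat a / of_nat N) * sig1 (- (\<i> * of_real \<theta>))))
     \<le> (128 * real N + 8 * (real a)\<^sup>2 + 4 * real a + 2) * t"
proof -
  define h where "h = of_nat N * w"
  define y where "y = - (\<i> * complex_of_real \<theta>)"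
  define z0 where "z0 = of_nat a * w + y"
  define zL where "zL = z0 + of_nat L * h"
  have tN: "t \<le> real N * t" using t N by simp
  then have t1: "t \<le> 1" using t by linarith
  have rw: "Re w = t" using w by simp
  have nw: "cmod w \<le> 2 * t" "t \<le> cmod w" using norm_Complex_le norm_Complex_ge t w by auto
  have rh: "Re h = real N * t" by (simp add: h_def rw)
  have h0: "h \<noteq> 0" using N nw t by (auto simp: h_def)
  have nh: "cmod h = real N * cmod w" by (simp add: h_def norm_mult)
  have th: "t \<le> cmod h" using nw N mult_right_mono[of 1 "real N" "cmod w"] by (simp add: nh)
  have dom: "of_real x * w + y \<in> sigdom" if "0 \<le> x" for x
    using shifted_ray_sigdom[OF t(3) that \<theta>] by (simp add: w y_def)
  have zk: "z0 + of_nat k * h = of_real (real (a + k * N)) * w + y" for k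
    by (simp add: z0_def h_def algebra_simps)
  have zkd: "z0 + of_nat k * h \<in> sigdom" for k unfolding zk by (rule dom) simp
  have yd: "y \<in> sigdom" using dom[of 0] by simp
  have z0d: "z0 \<in> sigdom" using zkd[of 0] by simp
  have zLd: "zL \<in> sigdom" using zkd[of L] by (simp add: zL_def)
  have "cmod (h * (\<Sum>k<L. - sig1 (z0 + of_nat k * h)) - (lfun (z0 + of_nat L * h) - lfun z0)
             + h / 2 * (- sig1 (z0 + of_nat L * h) - - sig1 z0)) \<le> 16 * cmod h ^ 3 * (2 * exp (- Re z0) / Re h)"
  proof (rule euler_maclaurin_sum[where S = sigdom and ?g2.0 = "\<lambda>z. - sig2 z" and ?g3.0 = "\<lambda>z. - sig3 z"])
  qed (use zkd t N rh in \<open>auto intro!: convex_sigdom lfun_deriv sig1_deriv sig2_deriv DERIV_minus norm_sig3_le\<close>)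
  also have "\<dots> \<le> 16 * cmod h ^ 3 * (2 * 1 / Re h)"
    using z0d rh t by (intro mult_left_mono divide_right_mono) (auto simp: sigdom_def)
  also have "\<dots> = cmod h * (32 * (real N * cmod w * (real N * cmod w)) / (real N * t))"
    by (simp add: power3_eq_cube rh nh)
  also have "\<dots> \<le> cmod h * (32 * (real N * (2 * t) * (real N * (2 * t))) / (real N * t))"
    by (intro mult_left_mono divide_right_mono mult_mono) (use nw t in auto)
  also have "\<dots> = cmod h * (128 * real N * t)" using t N by simp
  finally have e1: "cmod (h * (\<Sum>k<L. - sig1 (z0 + of_nat k * h)) - (lfun zL - lfun z0) + h / 2 * (- sig1 zL - - sig1 z0)) \<le> cmod h * (128 * real N * t)"
    unfolding zL_def .
  have rL: "real L * t < Re zL"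
  proof -
    have "Re zL = real a * t + real L * (real N * t)" by (simp add: zL_def z0_def rh rw y_def)
    moreover have "real L * t \<le> real L * (real N * t)" by (intro mult_left_mono tN) auto
    moreover have "0 < real a * t" using a t by simp
    ultimately show ?thesis by linarith
  qed
  then have "exp (- Re zL) < exp (- (real L * t))" by simp
  then have eL: "exp (- Re zL) < t\<^sup>2 / 2" using L by linarith
  have t2: "t\<^sup>2 \<le> t" using t t1 by (simp add: power2_eq_square)
  have e2: "cmod (lfun zL) \<le> cmod h * t"
  proof -
    have "cmod (exp (- zL)) < 1/2" using eL t2 t1 by simp
    then have "cmod (lfun zL) \<le> 2 * exp (- Re zL)"
      unfolding lfun_def by (rule order_trans[OF norm_Ln_le]) auto
    also have "\<dots> \<le> t * t" using eL by (simp add: power2_eq_square)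
    also have "\<dots> \<le> cmod h * t" using th t by (intro mult_right_mono) auto
    finally show ?thesis .
  qed
  have e3: "cmod (sig1 zL) \<le> t" using norm_sig1_le[OF zLd] eL t2 by linarith
  have e4: "cmod (lfun z0 - (lfun y - of_nat a * w * sig1 y)) \<le> cmod h * (8 * (real a)\<^sup>2 * t)"
  proof -
    have "cmod (lfun z0 - (lfun y - (z0 - y) * sig1 y)) \<le> 4 * (cmod (z0 - y))\<^sup>2"
      by (rule lfun_linear_approx[OF yd z0d])
    also have "\<dots> = 4 * (real a)\<^sup>2 * (cmod w * cmod w)"
      by (simp add: z0_def norm_mult power_mult_distrib power2_eq_square)
    also have "\<dots> \<le> 4 * (real a)\<^sup>2 * (cmod h * (2 * t))"
      by (intro mult_left_mono mult_mono) (use nw N t mult_right_mono[of 1 "real N" "cmod w"] in \<open>auto simp: nh\<close>)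
    finally show ?thesis by (simp add: z0_def mult_ac)
  qed
  have e5: "cmod (sig1 z0 - sig1 y) \<le> 8 * real a * t"
  proof -
    have "cmod (sig1 z0 - sig1 y) \<le> 4 * cmod (z0 - y)" by (rule sig1_lipschitz[OF z0d yd])
    also have "cmod (z0 - y) = real a * cmod w" by (simp add: z0_def norm_mult)
    also have "4 * (real a * cmod w) \<le> 4 * (real a * (2 * t))" using nw by (intro mult_left_mono) auto
    finally show ?thesis by simp
  qed
  define \<Sigma> where "\<Sigma> = (\<Sum>k<L. sig1 (z0 + of_nat k * h))"
  define R1 where "R1 = h * (\<Sum>k<L. - sig1 (z0 + of_nat k * h)) - (lfun zL - lfun z0) + h / 2 * (- sig1 zL - - sig1 z0)"
  define R4 where "R4 = lfun z0 - (lfun y - of_nat a * w * sig1 y)"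
  define R5 where "R5 = sig1 z0 - sig1 y"
  define X where "X = \<Sigma> - (lfun y / h + (1/2 - of_nat a / of_nat N) * sig1 y)"
  have aw: "of_nat a / of_nat N * h = of_nat a * w" using N by (simp add: h_def)
  have "h * X = h * \<Sigma> - lfun y - h / 2 * sig1 y + of_nat a * w * sig1 y"
    unfolding aw[symmetric] using h0 by (simp add: X_def algebra_simps)
  also have "\<dots> = - R1 - lfun zL + R4 - h / 2 * sig1 zL + h / 2 * R5"
    by (simp add: R1_def R4_def R5_def \<Sigma>_def sum_negf algebra_simps diff_divide_distrib)
  also have "cmod \<dots> \<le> cmod (- R1) + cmod (lfun zL) + cmod R4 + cmod (h / 2 * sig1 zL) + cmod (h / 2 * R5)"
    by (intro norm_triangle_le norm_triangle_le_diff add_mono order_refl)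
  also have "\<dots> \<le> cmod h * (128 * real N * t) + cmod h * t + cmod h * (8 * (real a)\<^sup>2 * t) + cmod h * t + cmod h * (4 * real a * t)"
  proof (intro add_mono)
    show "cmod (h / 2 * sig1 zL) \<le> cmod h * t"
    proof -
      have "cmod (h / 2 * sig1 zL) \<le> cmod h * cmod (sig1 zL)" by (simp add: norm_mult norm_divide)
      also have "\<dots> \<le> cmod h * t" using e3 by (intro mult_left_mono) auto
      finally show ?thesis .
    qed
    show "cmod (h / 2 * R5) \<le> cmod h * (4 * real a * t)"
    proof -
      have "cmod (h / 2 * R5) = cmod h / 2 * cmod (R5)" by (simp add: norm_mult norm_divide)
      also have "\<dots> \<le> cmod h / 2 * (8 * real a * t)" using e5 by (intro mult_left_mono) (auto simp: R5_def)
      also have "\<dots> = cmod h * (4 * real a * t)" by simp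
      finally show ?thesis .
    qed
    show "cmod (- R1) \<le> cmod h * (128 * real N * t)" unfolding norm_minus_cancel R1_def by (rule e1)
    show "cmod R4 \<le> cmod h * (8 * (real a)\<^sup>2 * t)" unfolding R4_def by (rule e4)
  qed (rule e2)
  also have "\<dots> = cmod h * ((128 * real N + 8 * (real a)\<^sup>2 + 4 * real a + 2) * t)" by (simp add: algebra_simps)
  finally have "cmod h * cmod X \<le> cmod h * ((128 * real N + 8 * (real a)\<^sup>2 + 4 * real a + 2) * t)" by (simp add: norm_mult)
  then have "cmod X \<le> (128 * real N + 8 * (real a)\<^sup>2 + 4 * real a + 2) * t" using h0 by (simp add: mult_le_cancel_left)
  moreover have "\<Sigma> = (\<Sum>k<L. sig1 (of_nat (a + k * N) * w - \<i> * of_real \<theta>))"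
    by (simp add: \<Sigma>_def z0_def h_def y_def algebra_simps)
  ultimately show ?thesis by (simp add: X_def y_def h_def)
qed

text \<open>Dominates both the coefficient of t coming from two uses of
  \<open>sig1_sum_asymp\<close> and the coefficient of |\<theta>| coming from replacing sig1 (i x)
  and sig1 (- i x) by 1/2.\<close>

definition biasC :: "nat \<Rightarrow> nat \<Rightarrow> nat \<Rightarrow> real" where
  "biasC N a b = 256 * real N + 8 * (real a)\<^sup>2 + 8 * (real b)\<^sup>2 + 8 * real a + 8 * real b + 8"

text \<open>In the derivative of \<open>H\<close> the terms of order \<open>1 / w\<close> add up to exactly \<open>\<zeta> / (N w)\<close> by the reflection
  identity of \<open>lfun\<close>, so no further expansion in \<open>\<theta>\<close> is required.\<close>

lemma log_bias_asymp:
  fixes a b N L :: nat and t \<phi> \<theta> :: real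
  assumes t: "0 < t" "real N * t \<le> 1" "\<bar>\<phi>\<bar> \<le> t" and w: "w = Complex t (- \<phi>)" and N: "1 \<le> N"
    and L: "exp (- (real L * t)) \<le> t\<^sup>2 / 2" and a: "1 \<le> a" and b: "1 \<le> b" and \<theta>: "\<bar>\<theta>\<bar> \<le> 1/2"
  defines "H \<equiv> (\<lambda>\<zeta>. (\<Sum>k<L. lfun (of_nat (a + k * N) * w - \<zeta>)) + (\<Sum>k<L. lfun (of_nat (b + k * N) * w + \<zeta>)))"
  shows "cmod (H (\<i> * of_real \<theta>) - H 0 -
      (- of_real (\<theta>\<^sup>2) / (2 * of_nat N * w) + \<i> * of_real (\<theta> * (real b - real a) / (2 * real N))))
    \<le> biasC N a b * (\<bar>\<theta>\<bar> + t) * \<bar>\<theta>\<bar>"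
proof -
  \<comment> \<open>\<open>H\<close> minus its predicted value, as a function of \<zeta> = i
    \<theta> (so \<zeta>^2 = - \<theta>^2). A bound on the derivative along the segment from 0 then
    supplies the factor |\<theta>|.\<close>
  define G where "G \<zeta> = H \<zeta> - \<zeta>\<^sup>2 / (2 * of_nat N * w) - \<zeta> * of_real ((real b - real a) / (2 * real N))" for \<zeta>
  define G' where "G' \<zeta> = (\<Sum>k<L. sig1 (of_nat (a + k * N) * w - \<zeta>)) - (\<Sum>k<L. sig1 (of_nat (b + k * N) * w + \<zeta>))
     - \<zeta> / (of_nat N * w) - of_real ((real b - real a) / (2 * real N))" for \<zeta>
  have w0: "w \<noteq> 0" using t w by (auto simp: complex_eq_iff)
  have seg: "\<exists>x. \<zeta> = \<i> * of_real x \<and> \<bar>x\<bar> \<le> \<bar>\<theta>\<bar>" if \<zeta>: "\<zeta> \<in> closed_segment 0 (\<i> * of_real \<theta>)" for \<zeta>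
  proof -
    obtain u where "0 \<le> u" "u \<le> 1" "\<zeta> = (1 - u) *\<^sub>R 0 + u *\<^sub>R (\<i> * of_real \<theta>)"
      using \<zeta> unfolding in_segment by blast
    then have u: "0 \<le> u" "u \<le> 1" "\<zeta> = u *\<^sub>R (\<i> * of_real \<theta>)" by simp_all
    have "u * \<bar>\<theta>\<bar> \<le> 1 * \<bar>\<theta>\<bar>" by (rule mult_right_mono) (use u in auto)
    then show ?thesis using u by (intro exI[of _ "u * \<theta>"]) (auto simp: scaleR_conv_of_real abs_mult)
  qed
  have "cmod (G (\<i> * of_real \<theta>) - G 0) \<le> (biasC N a b * (\<bar>\<theta>\<bar> + t)) * cmod (\<i> * of_real \<theta> - 0)"
  proof (rule field_differentiable_bound[where S = "closed_segment 0 (\<i> * of_real \<theta>)" and f' = G'])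
    fix \<zeta> assume "\<zeta> \<in> closed_segment 0 (\<i> * of_real \<theta>)"
    then obtain x where x: "\<zeta> = \<i> * of_real x" "\<bar>x\<bar> \<le> \<bar>\<theta>\<bar>" using seg by blast
    have x2: "\<bar>x\<bar> \<le> 1/2" "\<bar>- x\<bar> \<le> 1/2" using x \<theta> by auto
    have da: "of_nat (a + k * N) * w - \<zeta> \<in> sigdom" for k
      using shifted_ray_sigdom[OF t(3) _ x2(1), of "real (a + k * N)"] w x by simp
    have db: "of_nat (b + k * N) * w + \<zeta> \<in> sigdom" for k
      using shifted_ray_sigdom[OF t(3) _ x2(2), of "real (b + k * N)"] w x by simp
    show "(G has_field_derivative G' \<zeta>) (at \<zeta> within closed_segment 0 (\<i> * of_real \<theta>))"
    proof (rule has_field_derivative_at_within)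
      have A: "((\<lambda>\<zeta>. lfun (of_nat (a + k * N) * w - \<zeta>)) has_field_derivative sig1 (of_nat (a + k * N) * w - \<zeta>)) (at \<zeta>)" for k
      proof -
        have "((\<lambda>\<zeta>. of_nat (a + k * N) * w - \<zeta>) has_field_derivative - 1) (at \<zeta>)" by (auto intro!: derivative_eq_intros)
        from DERIV_chain2[OF lfun_deriv[OF da] this] show ?thesis by simp
      qed
      have B: "((\<lambda>\<zeta>. lfun (of_nat (b + k * N) * w + \<zeta>)) has_field_derivative - sig1 (of_nat (b + k * N) * w + \<zeta>)) (at \<zeta>)" for k
      proof -
        have "((\<lambda>\<zeta>. of_nat (b + k * N) * w + \<zeta>) has_field_derivative 1) (at \<zeta>)" by (auto intro!: derivative_eq_intros)
        from DERIV_chain2[OF lfun_deriv[OF db] this] show ?thesis by simp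
      qed
      have C: "((\<lambda>\<zeta>. \<zeta>\<^sup>2 / (2 * of_nat N * w)) has_field_derivative \<zeta> / (of_nat N * w)) (at \<zeta>)"
        using w0 N by (auto intro!: derivative_eq_intros simp: field_simps)
      have D: "((\<lambda>\<zeta>. \<zeta> * c) has_field_derivative c) (at \<zeta>)" for c
        by (auto intro!: derivative_eq_intros)
      have "(G has_field_derivative (\<Sum>k<L. sig1 (of_nat (a + k * N) * w - \<zeta>)) + (\<Sum>k<L. - sig1 (of_nat (b + k * N) * w + \<zeta>))
         - \<zeta> / (of_nat N * w) - of_real ((real b - real a) / (2 * real N))) (at \<zeta>)"
        unfolding G_def [abs_def] H_def by (intro DERIV_diff DERIV_add DERIV_sum A B C D)
      then show "(G has_field_derivative G' \<zeta>) (at \<zeta>)" by (simp add: G'_def sum_negf)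
    qed
    define SA where "SA = (\<Sum>k<L. sig1 (of_nat (a + k * N) * w - \<i> * of_real x)) -
      (lfun (- (\<i> * of_real x)) / (of_nat N * w) + (1/2 - of_nat a / of_nat N) * sig1 (- (\<i> * of_real x)))"
    define SB where "SB = (\<Sum>k<L. sig1 (of_nat (b + k * N) * w - \<i> * of_real (- x))) -
      (lfun (- (\<i> * of_real (- x))) / (of_nat N * w) + (1/2 - of_nat b / of_nat N) * sig1 (- (\<i> * of_real (- x))))"
    have SA: "cmod SA \<le> (128 * real N + 8 * (real a)\<^sup>2 + 4 * real a + 2) * t"
      unfolding SA_def by (rule sig1_sum_asymp[OF t w N L a x2(1)])
    have SB: "cmod SB \<le> (128 * real N + 8 * (real b)\<^sup>2 + 4 * real b + 2) * t"
      unfolding SB_def by (rule sig1_sum_asymp[OF t w N L b x2(2)])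
    have dx: "- (\<i> * of_real x) \<in> sigdom" "\<i> * of_real x \<in> sigdom" using x2 by (auto simp: sigdom_def)
    define TA where "TA = sig1 (- (\<i> * of_real x)) - 1/2"
    define TB where "TB = sig1 (\<i> * of_real x) - 1/2"
    have TA: "cmod TA \<le> 4 * \<bar>\<theta>\<bar>" and TB: "cmod TB \<le> 4 * \<bar>\<theta>\<bar>"
      using sig1_lipschitz[OF dx(1) zero_sigdom] sig1_lipschitz[OF dx(2) zero_sigdom] x
      by (simp_all add: TA_def TB_def sig1_0 norm_mult)
    define ca where "ca = (1/2 - of_nat a / of_nat N :: complex)"
    define cb where "cb = (1/2 - of_nat b / of_nat N :: complex)"
    have le: "real c / real N \<le> real c" for c using N frac_le[of "real c" "real c" 1 "real N"] by simp
    have nca: "cmod (1/2 - of_nat c / of_nat N) \<le> 1/2 + real c" for c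
      using norm_triangle_ineq4[of "1/2 :: complex" "of_nat c / of_nat N"] le[of c] by (simp add: norm_divide)
    \<comment> \<open>The terms in 1 / w cancel against \<zeta> / (N w) by
      \<open>lfun_reflect\<close>. At sig1 = 1/2 the remaining terms give ca/2 - cb/2 = (b - a) / (2
      N), which is also subtracted, so only errors are left.\<close>
    have G'eq: "G' \<zeta> = SA - SB + ca * TA - cb * TB"
    proof -
      have "(lfun (- (\<i> * of_real x)) - lfun (\<i> * of_real x)) / (of_nat N * w) = \<zeta> / (of_nat N * w)"
        using lfun_reflect[OF x2(1)] x by simp
      then have r: "lfun (- (\<i> * of_real x)) / (of_nat N * w) - lfun (\<i> * of_real x) / (of_nat N * w) = \<zeta> / (of_nat N * w)"
        by (simp add: diff_divide_distrib)
      have q: "of_real ((real b - real a) / (2 * real N)) = ca / 2 - cb / 2"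
        using N by (simp add: ca_def cb_def field_simps)
      have "G' \<zeta> = (\<Sum>k<L. sig1 (of_nat (a + k * N) * w - \<zeta>)) - (\<Sum>k<L. sig1 (of_nat (b + k * N) * w + \<zeta>))
          - (lfun (- (\<i> * of_real x)) / (of_nat N * w) - lfun (\<i> * of_real x) / (of_nat N * w)) - (ca / 2 - cb / 2)"
        unfolding G'_def q r ..
      then show ?thesis
        unfolding SA_def SB_def TA_def TB_def ca_def[symmetric] cb_def[symmetric]
        by (simp add: x(1) algebra_simps)
    qed
    have "cmod (G' \<zeta>) \<le> cmod SA + cmod SB + cmod (ca * TA) + cmod (cb * TB)"
      unfolding G'eq by (intro norm_triangle_le norm_triangle_le_diff add_mono order_refl)
    also have "\<dots> \<le> (128 * real N + 8 * (real a)\<^sup>2 + 4 * real a + 2) * t + (128 * real N + 8 * (real b)\<^sup>2 + 4 * real b + 2) * t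
       + (1/2 + real a) * (4 * \<bar>\<theta>\<bar>) + (1/2 + real b) * (4 * \<bar>\<theta>\<bar>)"
      unfolding norm_mult by (intro add_mono SA SB mult_mono TA TB) (use nca in \<open>auto simp: ca_def cb_def\<close>)
    also have "\<dots> \<le> biasC N a b * (\<bar>\<theta>\<bar> + t)"
    proof -
      have "(128 * real N + 8 * (real a)\<^sup>2 + 4 * real a + 2) * t + (128 * real N + 8 * (real b)\<^sup>2 + 4 * real b + 2) * t
          \<le> biasC N a b * t"
        unfolding distrib_right[symmetric] by (rule mult_right_mono) (use t in \<open>auto simp: biasC_def\<close>)
      moreover have "(1/2 + real a) * (4 * \<bar>\<theta>\<bar>) + (1/2 + real b) * (4 * \<bar>\<theta>\<bar>) \<le> biasC N a b * \<bar>\<theta>\<bar>"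
      proof -
        have "(1/2 + real a) * (4 * \<bar>\<theta>\<bar>) + (1/2 + real b) * (4 * \<bar>\<theta>\<bar>) = (4 + 4 * real a + 4 * real b) * \<bar>\<theta>\<bar>"
          by (simp add: algebra_simps)
        also have "\<dots> \<le> biasC N a b * \<bar>\<theta>\<bar>" by (rule mult_right_mono) (auto simp: biasC_def)
        finally show ?thesis .
      qed
      ultimately show ?thesis by (simp add: distrib_left)
    qed
    finally show "cmod (G' \<zeta>) \<le> biasC N a b * (\<bar>\<theta>\<bar> + t)" .
  qed auto
  moreover have "G (\<i> * of_real \<theta>) - G 0 = H (\<i> * of_real \<theta>) - H 0 -
      (- of_real (\<theta>\<^sup>2) / (2 * of_nat N * w) + \<i> * of_real (\<theta> * (real b - real a) / (2 * real N)))"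
    by (simp add: G_def power_mult_distrib algebra_simps)
  ultimately show ?thesis by (simp add: norm_mult)
qed

section \<open>Fourier inversion and the sign kernel\<close>

text \<open>Used over a finite set of parts, which turns the expansion into a finite sum over
  subsets and removes every question of convergence.\<close>

definition bias_gf :: "(nat \<Rightarrow> int) \<Rightarrow> nat set \<Rightarrow> real \<Rightarrow> complex \<Rightarrow> complex" where
  "bias_gf ch I \<theta> w = (\<Prod>m\<in>I. 1 + exp (\<i> * of_real (\<theta> * of_int (ch m)) - of_nat m * w))"

lemma bias_gf_expand:
  assumes "finite I"
  shows "bias_gf ch I \<theta> w = (\<Sum>A\<in>Pow I. exp (\<i> * of_real (\<theta> * of_int (\<Sum>m\<in>A. ch m)) - of_nat (\<Sum>m\<in>A. m) * w))"
proof -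
  have "bias_gf ch I \<theta> w = (\<Prod>m\<in>I. exp (\<i> * of_real (\<theta> * of_int (ch m)) - of_nat m * w) + 1)"
    by (simp add: bias_gf_def add.commute)
  also have "\<dots> = (\<Sum>A\<in>Pow I. \<Prod>m\<in>A. exp (\<i> * of_real (\<theta> * of_int (ch m)) - of_nat m * w))"
    by (subst prod_add[OF assms]) simp
  also have "\<dots> = (\<Sum>A\<in>Pow I. exp (\<i> * of_real (\<theta> * of_int (\<Sum>m\<in>A. ch m)) - of_nat (\<Sum>m\<in>A. m) * w))"
  proof (rule sum.cong[OF refl])
    fix A assume "A \<in> Pow I"
    then have A: "finite A" using assms finite_subset by auto
    show "(\<Prod>m\<in>A. exp (\<i> * of_real (\<theta> * of_int (ch m)) - of_nat m * w))
        = exp (\<i> * of_real (\<theta> * of_int (\<Sum>m\<in>A. ch m)) - of_nat (\<Sum>m\<in>A. m) * w)"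
      by (subst exp_sum[OF A, symmetric])
         (simp add: sum_subtractf sum_distrib_left sum_distrib_right)
  qed
  finally show ?thesis .
qed

lemma has_integral_exp_circle:
  fixes k :: int
  shows "((\<lambda>\<phi>. exp (of_int k * Complex t (- \<phi>))) has_integral (if k = 0 then 2 * of_real pi else 0)) {- pi..pi}"
proof (cases "k = 0")
  case True
  then show ?thesis using has_integral_const_real[of "1 :: complex" "- pi" pi] by (simp add: scaleR_conv_of_real)
next
  case False
  define g where "g \<phi> = exp (of_int k * Complex t (- \<phi>)) / (- \<i> * of_int k)" for \<phi>
  have "((\<lambda>\<phi>. exp (of_int k * Complex t (- \<phi>))) has_integral g pi - g (- pi)) {- pi..pi}"
  proof (rule fundamental_theorem_of_calculus)
    fix x assume "x \<in> {- pi..pi}"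
    have e: "Complex t (- \<phi>) = of_real t - \<i> * of_real \<phi>" for \<phi> by (simp add: complex_eq_iff)
    have "((\<lambda>z. exp (of_int k * (of_real t - \<i> * z)) / (- \<i> * of_int k)) has_field_derivative exp (of_int k * (of_real t - \<i> * of_real x))) (at (of_real x))"
      using False by (auto intro!: derivative_eq_intros)
    then have "((\<lambda>\<phi>. exp (of_int k * (of_real t - \<i> * of_real \<phi>)) / (- \<i> * of_int k)) has_vector_derivative exp (of_int k * (of_real t - \<i> * of_real x))) (at x)"
      by (rule has_vector_derivative_real_field)
    then show "(g has_vector_derivative exp (of_int k * Complex t (- x))) (at x within {- pi..pi})"
      unfolding g_def [abs_def] e by (rule has_vector_derivative_at_within)
  qed auto
  moreover have "g pi = g (- pi)"
  proof -
    have "of_int k * Complex t pi = of_int k * Complex t (- pi) + of_int (2 * k) * (of_real pi * \<i>)"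
      by (simp add: complex_eq_iff)
    moreover have "exp (of_int (2 * k) * (of_real pi * \<i>)) = 1"
      unfolding exp_eq_1 by (intro conjI exI[of _ k]) simp_all
    ultimately show ?thesis by (simp add: g_def exp_add)
  qed
  ultimately show ?thesis using False by simp
qed

text \<open>The coefficient of exp (- n w) in \<open>bias_gf\<close>; up to normalisation, the
  characteristic function of the excess on the subsets of \<open>I\<close> with sum
  \<open>n\<close>.\<close>

definition char_coeff :: "(nat \<Rightarrow> int) \<Rightarrow> nat set \<Rightarrow> nat \<Rightarrow> real \<Rightarrow> complex" where
  "char_coeff ch I n \<theta> = (\<Sum>A | A \<subseteq> I \<and> (\<Sum>m\<in>A. m) = n. exp (\<i> * of_real (\<theta> * of_int (\<Sum>m\<in>A. ch m))))"

lemma has_integral_bias_gf: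
  assumes "finite I"
  shows "((\<lambda>\<phi>. bias_gf ch I \<theta> (Complex t (- \<phi>)) * exp (of_nat n * Complex t (- \<phi>)))
     has_integral (2 * of_real pi * char_coeff ch I n \<theta>)) {- pi..pi}"
proof -
  define E where "E A = exp (\<i> * complex_of_real (\<theta> * of_int (\<Sum>m\<in>A. ch m)))" for A
  define k where "k A = int n - int (\<Sum>m\<in>A. m)" for A
  have "((\<lambda>\<phi>. \<Sum>A\<in>Pow I. E A * exp (of_int (k A) * Complex t (- \<phi>))) has_integral
      (\<Sum>A\<in>Pow I. E A * (if k A = 0 then 2 * of_real pi else 0))) {- pi..pi}"
    by (intro has_integral_sum has_integral_mult_right has_integral_exp_circle) (use assms in auto)
  moreover have "(\<Sum>A\<in>Pow I. E A * exp (of_int (k A) * Complex t (- \<phi>)))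
      = bias_gf ch I \<theta> (Complex t (- \<phi>)) * exp (of_nat n * Complex t (- \<phi>))" for \<phi>
    unfolding bias_gf_expand[OF assms] sum_distrib_right
    by (rule sum.cong[OF refl]) (simp add: E_def k_def exp_add[symmetric] algebra_simps)
  moreover have "(\<Sum>A\<in>Pow I. E A * (if k A = 0 then 2 * of_real pi else 0)) = 2 * of_real pi * char_coeff ch I n \<theta>"
  proof -
    have "(\<Sum>A\<in>Pow I. E A * (if k A = 0 then 2 * of_real pi else 0)) = (\<Sum>A\<in>Pow I. if (\<Sum>m\<in>A. m) = n then E A * (2 * of_real pi) else 0)"
      by (rule sum.cong[OF refl]) (auto simp: k_def simp del: of_nat_sum)
    also have "\<dots> = (\<Sum>A | A \<in> Pow I \<and> (\<Sum>m\<in>A. m) = n. E A * (2 * of_real pi))"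
      using assms by (subst sum.inter_filter[symmetric]) auto
    finally show ?thesis by (simp add: char_coeff_def E_def sum_distrib_left mult.commute)
  qed
  ultimately show ?thesis by simp
qed

section \<open>Partitions into distinct parts as finite sets\<close>

definition bias_char :: "nat \<Rightarrow> nat \<Rightarrow> nat \<Rightarrow> nat \<Rightarrow> int" where
  "bias_char \<alpha> \<beta> N m = (if [m = \<alpha>] (mod N) then 1 else if [m = \<beta>] (mod N) then - 1 else 0)"

lemma sum_bias_char:
  assumes "finite A" "\<not> [\<alpha> = \<beta>] (mod N)"
  shows "(\<Sum>m\<in>A. bias_char \<alpha> \<beta> N m) = int (card {m\<in>A. [m = \<alpha>] (mod N)}) - int (card {m\<in>A. [m = \<beta>] (mod N)})"
proof -
  have "\<not> ([m = \<alpha>] (mod N) \<and> [m = \<beta>] (mod N))" for m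
    using assms(2) cong_trans cong_sym by blast
  then have "bias_char \<alpha> \<beta> N m = (if [m = \<alpha>] (mod N) then 1 else 0) - (if [m = \<beta>] (mod N) then 1 else 0)" for m
    unfolding bias_char_def by auto
  then show ?thesis using assms(1)
    by (simp add: sum_subtractf sum.inter_filter[symmetric])
qed

text \<open>No part exceeds the sum n, so \<open>I\<close> may be any set between these bounds; this
  freedom allows a choice consisting of complete residue blocks.\<close>

lemma d_eq_card:
  assumes "\<not> [\<alpha> = \<beta>] (mod N)" "{K<..n} \<subseteq> I" "I \<subseteq> {K<..}"
  shows "d K \<alpha> \<beta> N n = card {A. A \<subseteq> I \<and> (\<Sum>m\<in>A. m) = n \<and> 0 < (\<Sum>m\<in>A. bias_char \<alpha> \<beta> N m)}"
  unfolding d_def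
proof (rule bij_betw_same_card[of set_mset], rule bij_betw_byWitness[where f' = mset_set])
  have mset: "mset_set (set_mset p) = p" if "distinct_parts p" for p :: "nat multiset"
  proof (rule multiset_eqI)
    fix x show "count (mset_set (set_mset p)) x = count p x"
    proof (cases "x \<in># p")
      case True
      then have "count p x = 1"
      proof -
        have "count p x \<le> 1" using that unfolding distinct_parts_def by blast
        moreover have "count p x \<noteq> 0" using True by (simp only: not_in_iff[symmetric] not_not)
        ultimately show ?thesis by linarith
      qed
      then show ?thesis using True by simp
    qed (simp add: not_in_iff)
  qed
  have cnt: "int (parts_congruent a N (mset_set A)) = int (card {m\<in>A. [m = a] (mod N)})" if "finite A" for a and A :: "nat set"
    using that by (simp add: parts_congruent_def filter_mset_mset_set)
  have iff: "parts_congruent \<beta> N (mset_set A) < parts_congruent \<alpha> N (mset_set A) \<longleftrightarrow> 0 < (\<Sum>m\<in>A. bias_char \<alpha> \<beta> N m)"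
    if "finite A" for A
    using cnt[OF that, of \<alpha>] cnt[OF that, of \<beta>] unfolding sum_bias_char[OF that assms(1)] by linarith
  show "\<forall>p\<in>bias_partitions K \<alpha> \<beta> N n. mset_set (set_mset p) = p"
    using mset by (auto simp: bias_partitions_def)
  \<comment> \<open>A sum over an infinite set is 0 by default, which contradicts a positive
    excess.\<close>
  have fin: "finite A" if "(\<Sum>m\<in>A. m) = n" "A \<subseteq> I" "A \<noteq> {}" "0 < (\<Sum>m\<in>A. bias_char \<alpha> \<beta> N m)" for A
    using that by (metis less_irrefl sum.infinite)
  show "\<forall>A\<in>{A. A \<subseteq> I \<and> (\<Sum>m\<in>A. m) = n \<and> 0 < (\<Sum>m\<in>A. bias_char \<alpha> \<beta> N m)}. set_mset (mset_set A) = A"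
  proof
    fix A assume "A \<in> {A. A \<subseteq> I \<and> (\<Sum>m\<in>A. m) = n \<and> 0 < (\<Sum>m\<in>A. bias_char \<alpha> \<beta> N m)}"
    then have "finite A" using fin by (cases "A = {}") auto
    then show "set_mset (mset_set A) = A" by simp
  qed
  show "set_mset ` bias_partitions K \<alpha> \<beta> N n \<subseteq> {A. A \<subseteq> I \<and> (\<Sum>m\<in>A. m) = n \<and> 0 < (\<Sum>m\<in>A. bias_char \<alpha> \<beta> N m)}"
  proof (rule image_subsetI, rule CollectI)
    fix p assume p: "p \<in> bias_partitions K \<alpha> \<beta> N n"
    then have e: "mset_set (set_mset p) = p" and s: "\<Sum>\<^sub># p = n"
      using mset by (auto simp: bias_partitions_def is_partition_of_def)
    have "(\<Sum>m\<in>set_mset p. m) = \<Sum>\<^sub># (mset_set (set_mset p))" by (simp add: sum_unfold_sum_mset)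
    then have sum: "(\<Sum>m\<in>set_mset p. m) = n" using e s by simp
    have "m \<in> I" if m: "m \<in># p" for m
    proof -
      have "m \<le> (\<Sum>m\<in>set_mset p. m)" using m by (intro member_le_sum) auto
      then show ?thesis using p m sum assms(2) by (auto simp: bias_partitions_def)
    qed
    moreover have "0 < (\<Sum>m\<in>set_mset p. bias_char \<alpha> \<beta> N m)"
      using iff[of "set_mset p"] p by (simp add: e bias_partitions_def)
    ultimately show "set_mset p \<subseteq> I \<and> (\<Sum>m\<in>set_mset p. m) = n \<and> 0 < (\<Sum>m\<in>set_mset p. bias_char \<alpha> \<beta> N m)"
      using sum by blast
  qed
  show "mset_set ` {A. A \<subseteq> I \<and> (\<Sum>m\<in>A. m) = n \<and> 0 < (\<Sum>m\<in>A. bias_char \<alpha> \<beta> N m)} \<subseteq> bias_partitions K \<alpha> \<beta> N n"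
  proof (rule image_subsetI)
    fix A assume "A \<in> {A. A \<subseteq> I \<and> (\<Sum>m\<in>A. m) = n \<and> 0 < (\<Sum>m\<in>A. bias_char \<alpha> \<beta> N m)}"
    then have A: "A \<subseteq> I" "(\<Sum>m\<in>A. m) = n" "0 < (\<Sum>m\<in>A. bias_char \<alpha> \<beta> N m)" by auto
    then have f: "finite A" using fin by (cases "A = {}") auto
    have "\<Sum>\<^sub># (mset_set A) = n" using A f by (simp add: sum_unfold_sum_mset)
    moreover have "\<forall>x\<in>A. K < x" using A(1) assms(3) by auto
    ultimately show "mset_set A \<in> bias_partitions K \<alpha> \<beta> N n"
      using f iff[OF f] A(3)
      by (auto simp: bias_partitions_def is_partition_of_def distinct_parts_def count_mset_set')
  qed
qed

section \<open>The Dirichlet kernel as a detector of signs\<close>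

definition dirichlet :: "nat \<Rightarrow> real \<Rightarrow> real" where
  "dirichlet m \<theta> = 1 + 2 * (\<Sum>i = 1..m. cos (real i * \<theta>))"

lemma sin_half_dirichlet: "sin (\<theta> / 2) * dirichlet m \<theta> = sin ((real m + 1/2) * \<theta>)"
proof (induction m)
  case (Suc m)
  have "sin (\<theta> / 2) * dirichlet (Suc m) \<theta> = sin (\<theta> / 2) * dirichlet m \<theta> + 2 * sin (\<theta> / 2) * cos (real (Suc m) * \<theta>)"
    by (simp add: dirichlet_def algebra_simps)
  also have "\<dots> = sin (real (Suc m) * \<theta> - \<theta> / 2) + 2 * sin (\<theta> / 2) * cos (real (Suc m) * \<theta>)"
    using Suc.IH by (simp add: algebra_simps)
  also have "\<dots> = sin (real (Suc m) * \<theta> + \<theta> / 2)"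
    by (simp add: sin_add sin_diff)
  finally show ?case by (simp add: algebra_simps)
qed (simp add: dirichlet_def)

lemma abs_dirichlet_le: "\<bar>dirichlet m \<theta>\<bar> \<le> 2 * real m + 1"
proof -
  have "\<bar>\<Sum>i = 1..m. cos (real i * \<theta>)\<bar> \<le> (\<Sum>i = 1..m. 1)"
    by (rule order_trans[OF sum_abs sum_mono]) auto
  then show ?thesis by (simp add: dirichlet_def)
qed

lemma has_integral_dirichlet: "(dirichlet m has_integral pi) {0..pi}"
proof -
  have c: "((\<lambda>\<theta>. cos (real i * \<theta>)) has_integral 0) {0..pi}" if "i \<in> {1..m}" for i
  proof -
    have "((\<lambda>\<theta>. cos (real i * \<theta>)) has_integral (sin (real i * pi) / real i - sin (real i * 0) / real i)) {0..pi}"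
      using that by (intro fundamental_theorem_of_calculus)
        (auto intro!: derivative_eq_intros simp: has_real_derivative_iff_has_vector_derivative[symmetric])
    then show ?thesis by simp
  qed
  have "((\<lambda>\<theta>. 1 + 2 * (\<Sum>i = 1..m. cos (real i * \<theta>))) has_integral (pi - 0) * 1 + 2 * (\<Sum>i = 1..m. 0)) {0..pi}"
    using has_integral_const_real[of "1 :: real" 0 pi]
    by (intro has_integral_add has_integral_mult_right has_integral_sum c) auto
  then show ?thesis by (simp add: dirichlet_def [abs_def])
qed

lemma continuous_on_dirichlet: "continuous_on S (dirichlet m)"
  unfolding dirichlet_def [abs_def] by (intro continuous_intros)

text \<open>The kernel of the sign of \<open>j - 1/2\<close>: ties \<open>j = 0\<close> count as negative.\<close>

definition sgn_kernel :: "int \<Rightarrow> real \<Rightarrow> real" where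
  "sgn_kernel j \<theta> = (if 0 < j then dirichlet (nat (j - 1)) \<theta> else - dirichlet (nat (- j)) \<theta>)"

lemma sin_half_sgn_kernel: "sin (\<theta> / 2) * sgn_kernel j \<theta> = sin (of_int j * \<theta> - \<theta> / 2)"
proof (cases "0 < j")
  case True
  then have "real (nat (j - 1)) + 1/2 = of_int j - 1/2" by simp
  then show ?thesis using True sin_half_dirichlet[of \<theta> "nat (j - 1)"] by (simp add: sgn_kernel_def algebra_simps)
next
  case False
  define c where "c = of_int j - (1/2 :: real)"
  have "real (nat (- j)) + 1/2 = - c" using False by (simp add: c_def)
  then have "sin (\<theta> / 2) * dirichlet (nat (- j)) \<theta> = - sin (c * \<theta>)"
    using sin_half_dirichlet[of \<theta> "nat (- j)"] by simp
  moreover have "c * \<theta> = of_int j * \<theta> - \<theta> / 2" by (simp add: c_def algebra_simps)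
  ultimately show ?thesis using False by (simp add: sgn_kernel_def)
qed

lemma abs_sgn_kernel_le: "\<bar>sgn_kernel j \<theta>\<bar> \<le> 2 * \<bar>of_int j\<bar> + 1"
proof (cases "0 < j")
  case True
  then show ?thesis using abs_dirichlet_le[of "nat (j - 1)" \<theta>] by (simp add: sgn_kernel_def)
next
  case False
  then show ?thesis using abs_dirichlet_le[of "nat (- j)" \<theta>] by (simp add: sgn_kernel_def)
qed

lemma has_integral_sgn_kernel: "(sgn_kernel j has_integral (if 0 < j then pi else - pi)) {0..pi}"
  unfolding sgn_kernel_def [abs_def]
  using has_integral_dirichlet has_integral_neg[OF has_integral_dirichlet] by simp

lemma continuous_on_sgn_kernel: "continuous_on S (sgn_kernel j)"
  unfolding sgn_kernel_def [abs_def] by (cases "0 < j") (auto intro!: continuous_intros continuous_on_dirichlet)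

text \<open>Twice the indicator of 0 < X is 1 + sgn (X - 1/2), and the kernel integrates over
  {0..pi} to pi times that sign.\<close>

lemma two_card_pos_eq:
  fixes X :: "'a set \<Rightarrow> int"
  assumes "finite S"
  shows "2 * real (card {A\<in>S. 0 < X A}) = real (card S) + integral {0..pi} (\<lambda>\<theta>. \<Sum>A\<in>S. sgn_kernel (X A) \<theta>) / pi"
proof -
  have "((\<lambda>\<theta>. \<Sum>A\<in>S. sgn_kernel (X A) \<theta>) has_integral (\<Sum>A\<in>S. if 0 < X A then pi else - pi)) {0..pi}"
    by (intro has_integral_sum assms has_integral_sgn_kernel)
  then have "integral {0..pi} (\<lambda>\<theta>. \<Sum>A\<in>S. sgn_kernel (X A) \<theta>) = (\<Sum>A\<in>S. if 0 < X A then pi else - pi)"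
    by (rule integral_unique)
  also have "\<dots> = pi * (2 * real (card {A\<in>S. 0 < X A}) - real (card S))"
  proof -
    have "(\<Sum>A\<in>S. if 0 < X A then pi else - pi) = (\<Sum>A\<in>S. 2 * pi * (if 0 < X A then 1 else 0) - pi)"
      by (rule sum.cong) auto
    also have "\<dots> = 2 * pi * (\<Sum>A\<in>S. if 0 < X A then 1 else 0) - pi * real (card S)"
      by (simp add: sum_subtractf sum_distrib_left)
    also have "(\<Sum>A\<in>S. if 0 < X A then 1 else 0) = real (card {A\<in>S. 0 < X A})"
      using assms by (simp add: sum.inter_filter[symmetric])
    finally show ?thesis by (simp add: algebra_simps)
  qed
  finally show ?thesis by simp
qed

section \<open>Minor arcs\<close>

text \<open>With r = exp (- x) and s = sin^2 (u/2) the squared modulus is (1 + r)^2 - 4 r s. Because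
  (1 + r)^2 \<le> 4, this is at most (1 + r)^2 (1 - r s); the square root halves the exponent of the
  saving.\<close>

lemma norm_one_plus_exp_le:
  fixes x u :: real
  assumes "0 \<le> x"
  shows "cmod (1 + exp (Complex (- x) u)) \<le> (1 + exp (- x)) * exp (- (exp (- x) * (sin (u / 2))\<^sup>2 / 2))"
proof -
  define r where "r = exp (- x)"
  define s where "s = (sin (u / 2))\<^sup>2"
  have r: "0 < r" "r \<le> 1" using assms by (auto simp: r_def)
  have s: "0 \<le> s" by (simp add: s_def)
  have c: "cos u = 1 - 2 * s" using cos_double_sin[of "u / 2"] by (simp add: s_def)
  have "(cmod (1 + exp (Complex (- x) u)))\<^sup>2 = (1 + r * cos u)\<^sup>2 + (r * sin u)\<^sup>2"
    by (simp add: cmod_power2 Re_exp Im_exp r_def)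
  also have "\<dots> = (1 + r)\<^sup>2 - 4 * r * s"
  proof -
    have "(1 + r * cos u)\<^sup>2 + (r * sin u)\<^sup>2 = 1 + 2 * r * cos u + r\<^sup>2 * ((sin u)\<^sup>2 + (cos u)\<^sup>2)"
      by algebra
    also have "(sin u)\<^sup>2 + (cos u)\<^sup>2 = 1" by simp
    also have "1 + 2 * r * cos u + r\<^sup>2 * 1 = (1 + r)\<^sup>2 - 4 * r * s"
      unfolding c by (simp add: power2_eq_square algebra_simps)
    finally show ?thesis .
  qed
  also have "\<dots> \<le> (1 + r)\<^sup>2 * (1 - r * s)"
  proof -
    have "(1 + r)\<^sup>2 \<le> 2\<^sup>2" using r by (intro power_mono) auto
    then have "(1 + r)\<^sup>2 * (r * s) \<le> 4 * (r * s)" using r s by (intro mult_right_mono) auto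
    then show ?thesis by (simp add: algebra_simps)
  qed
  also have "\<dots> \<le> (1 + r)\<^sup>2 * exp (- (r * s))"
    using exp_ge_add_one_self[of "- (r * s)"] by (intro mult_left_mono) auto
  also have "\<dots> = ((1 + r) * exp (- (r * s / 2)))\<^sup>2"
    by (simp add: power_mult_distrib power2_eq_square[of "exp _"] exp_add[symmetric])
  finally show ?thesis unfolding r_def s_def by (rule power2_le_imp_le) (simp add: add_nonneg_nonneg)
qed

lemma norm_bias_gf_le:
  assumes "0 \<le> t"
  shows "cmod (bias_gf ch I \<theta> (Complex t (- \<phi>)))
    \<le> (\<Prod>m\<in>I. 1 + exp (- (real m * t))) * exp (- (\<Sum>m\<in>I. exp (- (real m * t)) * (sin ((\<theta> * of_int (ch m) + real m * \<phi>) / 2))\<^sup>2) / 2)"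
proof (cases "finite I")
  case True
  have e: "\<i> * of_real (\<theta> * of_int (ch m)) - of_nat m * Complex t (- \<phi>) = Complex (- (real m * t)) (\<theta> * of_int (ch m) + real m * \<phi>)" for m
    by (simp add: complex_eq_iff)
  have "cmod (bias_gf ch I \<theta> (Complex t (- \<phi>))) = (\<Prod>m\<in>I. cmod (1 + exp (Complex (- (real m * t)) (\<theta> * of_int (ch m) + real m * \<phi>))))"
    unfolding bias_gf_def e by (rule prod_norm[symmetric])
  also have "\<dots> \<le> (\<Prod>m\<in>I. (1 + exp (- (real m * t))) * exp (- (exp (- (real m * t)) * (sin ((\<theta> * of_int (ch m) + real m * \<phi>) / 2))\<^sup>2 / 2)))"
    by (rule prod_mono) (use assms in \<open>auto intro!: norm_one_plus_exp_le\<close>)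
  also have "\<dots> = (\<Prod>m\<in>I. 1 + exp (- (real m * t))) * exp (\<Sum>m\<in>I. - (exp (- (real m * t)) * (sin ((\<theta> * of_int (ch m) + real m * \<phi>) / 2))\<^sup>2 / 2))"
    unfolding prod.distrib exp_sum[OF True] ..
  finally show ?thesis by (simp add: sum_negf sum_divide_distrib)
qed (simp add: bias_gf_def)

text \<open>sin y - y/2 increases only up to pi/3; from there on sin x \<ge> sqrt 3 / 2 > 4/5 >
  pi/4.\<close>

lemma half_le_sin:
  fixes x :: real
  assumes "0 \<le> x" "x \<le> pi / 2"
  shows "x / 2 \<le> sin x"
proof (cases "x \<le> pi / 3")
  case True
  have "sin 0 - 0 / 2 \<le> sin x - x / 2"
  proof (rule DERIV_nonneg_imp_nondecreasing[OF assms(1)])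
    fix y assume y: "0 \<le> y" "y \<le> x"
    have "cos (pi / 3) \<le> cos y" by (rule cos_monotone_0_pi_le) (use y True in auto)
    then show "\<exists>z. ((\<lambda>y. sin y - y / 2) has_real_derivative z) (at y) \<and> 0 \<le> z"
      by (intro exI[of _ "cos y - 1/2"]) (auto intro!: derivative_eq_intros simp: cos_60)
  qed
  then show ?thesis by simp
next
  case False
  have "sin (pi / 3) \<le> sin x" by (rule sin_monotone_2pi_le) (use False assms in auto)
  moreover have "x / 2 \<le> 4/5" using assms pi_less_4 pi_approx by simp
  moreover have "4/5 \<le> sqrt 3 / 2"
  proof -
    have "8/5 \<le> sqrt 3" by (rule real_le_rsqrt) (simp add: power2_eq_square)
    then show ?thesis by simp
  qed
  ultimately show ?thesis by (simp add: sin_60)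
qed

lemma half_abs_le_abs_sin:
  fixes x :: real
  assumes "\<bar>x\<bar> \<le> pi / 2"
  shows "\<bar>x\<bar> / 2 \<le> \<bar>sin x\<bar>"
  using half_le_sin[of "\<bar>x\<bar>"] assms by (auto simp: abs_if split: if_splits)

text \<open>Multiplication by 2 sin (\<eta>/2) makes the sum telescope. That the bound does not
  depend on \<open>L\<close> is the equidistribution used on the minor arcs.\<close>

lemma sum_cos_progression: "\<bar>sin (\<eta> / 2)\<bar> * \<bar>\<Sum>k<L. cos (c + real k * \<eta>)\<bar> \<le> 1"
proof -
  have "2 * sin (\<eta> / 2) * (\<Sum>k<L. cos (c + real k * \<eta>)) = (\<Sum>k<L. sin (c + real (Suc k) * \<eta> - \<eta> / 2) - sin (c + real k * \<eta> - \<eta> / 2))"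
    unfolding sum_distrib_left
  proof (rule sum.cong[OF refl])
    fix k
    have "sin (c + real (Suc k) * \<eta> - \<eta> / 2) = sin ((c + real k * \<eta>) + \<eta> / 2)" by (simp add: algebra_simps)
    then show "2 * sin (\<eta> / 2) * cos (c + real k * \<eta>) = sin (c + real (Suc k) * \<eta> - \<eta> / 2) - sin (c + real k * \<eta> - \<eta> / 2)"
      by (simp only: sin_add sin_diff) simp
  qed
  also have "\<dots> = sin (c + real L * \<eta> - \<eta> / 2) - sin (c + real 0 * \<eta> - \<eta> / 2)"
    by (rule sum_lessThan_telescope)
  finally have "\<bar>2 * sin (\<eta> / 2) * (\<Sum>k<L. cos (c + real k * \<eta>))\<bar> \<le> 2"
    using abs_triangle_ineq4[of "sin (c + real L * \<eta> - \<eta> / 2)" "sin (c + real 0 * \<eta> - \<eta> / 2)"]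
      abs_sin_le_one[of "c + real L * \<eta> - \<eta> / 2"] abs_sin_le_one[of "c + real 0 * \<eta> - \<eta> / 2"] by linarith
  then show ?thesis by (simp add: abs_mult)
qed

lemma sum_sin2_progression_ge:
  assumes "0 < q" "q \<le> \<bar>sin (\<eta> / 2)\<bar>"
  shows "real L / 2 - 1 / (2 * q) \<le> (\<Sum>k<L. (sin ((c + real k * \<eta>) / 2))\<^sup>2)"
proof -
  define C where "C = (\<Sum>k<L. cos (c + real k * \<eta>))"
  have "(sin (y / 2))\<^sup>2 = 1/2 - cos y / 2" for y :: real
    using cos_double_sin[of "y / 2"] by (simp add: field_simps)
  then have e: "(\<Sum>k<L. (sin ((c + real k * \<eta>) / 2))\<^sup>2) = real L / 2 - C / 2"
    by (simp add: sum_subtractf sum_divide_distrib C_def)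
  have "q * \<bar>C\<bar> \<le> \<bar>sin (\<eta> / 2)\<bar> * \<bar>C\<bar>" by (rule mult_right_mono) (use assms in auto)
  also have "\<dots> \<le> 1" unfolding C_def by (rule sum_cos_progression)
  finally have "\<bar>C\<bar> \<le> 1 / q" using assms by (simp add: field_simps)
  then have "C / 2 \<le> 1 / (2 * q)" using assms(1) by (simp add: abs_le_iff)
  then show ?thesis unfolding e by simp
qed

text \<open>The addition theorem for v = (v + e) - e together with (|a| + |b|)^2 \<le> 2 a^2 + 2
  b^2. It carries a lower bound from a frequency 2 pi j / N over to nearby frequencies.\<close>

lemma sin2_perturb: "(sin (v / 2 :: real))\<^sup>2 / 2 - (e / 2)\<^sup>2 \<le> (sin ((v + e) / 2))\<^sup>2"
proof -
  define a where "a = sin ((v + e) / 2)"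
  define b where "b = sin (e / 2)"
  have "sin (v / 2) = a * cos (e / 2) - cos ((v + e) / 2) * b"
    unfolding a_def b_def sin_diff[symmetric] by (simp add: add_divide_distrib)
  then have "\<bar>sin (v / 2)\<bar> \<le> \<bar>a\<bar> * \<bar>cos (e / 2)\<bar> + \<bar>cos ((v + e) / 2)\<bar> * \<bar>b\<bar>"
    using abs_triangle_ineq4 by (metis abs_mult)
  also have "\<dots> \<le> \<bar>a\<bar> * 1 + 1 * \<bar>b\<bar>" by (intro add_mono mult_mono) auto
  finally have "\<bar>sin (v / 2)\<bar>\<^sup>2 \<le> (\<bar>a\<bar> + \<bar>b\<bar>)\<^sup>2" by (intro power_mono) auto
  also have "\<dots> \<le> 2 * a\<^sup>2 + 2 * b\<^sup>2"
    using zero_le_power2[of "\<bar>a\<bar> - \<bar>b\<bar>"] by (simp add: power2_sum power2_diff)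
  finally have "(sin (v / 2))\<^sup>2 \<le> 2 * a\<^sup>2 + 2 * b\<^sup>2" by simp
  moreover have "b\<^sup>2 \<le> (e / 2)\<^sup>2" unfolding b_def using abs_sin_x_le_abs_x[of "e / 2"] by (simp only: abs_le_square_iff)
  ultimately show ?thesis unfolding a_def by linarith
qed

lemma sin2_add_int_pi: "(sin (x + of_int k * pi))\<^sup>2 = (sin x)\<^sup>2" for k :: int
proof -
  have s: "sin (of_int k * pi) = 0" using sin_zero_iff_int2 by auto
  then have "(cos (of_int k * pi))\<^sup>2 = 1" using sin_cos_squared_add[of "of_int k * pi"] by simp
  then show ?thesis by (simp add: sin_add s power_mult_distrib)
qed

section \<open>Phases within a single residue class\<close>

lemma bias_char_add: "bias_char \<alpha> \<beta> N (g + k * N) = bias_char \<alpha> \<beta> N g"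
  by (simp add: bias_char_def Cong.cong_def)

text \<open>All summands are nonnegative: only one residue class is kept, and in it only parts with
  m t \<le> B, whose weights are at least exp (- B).\<close>

lemma progression_sum_le:
  assumes g: "g \<in> {K+1..K+N}" and M: "M \<le> L" and B: "\<And>k. k < M \<Longrightarrow> real (g + k * N) * t \<le> B"
  shows "exp (- B) * (\<Sum>k<M. (sin ((\<theta> * of_int (bias_char \<alpha> \<beta> N g) + real (g + k * N) * \<phi>) / 2))\<^sup>2)
     \<le> (\<Sum>m\<in>{K+1..K+N*L}. exp (- (real m * t)) * (sin ((\<theta> * of_int (bias_char \<alpha> \<beta> N m) + real m * \<phi>) / 2))\<^sup>2)"
proof -
  define F where "F m = exp (- (real m * t)) * (sin ((\<theta> * of_int (bias_char \<alpha> \<beta> N m) + real m * \<phi>) / 2))\<^sup>2" for m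
  have N: "N \<ge> 1" using g by auto
  have inj: "inj_on (\<lambda>k. g + k * N) {..<M}" using N by (auto simp: inj_on_def)
  have sub: "(\<lambda>k. g + k * N) ` {..<M} \<subseteq> {K+1..K+N*L}"
  proof (rule image_subsetI)
    fix k assume "k \<in> {..<M}"
    then have "Suc k * N \<le> L * N" using M by (intro mult_right_mono) auto
    then show "g + k * N \<in> {K+1..K+N*L}" using g by (auto simp: algebra_simps)
  qed
  have "exp (- B) * (\<Sum>k<M. (sin ((\<theta> * of_int (bias_char \<alpha> \<beta> N g) + real (g + k * N) * \<phi>) / 2))\<^sup>2)
      \<le> (\<Sum>k<M. F (g + k * N))"
    unfolding sum_distrib_left
    by (rule sum_mono) (use B in \<open>auto simp: F_def bias_char_add intro!: mult_right_mono\<close>)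
  also have "\<dots> = (\<Sum>m\<in>(\<lambda>k. g + k * N) ` {..<M}. F m)" by (simp add: sum.reindex[OF inj])
  also have "\<dots> \<le> (\<Sum>m\<in>{K+1..K+N*L}. F m)"
    by (rule sum_mono2[OF _ sub]) (auto simp: F_def)
  finally show ?thesis by (simp add: F_def)
qed

lemma class_representative:
  assumes "1 \<le> (N::nat)"
  shows "\<exists>g\<in>{K+1..K+N}. [g = x] (mod N)"
proof (intro bexI)
  \<comment> \<open>(N - 1) (K + 1) stands for - (K + 1) modulo N, which avoids truncated
    subtraction.\<close>
  define r where "r = (x + (N - 1) * (K + 1)) mod N"
  have "[K + 1 + r = K + 1 + (x + (N - 1) * (K + 1))] (mod N)"
    unfolding r_def by (intro cong_add cong_refl) simp
  also have "K + 1 + (x + (N - 1) * (K + 1)) = x + N * (K + 1)"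
    using assms by (cases N) simp_all
  also have "[x + N * (K + 1) = x] (mod N)" unfolding Cong.cong_def by (rule mod_mult_self2)
  finally show "[K + 1 + r = x] (mod N)" .
  have "r < N" using assms by (simp add: r_def)
  then show "K + 1 + r \<in> {K+1..K+N}" by simp
qed

lemma sin2_rational_lower:
  assumes "2 \<le> (N::nat)"
  shows "\<exists>s>0. \<forall>q::int. \<not> int N dvd q \<longrightarrow> s \<le> (sin (pi * of_int q / real N))\<^sup>2"
proof -
  define s where "s = Min ((\<lambda>r. (sin (pi * real r / real N))\<^sup>2) ` {1..<N})"
  have pos: "0 < (sin (pi * real r / real N))\<^sup>2" if "r \<in> {1..<N}" for r
  proof -
    have "0 < pi * real r / real N" "pi * real r / real N < pi" using that by (auto simp: field_simps)
    then have "0 < sin (pi * real r / real N)" by (rule sin_gt_zero)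
    then show ?thesis by simp
  qed
  have "0 < s" unfolding s_def using assms pos by (subst Min_gr_iff) auto
  moreover have "s \<le> (sin (pi * of_int q / real N))\<^sup>2" if q: "\<not> int N dvd q" for q
  proof -
    define r where "r = nat (q mod int N)"
    have r: "int r = q mod int N" using assms by (simp add: r_def)
    have "r \<noteq> 0" using q r by (auto simp: dvd_eq_mod_eq_0)
    moreover have "r < N" using assms r by (metis of_nat_0_less_iff of_nat_less_iff pos_mod_bound zero_less_numeral less_le_trans)
    ultimately have "r \<in> {1..<N}" by auto
    then have "s \<le> (sin (pi * real r / real N))\<^sup>2" unfolding s_def by (intro Min_le) auto
    also have "pi * real r / real N = pi * of_int q / real N + of_int (- (q div int N)) * pi"
    proof -
      have "q = int N * (q div int N) + int r" using r by simp
      then have "real_of_int q = real N * of_int (q div int N) + real r" by (metis of_int_add of_int_mult of_int_of_nat_eq)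
      then show ?thesis using assms by (simp add: field_simps)
    qed
    finally show ?thesis unfolding sin2_add_int_pi .
  qed
  ultimately show ?thesis by blast
qed

text \<open>False for \<open>N = 3\<close> or \<open>N = 4\<close> with \<open>\<alpha> + \<beta> = N\<close>: then \<open>n\<close> determines the excess modulo \<open>3\<close>, respectively modulo \<open>2\<close>.\<close>

lemma nontrivial_class:
  assumes N: "N = 2 \<or> N \<ge> 5" and ab: "1 \<le> \<alpha>" "\<alpha> \<le> N" "1 \<le> \<beta>" "\<beta> \<le> N" "\<alpha> \<noteq> \<beta>"
  shows "\<exists>s>0. \<forall>j::int. \<forall>\<theta>. \<not> int N dvd j \<longrightarrow>
    (\<exists>g\<in>{K+1..K+N}. s \<le> (sin ((\<theta> * of_int (bias_char \<alpha> \<beta> N g) + 2 * pi * of_int j * real g / real N) / 2))\<^sup>2)"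
proof -
  have ncong: "\<not> [x = y] (mod N)" if "1 \<le> x" "x \<le> N" "1 \<le> y" "y \<le> N" "x \<noteq> y" for x y
    using that by (metis cong_less_modulus_unique_nat Cong.cong_def le_neq_implies_less mod_less mod_self not_one_le_zero)
  show ?thesis
  proof (cases "N = 2")
    case True
    \<comment> \<open>For N = 2 and odd j an even part gives sin^2 (\<theta>/2) and an odd part
      cos^2 (\<theta>/2); one of them is at least 1/2.\<close>
    have "\<exists>g\<in>{K+1..K+N}. 1/2 \<le> (sin ((\<theta> * of_int (bias_char \<alpha> \<beta> N g) + 2 * pi * of_int j * real g / real N) / 2))\<^sup>2"
      if j: "\<not> int N dvd j" for j \<theta>
    proof -
      obtain g1 where g1: "g1 \<in> {K+1..K+N}" "odd g1"
        using class_representative[of N K 1] True by (auto simp: Cong.cong_def odd_iff_mod_2_eq_one)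
      obtain g2 where g2: "g2 \<in> {K+1..K+N}" "even g2"
        using class_representative[of N K 0] True by (auto simp: Cong.cong_def)
      have al: "\<alpha> = 1 \<and> \<beta> = 2 \<or> \<alpha> = 2 \<and> \<beta> = 1" using ab True by auto
      have abs: "\<bar>bias_char \<alpha> \<beta> N g\<bar> = 1" for g
        using al True by (cases "even g") (auto simp: bias_char_def Cong.cong_def odd_iff_mod_2_eq_one even_iff_mod_2_eq_zero)
      have sq: "(sin (\<theta> * of_int (bias_char \<alpha> \<beta> N g) / 2))\<^sup>2 = (sin (\<theta> / 2))\<^sup>2" for g
        using abs[of g] by (cases "bias_char \<alpha> \<beta> N g \<ge> 0") (auto simp: abs_if split: if_splits)
      have cq: "(cos (\<theta> * of_int (bias_char \<alpha> \<beta> N g) / 2))\<^sup>2 = (cos (\<theta> / 2))\<^sup>2" for g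
        using sq[of g] sin_cos_squared_add[of "\<theta> * of_int (bias_char \<alpha> \<beta> N g) / 2"] sin_cos_squared_add[of "\<theta> / 2"] by linarith
      have v: "(\<theta> * of_int (bias_char \<alpha> \<beta> N g) + 2 * pi * of_int j * real g / real N) / 2
          = \<theta> * of_int (bias_char \<alpha> \<beta> N g) / 2 + of_int (j * int g) * pi / 2" for g
        using True by (simp add: algebra_simps)
      obtain q where q: "int g2 = 2 * q" using g2(2) by (metis dvd_def even_of_nat)
      have "of_int (j * int g2) * pi / 2 = of_int (j * q) * pi" unfolding q by simp
      then have e2: "(sin ((\<theta> * of_int (bias_char \<alpha> \<beta> N g2) + 2 * pi * of_int j * real g2 / real N) / 2))\<^sup>2 = (sin (\<theta> / 2))\<^sup>2"
        unfolding v using sq by (simp only: sin2_add_int_pi)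
      have "odd (j * int g1)" using g1(2) j True by simp
      then obtain p where p: "j * int g1 = 2 * p + 1" by (elim oddE)
      have "\<theta> * of_int (bias_char \<alpha> \<beta> N g1) / 2 + of_int (j * int g1) * pi / 2 = (\<theta> * of_int (bias_char \<alpha> \<beta> N g1) / 2 + pi / 2) + of_int p * pi"
        unfolding p by (simp add: algebra_simps add_divide_distrib)
      then have e1: "(sin ((\<theta> * of_int (bias_char \<alpha> \<beta> N g1) + 2 * pi * of_int j * real g1 / real N) / 2))\<^sup>2 = (cos (\<theta> / 2))\<^sup>2"
        unfolding v using cq[of g1] by (simp only: sin2_add_int_pi) (simp add: sin_add)
      have "(sin (\<theta> / 2))\<^sup>2 \<ge> 1/2 \<or> (cos (\<theta> / 2))\<^sup>2 \<ge> 1/2" using sin_cos_squared_add[of "\<theta> / 2"] by linarith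
      then show ?thesis using e1 e2 g1(1) g2(1) by metis
    qed
    then show ?thesis by (intro exI[of _ "1/2"]) auto
  next
    case False
    then have N5: "5 \<le> N" using N by auto
    obtain s where s: "0 < s" "\<And>q::int. \<not> int N dvd q \<Longrightarrow> s \<le> (sin (pi * of_int q / real N))\<^sup>2"
      using sin2_rational_lower[of N] N5 by auto
    have "\<exists>g\<in>{K+1..K+N}. s \<le> (sin ((\<theta> * of_int (bias_char \<alpha> \<beta> N g) + 2 * pi * of_int j * real g / real N) / 2))\<^sup>2"
      if j: "\<not> int N dvd j" for j \<theta>
    proof -
      have adj: "\<not> int N dvd j * int x \<or> \<not> int N dvd j * int (Suc x)" for x
      proof (rule ccontr)
        assume "\<not> ?thesis"
        then have "int N dvd j * int (Suc x) - j * int x" by (intro dvd_diff) auto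
        then show False using j by (simp add: algebra_simps)
      qed
      \<comment> \<open>A class with character 0 has a phase independent of \<theta>. If 1 is free,
        it works since N does not divide j. Otherwise one of the pairs (2, 3), (4, 5) avoids
        \<alpha> and \<beta>, and N cannot divide j times both members; both pairs fit because N
        \<ge> 5.\<close>
      have "\<exists>x. 1 \<le> x \<and> x \<le> N \<and> x \<noteq> \<alpha> \<and> x \<noteq> \<beta> \<and> \<not> int N dvd j * int x"
      proof (cases "\<alpha> \<noteq> 1 \<and> \<beta> \<noteq> 1")
        case True then show ?thesis using j N5 by (intro exI[of _ 1]) auto
      next
        case no1: False
        show ?thesis
        proof (cases "2 \<notin> {\<alpha>, \<beta>} \<and> 3 \<notin> {\<alpha>, \<beta>}")
          case True
          then show ?thesis using adj[of 2] N5
            by (cases "int N dvd j * int 2") (auto intro: exI[of _ 2] exI[of _ 3] simp: eval_nat_numeral)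
        next
          case False
          then have "4 \<notin> {\<alpha>, \<beta>} \<and> 5 \<notin> {\<alpha>, \<beta>}" using no1 by auto
          then show ?thesis using adj[of 4] N5
            by (cases "int N dvd j * int 4") (auto intro: exI[of _ 4] exI[of _ 5] simp: eval_nat_numeral)
        qed
      qed
      then obtain x where x: "1 \<le> x" "x \<le> N" "x \<noteq> \<alpha>" "x \<noteq> \<beta>" "\<not> int N dvd j * int x" by blast
      obtain g where g: "g \<in> {K+1..K+N}" "[g = x] (mod N)" using class_representative[of N K x] N5 by auto
      have "\<not> [g = \<alpha>] (mod N)" "\<not> [g = \<beta>] (mod N)"
        using ncong[of x \<alpha>] ncong[of x \<beta>] x ab g(2) cong_trans cong_sym by blast+
      then have b0: "bias_char \<alpha> \<beta> N g = 0" by (simp add: bias_char_def)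
      have "[j * int g = j * int x] (mod int N)" using g(2) by (intro cong_mult cong_refl) (simp add: cong_int_iff)
      then have "\<not> int N dvd j * int g" using x(5) cong_dvd_iff by blast
      then have "s \<le> (sin (pi * of_int (j * int g) / real N))\<^sup>2" by (rule s(2))
      also have "pi * of_int (j * int g) / real N = (\<theta> * of_int (bias_char \<alpha> \<beta> N g) + 2 * pi * of_int j * real g / real N) / 2"
        by (simp add: b0)
      finally show ?thesis using g(1) by blast
    qed
    then show ?thesis using s(1) by blast
  qed
qed

text \<open>If \<open>N \<phi>\<close> is not within \<open>O(t)\<close> of a multiple of \<open>2 \<pi>\<close>, the phases in any one residue class are
  equidistributed; otherwise they are nearly constant for \<open>m\<close> up to a small multiple of \<open>1 / t\<close>, and
  nonzero in a suitable class.\<close>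

lemma minor_arc_sum:
  assumes N: "N = 2 \<or> N \<ge> 5" and ab: "1 \<le> \<alpha>" "\<alpha> \<le> N" "1 \<le> \<beta>" "\<beta> \<le> N" "\<alpha> \<noteq> \<beta>"
  shows "\<exists>c>0. \<exists>t0>0. \<forall>t L \<theta> \<phi>. 0 < t \<and> t \<le> t0 \<and> 10 / t \<le> real L \<and> \<bar>\<theta>\<bar> \<le> pi \<and> \<bar>\<phi>\<bar> \<le> pi \<and> (t \<le> \<bar>\<phi>\<bar> \<or> 1/2 \<le> \<bar>\<theta>\<bar>) \<longrightarrow>
     c / t \<le> (\<Sum>m\<in>{K+1..K+N*L}. exp (- (real m * t)) * (sin ((\<theta> * of_int (bias_char \<alpha> \<beta> N m) + real m * \<phi>) / 2))\<^sup>2)"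
proof -
  obtain s0 where s0: "0 < s0" "\<And>(j::int) \<theta>. \<not> int N dvd j \<Longrightarrow>
    (\<exists>g\<in>{K+1..K+N}. s0 \<le> (sin ((\<theta> * of_int (bias_char \<alpha> \<beta> N g) + 2 * pi * of_int j * real g / real N) / 2))\<^sup>2)"
    using nontrivial_class[OF N ab, of K] by blast
  \<comment> \<open>1/64 is the lower bound for sin^2 (\<theta>/2) with 1/2 \<le> |\<theta>| \<le>
    pi, needed when the nearest frequency is 0.\<close>
  define s where "s = min s0 (1/64)"
  have s: "0 < s" "s \<le> s0" "s \<le> 1/64" "s \<le> 1" using s0 by (auto simp: s_def)
  \<comment> \<open>\<open>sin2_perturb\<close> leaves s/2 - (e/2)^2, which is at least s/4 as long
    as |e| \<le> \<epsilon>.\<close>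
  define \<epsilon> where "\<epsilon> = sqrt s"
  have \<epsilon>: "0 < \<epsilon>" "\<epsilon> \<le> 1" "\<epsilon>\<^sup>2 = s" using s by (auto simp: \<epsilon>_def)
  have N1: "1 \<le> N" "0 < real N" using N by auto
  \<comment> \<open>The first representative g \<le> K + N then satisfies g t \<le> \<epsilon>/2;
    the other half of \<epsilon> is left for the progression itself.\<close>
  define t0 where "t0 = \<epsilon> / (2 * (real K + real N))"
  define c where "c = min (exp (- (real K + 9)) * (2 / real N)) (exp (- 1) * (s / 4 * (\<epsilon> / (2 * real N))))"
  have c0: "0 < c" using N1 s \<epsilon> by (simp add: c_def)
  have t00: "0 < t0" using N1 \<epsilon> by (simp add: t0_def)
  have "t0 \<le> 1"
  proof -
    have "1 \<le> real N" using N1 by simp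
    then have "1 \<le> 2 * real N" by simp
    also have "\<dots> \<le> 2 * (real K + real N)" by simp
    finally have "\<epsilon> \<le> 2 * (real K + real N)" by (rule order_trans[OF \<epsilon>(2)])
    then show ?thesis using N1 by (simp add: t0_def)
  qed
  have main: "c / t \<le> (\<Sum>m\<in>{K+1..K+N*L}. exp (- (real m * t)) * (sin ((\<theta> * of_int (bias_char \<alpha> \<beta> N m) + real m * \<phi>) / 2))\<^sup>2)"
    (is "_ \<le> ?S")
    if t: "0 < t" "t \<le> t0" and L: "10 / t \<le> real L" and \<theta>: "\<bar>\<theta>\<bar> \<le> pi" and \<phi>: "\<bar>\<phi>\<bar> \<le> pi" and nc: "t \<le> \<bar>\<phi>\<bar> \<or> 1/2 \<le> \<bar>\<theta>\<bar>"
    for t L \<theta> \<phi>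
  proof (cases "real N * t / 4 \<le> \<bar>sin (real N * \<phi> / 2)\<bar>")
    case True
    have t1: "t \<le> 1" using t \<open>t0 \<le> 1\<close> by simp
    \<comment> \<open>M/2 is at least 4 / (N t), while the cosine sum costs at most 2 / (N t); half
      of the gain remains, and m t stays bounded on this range.\<close>
    define M where "M = nat \<lceil>8 / (real N * t)\<rceil>"
    have pos: "0 < 8 / (real N * t)" using N1 t by simp
    have M: "8 / (real N * t) \<le> real M" "real M < 8 / (real N * t) + 1"
      unfolding M_def using pos by linarith+
    have "8 / (real N * t) \<le> 8 / (1 * t)" using N1 t by (intro divide_left_mono mult_right_mono) auto
    moreover have "1 \<le> 1 / t" using t t1 by simp
    ultimately have "real M \<le> 10 / t" using M by (simp add: add_divide_distrib[symmetric] field_simps)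
    then have MleL: "M \<le> L" using L by linarith
    have B: "real (K + 1 + k * N) * t \<le> real K + 9" if "k < M" for k
    proof -
      have "real k + 1 \<le> real M" using that by linarith
      then have "real k < 8 / (real N * t)" using M by linarith
      then have "real k * real N * t \<le> 8" using N1 t by (simp add: field_simps)
      moreover have "(real K + 1) * t \<le> (real K + 1) * 1" using t1 by (intro mult_left_mono) auto
      ultimately show ?thesis by (simp add: algebra_simps)
    qed
    have "2 / (real N * t) = 4 / (real N * t) - 1 / (2 * (real N * t / 4))" by (simp add: field_simps)
    also have "\<dots> \<le> real M / 2 - 1 / (2 * (real N * t / 4))"
    proof -
      have "4 / (real N * t) = 8 / (real N * t) / 2" by simp
      then show ?thesis using M(1) by linarith
    qed
    also have "\<dots> \<le> (\<Sum>k<M. (sin ((\<theta> * of_int (bias_char \<alpha> \<beta> N (K + 1)) + real (K + 1) * \<phi> + real k * (real N * \<phi>)) / 2))\<^sup>2)"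
      by (rule sum_sin2_progression_ge) (use True N1 t in auto)
    also have "\<dots> = (\<Sum>k<M. (sin ((\<theta> * of_int (bias_char \<alpha> \<beta> N (K + 1)) + real (K + 1 + k * N) * \<phi>) / 2))\<^sup>2)"
      by (simp add: algebra_simps)
    finally have "exp (- (real K + 9)) * (2 / (real N * t)) \<le> exp (- (real K + 9)) * \<dots>"
      by (rule mult_left_mono) simp
    also have "\<dots> \<le> ?S" by (rule progression_sum_le[OF _ MleL B]) (use N1 in auto)
    finally have "exp (- (real K + 9)) * (2 / real N) / t \<le> ?S" by (simp add: field_simps)
    moreover have "c / t \<le> exp (- (real K + 9)) * (2 / real N) / t"
      using t by (intro divide_right_mono) (auto simp: c_def)
    ultimately show ?thesis by linarith
  next
    case False
    have t1: "t \<le> 1" using t \<open>t0 \<le> 1\<close> by simp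
    \<comment> \<open>\<open>x\<close> is the signed distance of N \<phi> / 2 from the nearest
      multiple of pi. A small sine forces |x| < N t / 2, so \<phi> lies within t of 2 pi j /
      N.\<close>
    define j where "j = round (real N * \<phi> / (2 * pi))"
    define x where "x = real N * \<phi> / 2 - of_int j * pi"
    define \<delta> where "\<delta> = 2 * x / real N"
    have "\<bar>of_int j - real N * \<phi> / (2 * pi)\<bar> \<le> 1/2" unfolding j_def by (rule of_int_round_abs_le)
    then have "pi * \<bar>of_int j - real N * \<phi> / (2 * pi)\<bar> \<le> pi * (1/2)" by (intro mult_left_mono) auto
    moreover have "pi * \<bar>of_int j - real N * \<phi> / (2 * pi)\<bar> = \<bar>x\<bar>"
    proof -
      have "pi * \<bar>of_int j - real N * \<phi> / (2 * pi)\<bar> = \<bar>pi * (of_int j - real N * \<phi> / (2 * pi))\<bar>"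
        by (simp add: abs_mult)
      also have "pi * (of_int j - real N * \<phi> / (2 * pi)) = - x" by (simp add: x_def algebra_simps)
      finally show ?thesis by simp
    qed
    ultimately have x2: "\<bar>x\<bar> \<le> pi / 2" by simp
    have "(sin (real N * \<phi> / 2))\<^sup>2 = (sin x)\<^sup>2" using sin2_add_int_pi[of x j] by (simp add: x_def)
    then have "\<bar>sin (real N * \<phi> / 2)\<bar> = \<bar>sin x\<bar>" by (simp only: power2_eq_iff abs_eq_iff)
    then have "\<bar>x\<bar> / 2 < real N * t / 4" using half_abs_le_abs_sin[OF x2] False by linarith
    then have \<delta>: "\<bar>\<delta>\<bar> < t" using N1 by (simp add: \<delta>_def abs_mult field_simps)
    have \<phi>eq: "\<phi> = 2 * pi * of_int j / real N + \<delta>" using N1 by (simp add: \<delta>_def x_def field_simps)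
    have "\<exists>g\<in>{K+1..K+N}. s \<le> (sin ((\<theta> * of_int (bias_char \<alpha> \<beta> N g) + 2 * pi * of_int j * real g / real N) / 2))\<^sup>2"
    proof (cases "int N dvd j")
      case True
      then obtain j' where j': "j = int N * j'" by (elim dvdE)
      then have p: "\<phi> = 2 * pi * of_int j' + \<delta>" using \<phi>eq N1 by simp
      \<comment> \<open>Here \<phi> is within t of a multiple of 2 pi, which for |\<phi>| \<le> pi
        must be 0; the hypothesis then leaves only |\<theta>| \<ge> 1/2.\<close>
      have "j' = 0"
      proof (rule ccontr)
        assume "j' \<noteq> 0"
        then have "1 \<le> \<bar>real_of_int j'\<bar>" by linarith
        then have "2 * pi * 1 \<le> 2 * pi * \<bar>real_of_int j'\<bar>" by (intro mult_left_mono) auto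
        also have "\<dots> = \<bar>\<phi> - \<delta>\<bar>" using p by (simp add: abs_mult)
        also have "\<dots> \<le> pi + 1" using \<phi> \<delta> t1 by linarith
        finally show False using pi_gt3 by simp
      qed
      then have "\<bar>\<phi>\<bar> < t" using p \<delta> by simp
      then have th: "1/2 \<le> \<bar>\<theta>\<bar>" using nc by simp
      obtain g where g: "g \<in> {K+1..K+N}" "[g = \<alpha>] (mod N)" using class_representative[of N K \<alpha>] N1 by auto
      have "bias_char \<alpha> \<beta> N g = 1" using g by (simp add: bias_char_def)
      moreover have "1/64 \<le> (sin (\<theta> / 2))\<^sup>2"
      proof -
        have "\<bar>\<theta> / 2\<bar> / 2 \<le> \<bar>sin (\<theta> / 2)\<bar>" by (rule half_abs_le_abs_sin) (use \<theta> in simp)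
        then have "1/8 \<le> \<bar>sin (\<theta> / 2)\<bar>" using th by simp
        then have "(1/8)\<^sup>2 \<le> \<bar>sin (\<theta> / 2)\<bar>\<^sup>2" by (intro power_mono) auto
        then show ?thesis by (simp add: power2_eq_square)
      qed
      ultimately show ?thesis using g s j' \<open>j' = 0\<close> by (intro bexI[of _ g]) auto
    next
      case False
      then show ?thesis using s0(2)[of j \<theta>] s(2) by (meson order_trans)
    qed
    then obtain g where g: "g \<in> {K+1..K+N}" "s \<le> (sin ((\<theta> * of_int (bias_char \<alpha> \<beta> N g) + 2 * pi * of_int j * real g / real N) / 2))\<^sup>2" by blast
    define v where "v = \<theta> * of_int (bias_char \<alpha> \<beta> N g) + 2 * pi * of_int j * real g / real N"
    \<comment> \<open>For k < M this gives k N t \<le> \<epsilon>/2, hence m t \<le> \<epsilon> and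
      an accumulated phase error m |\<delta>| of at most \<epsilon>.\<close>
    define M where "M = nat \<lceil>\<epsilon> / (2 * real N * t)\<rceil>"
    have pos: "0 < \<epsilon> / (2 * real N * t)" using N1 t \<epsilon> by simp
    have M: "\<epsilon> / (2 * real N * t) \<le> real M" "real M < \<epsilon> / (2 * real N * t) + 1"
      unfolding M_def using pos by linarith+
    have "\<epsilon> / (2 * real N * t) \<le> 1 / (1 * t)"
    proof (rule frac_le)
      show "1 * t \<le> 2 * real N * t" using N1 t by (intro mult_right_mono) auto
    qed (use \<epsilon> t in auto)
    moreover have "1 \<le> 1 / t" using t t1 by simp
    moreover have "10 / t = 10 * (1 / t)" by simp
    ultimately have MleL: "M \<le> L" using L M by linarith
    have B: "real (g + k * N) * t \<le> \<epsilon>" if "k < M" for k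
    proof -
      have "real k + 1 \<le> real M" using that by linarith
      then have "real k < \<epsilon> / (2 * real N * t)" using M by linarith
      then have "real k * real N * t \<le> \<epsilon> / 2" using N1 t by (simp add: field_simps)
      moreover have "real g * t \<le> (real K + real N) * t0" using g t by (intro mult_mono) auto
      moreover have "(real K + real N) * t0 = \<epsilon> / 2"
      proof -
        have "q * (\<epsilon> / (2 * q)) = \<epsilon> / 2" if "0 < q" for q :: real using that by simp
        from this[of "real K + real N"] show ?thesis using N1 unfolding t0_def by simp
      qed
      ultimately show ?thesis by (simp add: algebra_simps)
    qed
    have each: "s / 4 \<le> (sin ((\<theta> * of_int (bias_char \<alpha> \<beta> N g) + real (g + k * N) * \<phi>) / 2))\<^sup>2" if "k < M" for k
    proof -
      define e where "e = real (g + k * N) * \<delta>"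
      have "\<bar>e\<bar> \<le> real (g + k * N) * t" unfolding e_def abs_mult using \<delta> by (intro mult_mono) auto
      then have "\<bar>e\<bar> \<le> \<epsilon>" using B[OF that] by linarith
      then have "e\<^sup>2 \<le> s" using \<epsilon>(3) abs_le_square_iff[of e \<epsilon>] \<epsilon>(1) by simp
      then have "(e / 2)\<^sup>2 \<le> s / 4" by (simp add: power_divide)
      then have "s / 4 \<le> (sin ((v + e) / 2))\<^sup>2" using sin2_perturb[of v e] g(2) unfolding v_def[symmetric] by linarith
      also have "\<dots> = (sin ((v + e) / 2 + of_int (j * int k) * pi))\<^sup>2" by (rule sin2_add_int_pi[symmetric])
      also have "(v + e) / 2 + of_int (j * int k) * pi = (\<theta> * of_int (bias_char \<alpha> \<beta> N g) + real (g + k * N) * \<phi>) / 2"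
        unfolding v_def e_def \<phi>eq using N1 by (simp add: field_simps)
      finally show ?thesis .
    qed
    have "s / 4 * (\<epsilon> / (2 * real N * t)) \<le> s / 4 * real M" using M s by (intro mult_left_mono) auto
    also have "\<dots> = (\<Sum>k<M. s / 4)" by simp
    also have "\<dots> \<le> (\<Sum>k<M. (sin ((\<theta> * of_int (bias_char \<alpha> \<beta> N g) + real (g + k * N) * \<phi>) / 2))\<^sup>2)"
      by (rule sum_mono) (use each in auto)
    finally have "exp (- \<epsilon>) * (s / 4 * (\<epsilon> / (2 * real N * t))) \<le> exp (- \<epsilon>) * \<dots>" by (rule mult_left_mono) simp
    also have "\<dots> \<le> ?S" by (rule progression_sum_le[OF g(1) MleL B])
    finally have S1: "exp (- \<epsilon>) * (s / 4 * (\<epsilon> / (2 * real N * t))) \<le> ?S" .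
    have "exp (- 1) * (s / 4 * (\<epsilon> / (2 * real N * t))) \<le> exp (- \<epsilon>) * (s / 4 * (\<epsilon> / (2 * real N * t)))"
      using \<epsilon> s t by (intro mult_right_mono) auto
    moreover have "exp (- 1) * (s / 4 * (\<epsilon> / (2 * real N * t))) = exp (- 1) * (s / 4 * (\<epsilon> / (2 * real N))) / t"
      by (simp add: field_simps)
    moreover have "c / t \<le> exp (- 1) * (s / 4 * (\<epsilon> / (2 * real N))) / t"
      using t by (intro divide_right_mono) (auto simp: c_def)
    ultimately show ?thesis using S1 by linarith
  qed
  show ?thesis using c0 t00 main by blast
qed

section \<open>Gaussian integrals\<close>

lemma power_times_exp_le:
  fixes x :: real
  assumes "0 \<le> x"
  shows "x ^ k * exp (- x) \<le> fact k"
proof -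
  have s: "(\<lambda>n. x ^ n /\<^sub>R fact n) sums exp x" by (rule exp_converges)
  have "x ^ k /\<^sub>R fact k = (\<Sum>n\<in>{k}. x ^ n /\<^sub>R fact n)" by simp
  also have "\<dots> \<le> (\<Sum>n. x ^ n /\<^sub>R fact n)"
    by (rule sum_le_suminf[OF sums_summable[OF s]]) (use assms in auto)
  also have "\<dots> = exp x" using s by (simp add: sums_iff)
  finally have "x ^ k \<le> fact k * exp x" by (simp add: field_simps)
  then show ?thesis by (simp add: exp_minus field_simps)
qed

text \<open>Exchanges exponential smallness in 1 / t for whatever power of t is convenient.\<close>

lemma exp_neg_inverse_le:
  fixes c t :: real
  assumes "0 < c" "0 < t"
  shows "exp (- (c / t)) \<le> fact k / c ^ k * t ^ k"
proof -
  have "(c / t) ^ k * exp (- (c / t)) \<le> fact k" by (rule power_times_exp_le) (use assms in simp)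
  then show ?thesis using assms by (simp add: power_divide field_simps)
qed

lemma norm_exp_diff_le:
  fixes a b :: complex
  assumes "Re a \<le> M" "Re b \<le> M"
  shows "cmod (exp a - exp b) \<le> exp M * cmod (a - b)"
proof (rule field_differentiable_bound[where S = "{z. Re z \<le> M}" and f' = exp])
  show "convex {z. Re z \<le> M}" by (rule convex_halfspace_Re_le)
qed (use assms in \<open>auto intro: DERIV_exp has_field_derivative_at_within\<close>)

lemma norm_exp_minus_one_le: "cmod (exp r - 1) \<le> cmod r * exp (cmod r)"
  using norm_exp_diff_le[of r "cmod r" 0] complex_Re_le_cmod[of r] by (simp add: mult.commute)

lemma gaussian_has_integral:
  assumes "0 < c"
  shows "((\<lambda>x. exp (- (c * x\<^sup>2))) has_integral sqrt (pi / c)) UNIV"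
proof -
  define \<sigma> where "\<sigma> = sqrt (1 / (2 * c))"
  have s: "0 < \<sigma>" "\<sigma>\<^sup>2 = 1 / (2 * c)" using assms by (auto simp: \<sigma>_def)
  have "(normal_density 0 \<sigma> has_integral 1) UNIV"
    using has_integral_integral_lborel[OF integrable_normal_density[OF s(1), of 0]] integral_normal_density[OF s(1), of 0] by simp
  then have "((\<lambda>x. sqrt (pi / c) * normal_density 0 \<sigma> x) has_integral sqrt (pi / c) * 1) UNIV"
    by (rule has_integral_mult_right)
  moreover have "sqrt (pi / c) * normal_density 0 \<sigma> x = exp (- (c * x\<^sup>2))" for x
    using assms by (simp add: normal_density_def s(2))
  ultimately show ?thesis by simp
qed

lemma gaussian_integrable_on: "(\<lambda>x::real. exp (- (c * x\<^sup>2))) integrable_on {a..b}"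
  by (intro integrable_continuous_real continuous_intros)

lemma gaussian_integral_le:
  assumes "0 < c"
  shows "integral {a..b} (\<lambda>x. exp (- (c * x\<^sup>2))) \<le> sqrt (pi / c)"
proof -
  have "integral {a..b} (\<lambda>x. exp (- (c * x\<^sup>2))) \<le> integral UNIV (\<lambda>x. exp (- (c * x\<^sup>2)))"
    by (rule integral_subset_le) (use gaussian_has_integral[OF assms] gaussian_integrable_on in auto)
  then show ?thesis using gaussian_has_integral[OF assms] by (simp add: integral_unique)
qed

text \<open>Outside {- b..b} half of the exponent is spent on the factor exp (- c b^2 / 2) and the
  other half is integrated over the whole line.\<close>

lemma gaussian_integral_ge:
  assumes "0 < c" "0 \<le> b"
  shows "sqrt (pi / c) - exp (- (c * b\<^sup>2 / 2)) * sqrt (2 * pi / c) \<le> integral {- b..b} (\<lambda>x. exp (- (c * x\<^sup>2)))"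
proof -
  let ?g = "\<lambda>x::real. exp (- (c * x\<^sup>2))"
  let ?h = "\<lambda>x::real. exp (- (c / 2 * x\<^sup>2))"
  have r: "((\<lambda>x. if x \<in> {- b..b} then ?g x else 0) has_integral integral {- b..b} ?g) UNIV"
    unfolding has_integral_restrict_UNIV using gaussian_integrable_on by (rule integrable_integral)
  have h: "((\<lambda>x. exp (- (c * b\<^sup>2 / 2)) * ?h x) has_integral exp (- (c * b\<^sup>2 / 2)) * sqrt (pi / (c / 2))) UNIV"
    by (intro has_integral_mult_right gaussian_has_integral) (use assms in simp)
  have "sqrt (pi / c) \<le> integral {- b..b} ?g + exp (- (c * b\<^sup>2 / 2)) * sqrt (pi / (c / 2))"
  proof (rule has_integral_le[OF gaussian_has_integral[OF assms(1)] has_integral_add[OF r h]])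
    fix x :: real
    show "?g x \<le> (if x \<in> {- b..b} then ?g x else 0) + exp (- (c * b\<^sup>2 / 2)) * ?h x"
    proof (cases "x \<in> {- b..b}")
      case False
      then have "b \<le> \<bar>x\<bar>" by auto
      then have "b\<^sup>2 \<le> x\<^sup>2" using assms(2) by (metis abs_of_nonneg abs_le_square_iff)
      then have "c * b\<^sup>2 \<le> c * x\<^sup>2" using assms(1) by (intro mult_left_mono) auto
      then have "?g x \<le> exp (- (c * b\<^sup>2 / 2) + - (c / 2 * x\<^sup>2))" by simp
      then show ?thesis using False unfolding exp_add by simp
    qed simp
  qed
  then show ?thesis by (simp add: mult.commute)
qed

lemma integral_even_half:
  fixes f :: "real \<Rightarrow> real"
  assumes "continuous_on {- b..b} f" "\<And>x. f (- x) = f x" "0 \<le> b"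
  shows "integral {0..b} f = integral {- b..b} f / 2"
proof -
  have i: "f integrable_on {- b..b}" using assms(1) by (rule integrable_continuous_real)
  have "integral {- b..0} f = integral {0..b} f"
    using Henstock_Kurzweil_Integration.integral_reflect_real[of b 0 f] assms(2) by simp
  then show ?thesis
    using Henstock_Kurzweil_Integration.integral_combine[OF _ _ i, of 0] assms(3) by simp
qed

lemma integral_odd_zero:
  fixes f :: "real \<Rightarrow> real"
  assumes "\<And>x. f (- x) = - f x"
  shows "integral {- b..b} f = 0"
proof -
  have "integral {- b..b} (\<lambda>x. f (- x)) = integral {- b..b} f"
    using Henstock_Kurzweil_Integration.integral_reflect_real[of b "- b" f] by simp
  then show ?thesis using assms by simp
qed

section \<open>The exponential of - \<rho> / (1 - i y) for |y| \<le> 1\<close>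

lemma Complex_1_inverse:
  "of_real \<rho> / Complex 1 (- y) = Complex (\<rho> / (1 + y\<^sup>2)) (\<rho> * y / (1 + y\<^sup>2))"
  by (simp add: complex_eq_iff Re_divide Im_divide)

lemma exp_minus_le_of_le:
  fixes a b :: real
  assumes "b \<le> a"
  shows "\<bar>exp (- b) - exp (- a)\<bar> \<le> (a - b) * exp (- b)"
proof -
  have "1 - exp (- (a - b)) \<le> a - b" using exp_ge_add_one_self[of "- (a - b)"] by linarith
  then have "exp (- b) * (1 - exp (- (a - b))) \<le> exp (- b) * (a - b)" by (intro mult_left_mono) auto
  moreover have "exp (- b) * (1 - exp (- (a - b))) = exp (- b) - exp (- a)"
    by (simp add: right_diff_distrib exp_add[symmetric])
  ultimately have "exp (- b) - exp (- a) \<le> (a - b) * exp (- b)" by (metis mult.commute)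
  moreover have "exp (- a) \<le> exp (- b)" using assms by simp
  ultimately show ?thesis by simp
qed

lemma saddle_norm:
  assumes "0 \<le> \<rho>" "\<bar>y\<bar> \<le> 1"
  shows "cmod (exp (- (of_real \<rho> / Complex 1 (- y)))) \<le> exp (- (\<rho> / 2))"
proof -
  have "y\<^sup>2 \<le> 1" using assms(2) by (simp add: abs_square_le_1)
  then have "\<rho> / 2 \<le> \<rho> / (1 + y\<^sup>2)" using assms(1) by (intro divide_left_mono) (auto simp: add_pos_nonneg)
  then show ?thesis unfolding Complex_1_inverse by simp
qed

text \<open>The exponents differ by at most \<rho> |y|, and both have real part at most - \<rho>/2;
  half of that decay absorbs the factor \<rho>.\<close>

lemma saddle_diff:
  assumes "0 \<le> \<rho>" "\<bar>y\<bar> \<le> 1"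
  shows "cmod (exp (- (of_real \<rho> / Complex 1 (- y))) - of_real (exp (- \<rho>))) \<le> 4 * \<bar>y\<bar> * exp (- (\<rho> / 4))"
proof -
  define a where "a = - (of_real \<rho> / Complex 1 (- y))"
  have y2: "y\<^sup>2 \<le> 1" using assms(2) by (simp add: abs_square_le_1)
  then have "\<rho> / 2 \<le> \<rho> / (1 + y\<^sup>2)" using assms(1) by (intro divide_left_mono) (auto simp: add_pos_nonneg)
  then have "cmod (exp a - exp (- of_real \<rho>)) \<le> exp (- (\<rho> / 2)) * cmod (a - (- of_real \<rho>))"
    by (intro norm_exp_diff_le) (use assms(1) in \<open>auto simp: a_def Complex_1_inverse\<close>)
  also have "cmod (a - (- of_real \<rho>)) \<le> \<rho> * \<bar>y\<bar>"
  proof -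
    have nz: "Complex 1 (- y) \<noteq> 0" by (simp add: complex_eq_iff)
    have "a - (- of_real \<rho>) = - \<i> * of_real (\<rho> * y) / Complex 1 (- y)"
    proof -
      have "a - (- of_real \<rho>) = (of_real \<rho> * Complex 1 (- y) - of_real \<rho>) / Complex 1 (- y)"
        using nz by (simp add: a_def diff_divide_distrib)
      also have "of_real \<rho> * Complex 1 (- y) - of_real \<rho> = - \<i> * of_real (\<rho> * y)"
        by (simp add: complex_eq_iff)
      finally show ?thesis .
    qed
    then have "cmod (a - (- of_real \<rho>)) = \<rho> * \<bar>y\<bar> / cmod (Complex 1 (- y))"
      using assms(1) by (simp add: norm_divide norm_mult abs_mult)
    also have "\<dots> \<le> \<rho> * \<bar>y\<bar> / 1"
      using complex_Re_le_cmod[of "Complex 1 (- y)"] assms(1) by (intro divide_left_mono) auto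
    finally show ?thesis by simp
  qed
  also have "exp (- (\<rho> / 2)) * (\<rho> * \<bar>y\<bar>) = 4 * \<bar>y\<bar> * ((\<rho> / 4) ^ 1 * exp (- (\<rho> / 4))) * exp (- (\<rho> / 4))"
    by (simp add: exp_add[symmetric])
  also have "\<dots> \<le> 4 * \<bar>y\<bar> * fact 1 * exp (- (\<rho> / 4))"
    by (intro mult_right_mono mult_left_mono power_times_exp_le) (use assms(1) in auto)
  finally show ?thesis by (simp add: a_def mult_left_mono exp_of_real[symmetric] del: exp_of_real)
qed

text \<open>The first-order correction, of size lam |y|^3, is imaginary and disappears in the real
  part. With x = lam y^2 the rest is O(x y^2 + x^2 y^2); substituting y^2 = x / lam gives the factor
  1 / lam, and the powers of x are absorbed with constant 16 * 2! + 32 * 3! = 224.\<close>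

lemma saddle_Re:
  assumes "0 < lam" "\<bar>y\<bar> \<le> 1"
  shows "\<bar>Re (exp (- (of_real (lam * y\<^sup>2) / Complex 1 (- y)))) - exp (- (lam * y\<^sup>2))\<bar> \<le> 224 / lam * exp (- (lam * y\<^sup>2 / 4))"
proof -
  define x where "x = lam * y\<^sup>2"
  define q where "q = x / (1 + y\<^sup>2)"
  define v where "v = x * y / (1 + y\<^sup>2)"
  have y2: "y\<^sup>2 \<le> 1" "0 \<le> y\<^sup>2" using assms(2) by (auto simp: abs_square_le_1)
  have x: "0 \<le> x" using assms(1) by (simp add: x_def)
  have yx: "y\<^sup>2 = x / lam" using assms(1) by (simp add: x_def)
  have q1: "x / 2 \<le> q" unfolding q_def using x y2 by (intro divide_left_mono) (auto simp: add_pos_nonneg)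
  have q2: "q \<le> x" unfolding q_def using x y2 by (simp add: divide_le_eq add_pos_nonneg mult_le_cancel_left1)
  have eq: "Re (exp (- (of_real x / Complex 1 (- y)))) = exp (- q) * cos v"
    unfolding Complex_1_inverse by (simp add: Re_exp q_def v_def)
  have e1: "\<bar>exp (- q) - exp (- x)\<bar> \<le> x * y\<^sup>2 * exp (- (x / 2))"
  proof -
    have "\<bar>exp (- q) - exp (- x)\<bar> \<le> (x - q) * exp (- q)" by (rule exp_minus_le_of_le[OF q2])
    also have "\<dots> \<le> x * y\<^sup>2 * exp (- (x / 2))"
    proof (rule mult_mono)
      have "x - q = x * y\<^sup>2 / (1 + y\<^sup>2)" using y2 by (simp add: q_def field_simps add_nonneg_eq_0_iff)
      also have "\<dots> \<le> x * y\<^sup>2 / 1" using x y2 by (intro divide_left_mono) (auto simp: add_pos_nonneg)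
      finally show "x - q \<le> x * y\<^sup>2" by simp
    qed (use q1 x in auto)
    finally show ?thesis .
  qed
  have e2: "\<bar>1 - cos v\<bar> \<le> x\<^sup>2 * y\<^sup>2 / 2"
  proof -
    have "1 - cos v = 2 * (sin (v / 2))\<^sup>2" using cos_double_sin[of "v / 2"] by simp
    moreover have "(sin (v / 2))\<^sup>2 \<le> (v / 2)\<^sup>2" using abs_sin_x_le_abs_x[of "v / 2"] by (simp only: abs_le_square_iff)
    ultimately have "\<bar>1 - cos v\<bar> \<le> v\<^sup>2 / 2" by (simp add: power2_eq_square)
    moreover have "v\<^sup>2 \<le> x\<^sup>2 * y\<^sup>2"
    proof -
      have "\<bar>v\<bar> = x * \<bar>y\<bar> / (1 + y\<^sup>2)" using x y2 by (simp add: v_def abs_mult)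
      also have "\<dots> \<le> x * \<bar>y\<bar> / 1" using x y2 by (intro divide_left_mono) (auto simp: add_pos_nonneg)
      finally have "\<bar>v\<bar> \<le> \<bar>x * y\<bar>" using x by (simp add: abs_mult)
      then show ?thesis by (simp only: abs_le_square_iff power_mult_distrib)
    qed
    ultimately show ?thesis by linarith
  qed
  have "exp (- q) * cos v - exp (- x) = (exp (- q) - exp (- x)) - exp (- q) * (1 - cos v)" by (simp add: algebra_simps)
  then have "\<bar>exp (- q) * cos v - exp (- x)\<bar> \<le> \<bar>exp (- q) - exp (- x)\<bar> + exp (- q) * \<bar>1 - cos v\<bar>"
    using abs_triangle_ineq4[of "exp (- q) - exp (- x)" "exp (- q) * (1 - cos v)"] by (simp add: abs_mult)
  also have "\<dots> \<le> x * y\<^sup>2 * exp (- (x / 2)) + exp (- (x / 2)) * (x\<^sup>2 * y\<^sup>2 / 2)"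
    by (intro add_mono e1 mult_mono e2) (use q1 in auto)
  also have "\<dots> = (16 * ((x / 4) ^ 2 * exp (- (x / 4))) + 32 * ((x / 4) ^ 3 * exp (- (x / 4)))) / lam * exp (- (x / 4))"
  proof -
    have "exp (- (x / 2)) = exp (- (x / 4)) * exp (- (x / 4))" by (simp add: exp_add[symmetric])
    then show ?thesis unfolding yx using assms(1) by (simp add: field_simps power2_eq_square power3_eq_cube)
  qed
  also have "\<dots> \<le> (16 * fact 2 + 32 * fact 3) / lam * exp (- (x / 4))"
    by (intro mult_right_mono divide_right_mono add_mono mult_left_mono power_times_exp_le) (use x assms(1) in auto)
  also have "\<dots> = 224 / lam * exp (- (x / 4))" by (simp add: fact_numeral)
  finally show ?thesis unfolding x_def[symmetric] eq .
qed

section \<open>The saddle point\<close>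

locale bias_parameters =
  fixes N K \<alpha> \<beta> :: nat
  assumes N_cases: "N = 2 \<or> N \<ge> 5"
    and class_bounds: "1 \<le> \<alpha>" "\<alpha> \<le> N" "1 \<le> \<beta>" "\<beta> \<le> N" "\<alpha> \<noteq> \<beta>"
begin

text \<open>For 1 \<le> x \<le> N this is the least number above \<open>K\<close> congruent to
  \<open>x\<close>, since \<open>e_vec\<close> counts the members of the class in {1..K}.\<close>

definition first_part :: "nat \<Rightarrow> nat" where "first_part x = x + N * e_vec K N x"

text \<open>n complete blocks of residues: every class contributes a progression of exactly n terms,
  and all parts up to n are included.\<close>

abbreviation parts :: "nat \<Rightarrow> nat set" where "parts n \<equiv> {K+1..K+N*n}"

abbreviation gf :: "nat \<Rightarrow> real \<Rightarrow> complex \<Rightarrow> complex" where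
  "gf n \<theta> w \<equiv> bias_gf (bias_char \<alpha> \<beta> N) (parts n) \<theta> w"

text \<open>The last condition says that \<open>t\<close> is the saddle point \<open>\<pi> / \<surd>(12 n)\<close>.\<close>

definition admissible :: "real \<Rightarrow> nat \<Rightarrow> bool" where
  "admissible t n \<longleftrightarrow> 0 < t \<and> t \<le> 1 / (24 * real N) \<and> real n * t\<^sup>2 = pi\<^sup>2 / 12"

text \<open>\<open>lam t\<close> is n t at the saddle and governs the Gaussian in y = \<phi> / t;
  \<open>rho\<close> is the exponent of the \<theta>-Gaussian at \<phi> = 0; \<open>kap\<close> is
  2^(- K - 1/2); \<open>W\<close> is the peak value of exp (n w + pi^2 / (12 w));
  \<open>shift\<close> is the approximate mean excess. All errors are measured in \<open>W\<close>
  times powers of t.\<close>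

definition lam :: "real \<Rightarrow> real" where "lam t = pi\<^sup>2 / (12 * t)"
definition rho :: "real \<Rightarrow> real \<Rightarrow> real" where "rho t \<theta> = \<theta>\<^sup>2 / (2 * real N * t)"
definition kap :: real where "kap = exp (- ((real K + 1/2) * ln 2))"
definition W :: "real \<Rightarrow> nat \<Rightarrow> real" where "W t n = exp (2 * (real n * t))"
definition CA :: real where "CA = 80 + 20 * (real K + 1)\<^sup>2"
definition CB :: real where "CB = biasC N (first_part \<alpha>) (first_part \<beta>)"
definition shift :: real where "shift = (real (first_part \<beta>) - real (first_part \<alpha>)) / (2 * real N)"

lemma N_ge_2: "2 \<le> N" using N_cases by auto

lemma admissibleD:
  assumes "admissible t n"
  shows "0 < t" "t \<le> 1 / 48" "t \<le> 1" "real N * t \<le> 1" "real n * t = lam t" "0 < lam t" "1 \<le> real n"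
proof -
  show t: "0 < t" using assms by (simp add: admissible_def)
  have a: "t \<le> 1 / (24 * real N)" using assms by (simp add: admissible_def)
  have "1 / (24 * real N) \<le> 1 / 48" using N_ge_2 by (simp add: field_simps)
  then show "t \<le> 1 / 48" using a by linarith
  then show "t \<le> 1" by linarith
  have "real N * t \<le> real N * (1 / (24 * real N))" using a by (intro mult_left_mono) auto
  then show "real N * t \<le> 1" using N_ge_2 by simp
  have "real n * t * t = pi\<^sup>2 / 12" using assms by (simp add: admissible_def power2_eq_square mult.assoc)
  then show l: "real n * t = lam t" using t by (simp add: lam_def field_simps)
  show "0 < lam t" using t by (simp add: lam_def)
  then have "n \<noteq> 0" using l by (cases n) auto
  then show "1 \<le> real n" by simp
qed

lemma first_part_bounds:
  assumes "1 \<le> x" "x \<le> N"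
  shows "first_part x \<in> {K+1..K+N}"
proof -
  define q r where "q = K div N" and "r = K mod N"
  have K: "K = N * q + r" by (simp add: q_def r_def)
  have r: "r < N" using N_ge_2 by (simp add: r_def)
  have e: "e_vec K N x = q + (if x \<le> r then 1 else 0)"
    by (simp add: e_vec_def q_def r_def minus_mult_div_eq_mod)
  show ?thesis
  proof (cases "x \<le> r")
    case True
    then show ?thesis using assms r unfolding first_part_def e by (simp add: K)
  next
    case False
    then show ?thesis using assms r unfolding first_part_def e by (simp add: K)
  qed
qed

lemma class_image:
  assumes "1 \<le> x" "x \<le> N"
  shows "{m \<in> parts n. [m = x] (mod N)} = (\<lambda>k. first_part x + k * N) ` {..<n}"
proof (intro equalityI subsetI)
  note b = first_part_bounds[OF assms]
  have fx: "[first_part x = x] (mod N)" by (simp add: first_part_def Cong.cong_def)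
  fix m assume "m \<in> {m \<in> parts n. [m = x] (mod N)}"
  then have m: "m \<in> parts n" "[m = first_part x] (mod N)" using fx cong_trans cong_sym by blast+
  have ge: "first_part x \<le> m"
  proof (rule ccontr)
    assume l: "\<not> first_part x \<le> m"
    then have "N dvd first_part x - m" using m(2) by (metis cong_altdef_nat cong_sym nat_le_linear)
    then have "N \<le> first_part x - m" using l by (intro dvd_imp_le) auto
    then show False using m(1) b by auto
  qed
  then have "N dvd m - first_part x" using m(2) by (metis cong_altdef_nat)
  then obtain k where k: "m - first_part x = N * k" by (elim dvdE)
  then have mk: "m = first_part x + k * N" using k ge by (metis le_add_diff_inverse mult.commute)
  have "k < n"
  proof (rule ccontr)
    assume "\<not> k < n"
    then have "N * n \<le> N * k" by simp
    moreover have "m \<le> K + N * n" "K + 1 \<le> first_part x" using m(1) b by auto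
    moreover have "m = first_part x + N * k" using mk by (simp only: mult.commute)
    ultimately show False by linarith
  qed
  then show "m \<in> (\<lambda>k. first_part x + k * N) ` {..<n}" using mk by blast
next
  note b = first_part_bounds[OF assms]
  fix m assume "m \<in> (\<lambda>k. first_part x + k * N) ` {..<n}"
  then obtain k where k: "k < n" "m = first_part x + k * N" by blast
  have "Suc k * N \<le> n * N" using k(1) by (intro mult_right_mono) auto
  then have "m \<in> parts n" using k b by (auto simp: mult.commute)
  moreover have "[m = x] (mod N)"
  proof -
    have "m = x + (e_vec K N x + k) * N" using k(2) by (simp add: first_part_def algebra_simps)
    then show ?thesis unfolding Cong.cong_def by simp
  qed
  ultimately show "m \<in> {m \<in> parts n. [m = x] (mod N)}" by simp
qed

lemma not_cong: "\<not> [\<alpha> = \<beta>] (mod N)"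
proof
  assume "[\<alpha> = \<beta>] (mod N)"
  then have "\<alpha> mod N = \<beta> mod N" by (simp add: Cong.cong_def)
  then show False using class_bounds by (cases "\<alpha> = N"; cases "\<beta> = N") auto
qed

lemma gf_split:
  "gf n \<theta> w = (\<Prod>k<n. 1 + exp (\<i> * of_real \<theta> - of_nat (first_part \<alpha> + k * N) * w))
     * (\<Prod>k<n. 1 + exp (- (\<i> * of_real \<theta>) - of_nat (first_part \<beta> + k * N) * w))
     * (\<Prod>m\<in>{m \<in> parts n. \<not> [m = \<alpha>] (mod N) \<and> \<not> [m = \<beta>] (mod N)}. 1 + exp (- (of_nat m * w)))"
proof -
  define A where "A = {m \<in> parts n. [m = \<alpha>] (mod N)}"
  define B where "B = {m \<in> parts n. [m = \<beta>] (mod N)}"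
  define R where "R = {m \<in> parts n. \<not> [m = \<alpha>] (mod N) \<and> \<not> [m = \<beta>] (mod N)}"
  define f where "f m = 1 + exp (\<i> * of_real (\<theta> * of_int (bias_char \<alpha> \<beta> N m)) - of_nat m * w)" for m
  have u: "parts n = (A \<union> B) \<union> R" by (auto simp: A_def B_def R_def)
  have dis: "A \<inter> B = {}" "(A \<union> B) \<inter> R = {}"
    using not_cong cong_trans cong_sym unfolding A_def B_def R_def by blast+
  have fin: "finite A" "finite B" "finite R" by (auto simp: A_def B_def R_def)
  have inj: "inj_on (\<lambda>k. c + k * N) {..<n}" for c using N_ge_2 by (auto simp: inj_on_def)
  have "gf n \<theta> w = prod f ((A \<union> B) \<union> R)" unfolding bias_gf_def f_def u[symmetric] ..
  also have "\<dots> = prod f A * prod f B * prod f R"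
    using dis fin by (simp add: prod.union_disjoint)
  also have "prod f A = (\<Prod>k<n. f (first_part \<alpha> + k * N))"
    unfolding A_def class_image[OF class_bounds(1,2)] by (simp add: prod.reindex[OF inj])
  also have "\<dots> = (\<Prod>k<n. 1 + exp (\<i> * of_real \<theta> - of_nat (first_part \<alpha> + k * N) * w))"
    by (rule prod.cong[OF refl]) (simp add: f_def bias_char_add, simp add: bias_char_def first_part_def Cong.cong_def)
  also have "prod f B = (\<Prod>k<n. f (first_part \<beta> + k * N))"
    unfolding B_def class_image[OF class_bounds(3,4)] by (simp add: prod.reindex[OF inj])
  also have "\<dots> = (\<Prod>k<n. 1 + exp (- (\<i> * of_real \<theta>) - of_nat (first_part \<beta> + k * N) * w))"
  proof (rule prod.cong[OF refl])
    fix k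
    have "[first_part \<beta> = \<beta>] (mod N)" by (simp add: first_part_def Cong.cong_def)
    moreover from this have "\<not> [first_part \<beta> = \<alpha>] (mod N)" using not_cong cong_trans cong_sym by blast
    ultimately have "bias_char \<alpha> \<beta> N (first_part \<beta> + k * N) = - 1" unfolding bias_char_add by (simp add: bias_char_def)
    then show "f (first_part \<beta> + k * N) = 1 + exp (- (\<i> * of_real \<theta>) - of_nat (first_part \<beta> + k * N) * w)"
      unfolding f_def by simp
  qed
  also have "prod f R = (\<Prod>m\<in>R. 1 + exp (- (of_nat m * w)))"
    by (rule prod.cong[OF refl]) (simp add: f_def R_def bias_char_def)
  finally show ?thesis by (simp add: R_def)
qed

text \<open>The far-endpoint condition of both sum asymptotics. Here n t = c / t with c = pi^2 / 12;
  a cubic bound for exp (- c / t) leaves a spare factor t to absorb the constant.\<close>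

lemma tail_small:
  assumes "admissible t n"
  shows "exp (- (real n * t)) \<le> t\<^sup>2 / 2"
proof -
  note A = admissibleD[OF assms]
  define c where "c = pi\<^sup>2 / 12"
  have p: "9 \<le> pi\<^sup>2" using power_mono[of 3 pi 2] pi_gt3 by simp
  have c: "3/4 \<le> c" using p by (simp add: c_def)
  have "real n * t = c / t" unfolding A(5) by (simp add: lam_def c_def)
  then have "exp (- (real n * t)) \<le> fact 3 / c ^ 3 * t ^ 3"
    using exp_neg_inverse_le[of c t 3] c A(1) by simp
  also have "\<dots> \<le> fact 3 / (3/4) ^ 3 * t ^ 3"
    using A(1) c by (intro mult_right_mono divide_left_mono power_mono) auto
  also have "\<dots> = t\<^sup>2 * (fact 3 / (3/4) ^ 3 * t)" by (simp add: power2_eq_square power3_eq_cube)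
  also have "\<dots> \<le> t\<^sup>2 * (1 / 2)"
  proof (rule mult_left_mono)
    have "fact 3 / (3/4) ^ 3 * t \<le> fact 3 / (3/4) ^ 3 * (1 / 32 :: real)"
      using A(2) by (intro mult_left_mono) auto
    then show "fact 3 / (3/4) ^ 3 * t \<le> 1 / 2" by (simp add: fact_numeral power3_eq_cube)
  qed simp
  finally show ?thesis by simp
qed

lemma gf_zero_asymp:
  assumes "admissible t n" "\<bar>\<phi>\<bar> \<le> t"
  shows "\<exists>r. gf n 0 (Complex t (- \<phi>)) = of_real kap * exp (of_real (pi\<^sup>2 / 12) / Complex t (- \<phi>) + r) \<and> cmod r \<le> CA * t"
proof -
  note A = admissibleD[OF assms(1)]
  define w where "w = Complex t (- \<phi>)"
  define S where "S = (\<Sum>m = K + 1..K + N * n. lfun (of_nat m * w))"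
  define r where "r = S - (of_real (pi\<^sup>2 / 12) / w - of_real ((real K + 1/2) * ln 2))"
  have "n \<le> N * n" using N_ge_2 by simp
  then have "real n \<le> real (N * n)" by (rule of_nat_mono)
  then have "real n * t \<le> real (N * n) * t" using A(1) by (intro mult_right_mono) auto
  then have "exp (- (real (N * n) * t)) \<le> t\<^sup>2 / 2"
    using tail_small[OF assms(1)] by (meson exp_le_cancel_iff neg_le_iff_le order_trans)
  then have "cmod r \<le> CA * t"
    unfolding r_def S_def CA_def by (intro log_product_asymp) (use A assms w_def in auto)
  moreover have "gf n 0 w = exp S"
  proof -
    have "of_nat m * w \<in> sigdom" for m :: nat
      using ray_sigdom[OF assms(2), of "real m"] by (simp add: w_def)
    then have "exp (lfun (of_nat m * w)) = 1 + exp (- (of_nat m * w))" for m :: nat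
      unfolding lfun_def by (intro exp_Ln one_plus_exp_nz)
    then show ?thesis by (simp add: bias_gf_def S_def exp_sum)
  qed
  moreover have "exp S = of_real kap * exp (of_real (pi\<^sup>2 / 12) / w + r)"
    by (simp add: r_def kap_def exp_of_real[symmetric] exp_add[symmetric] del: exp_of_real)
  ultimately show ?thesis unfolding w_def by metis
qed

text \<open>The parts outside both classes give a factor independent of \<theta>, which is common to
  both sides; only the two progressions of \<open>log_bias_asymp\<close> matter.\<close>

lemma gf_ratio:
  assumes "admissible t n" "\<bar>\<phi>\<bar> \<le> t" "\<bar>\<theta>\<bar> \<le> 1/2"
  shows "\<exists>r. gf n \<theta> (Complex t (- \<phi>)) = gf n 0 (Complex t (- \<phi>)) *
     exp (- of_real (\<theta>\<^sup>2) / (2 * of_nat N * Complex t (- \<phi>)) + \<i> * of_real (\<theta> * shift) + r)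
     \<and> cmod r \<le> CB * (\<bar>\<theta>\<bar> + t) * \<bar>\<theta>\<bar>"
proof -
  note A = admissibleD[OF assms(1)]
  define w where "w = Complex t (- \<phi>)"
  define H where "H \<zeta> = (\<Sum>k<n. lfun (of_nat (first_part \<alpha> + k * N) * w - \<zeta>)) + (\<Sum>k<n. lfun (of_nat (first_part \<beta> + k * N) * w + \<zeta>))" for \<zeta>
  define r where "r = H (\<i> * of_real \<theta>) - H 0 - (- of_real (\<theta>\<^sup>2) / (2 * of_nat N * w) + \<i> * of_real (\<theta> * (real (first_part \<beta>) - real (first_part \<alpha>)) / (2 * real N)))"
  have fp: "1 \<le> first_part \<alpha>" "1 \<le> first_part \<beta>" using class_bounds by (auto simp: first_part_def)
  have r: "cmod r \<le> CB * (\<bar>\<theta>\<bar> + t) * \<bar>\<theta>\<bar>"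
    unfolding r_def H_def CB_def
    by (rule log_bias_asymp[OF A(1,4) assms(2) w_def _ tail_small[OF assms(1)] fp assms(3)]) (use N_ge_2 in simp)
  define Rp where "Rp = (\<Prod>m\<in>{m \<in> parts n. \<not> [m = \<alpha>] (mod N) \<and> \<not> [m = \<beta>] (mod N)}. 1 + exp (- (of_nat m * w)))"
  have key: "gf n x w = exp (H (\<i> * of_real x)) * Rp" if x: "\<bar>x\<bar> \<le> 1/2" for x
  proof -
    have a: "exp (lfun (of_nat m * w - \<i> * of_real x)) = 1 + exp (\<i> * of_real x - of_nat m * w)" for m :: nat
    proof -
      have "of_real (real m) * w - \<i> * of_real x \<in> sigdom"
        unfolding w_def by (rule shifted_ray_sigdom[OF assms(2) _ x]) simp
      then show ?thesis using one_plus_exp_nz[of "of_nat m * w - \<i> * of_real x"] by (simp add: lfun_def)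
    qed
    have b: "exp (lfun (of_nat m * w + \<i> * of_real x)) = 1 + exp (- (\<i> * of_real x) - of_nat m * w)" for m :: nat
    proof -
      have "of_real (real m) * w - \<i> * of_real (- x) \<in> sigdom"
        unfolding w_def by (rule shifted_ray_sigdom[OF assms(2)]) (use x in auto)
      then show ?thesis using one_plus_exp_nz[of "of_nat m * w + \<i> * of_real x"] by (simp add: lfun_def algebra_simps)
    qed
    show ?thesis unfolding gf_split Rp_def H_def exp_add exp_sum[OF finite_lessThan] a b ..
  qed
  have "gf n \<theta> w = exp (H (\<i> * of_real \<theta>)) * Rp" by (rule key[OF assms(3)])
  also have "\<dots> = exp (H 0) * Rp * exp (H (\<i> * of_real \<theta>) - H 0)" by (simp add: exp_diff)
  also have "exp (H 0) * Rp = gf n 0 w" using key[of 0] by simp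
  also have "H (\<i> * of_real \<theta>) - H 0 = - of_real (\<theta>\<^sup>2) / (2 * of_nat N * w) + \<i> * of_real (\<theta> * shift) + r"
    by (simp add: r_def shift_def)
  finally show ?thesis using r unfolding w_def by blast
qed

text \<open>\<open>G\<close> is the integrand of the Fourier inversion and \<open>Q\<close> its
  value at \<theta> = 0. \<open>P\<close> is the model with Gaussian factor exp (- \<theta>^2 / (2 N
  w)); the phase exp (i \<theta> shift) is kept outside of \<open>P\<close>, so that
  \<open>P\<close> is conjugate-symmetric in \<phi>.\<close>

definition Q :: "real \<Rightarrow> nat \<Rightarrow> real \<Rightarrow> complex" where
  "Q t n \<phi> = gf n 0 (Complex t (- \<phi>)) * exp (of_nat n * Complex t (- \<phi>))"

definition G :: "real \<Rightarrow> nat \<Rightarrow> real \<Rightarrow> real \<Rightarrow> complex" where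
  "G t n \<theta> \<phi> = gf n \<theta> (Complex t (- \<phi>)) * exp (of_nat n * Complex t (- \<phi>))"

definition P :: "real \<Rightarrow> nat \<Rightarrow> real \<Rightarrow> real \<Rightarrow> complex" where
  "P t n \<theta> \<phi> = Q t n \<phi> * exp (- (of_real (rho t \<theta>) / Complex 1 (- (\<phi> / t))))"

text \<open>With \<open>w = t z\<close>, \<open>z = 1 - i y\<close> and \<open>\<lambda> = n t\<close>, the exponent \<open>n w + \<pi>\<^sup>2 / (12 w)\<close> equals
  \<open>\<lambda> (z + 1 / z) = 2 \<lambda> - \<lambda> y\<^sup>2 / z\<close>.\<close>

lemma Q_eq:
  assumes "admissible t n" "\<bar>\<phi>\<bar> \<le> t"
  shows "\<exists>r. Q t n \<phi> = of_real (kap * W t n) * exp (- (of_real (lam t * (\<phi> / t)\<^sup>2) / Complex 1 (- (\<phi> / t)))) * exp r \<and> cmod r \<le> CA * t"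
proof -
  note A = admissibleD[OF assms(1)]
  obtain r where r: "gf n 0 (Complex t (- \<phi>)) = of_real kap * exp (of_real (pi\<^sup>2 / 12) / Complex t (- \<phi>) + r)" "cmod r \<le> CA * t"
    using gf_zero_asymp[OF assms] by blast
  define y where "y = \<phi> / t"
  define z where "z = Complex 1 (- y)"
  have z0: "z \<noteq> 0" by (simp add: z_def complex_eq_iff)
  have w: "Complex t (- \<phi>) = of_real t * z" using A(1) by (simp add: z_def y_def complex_eq_iff)
  have zz: "z + 1 / z = 2 - of_real (y\<^sup>2) / z"
  proof -
    have "z * z + 1 = 2 * z - of_real (y\<^sup>2)" by (simp add: z_def complex_eq_iff power2_eq_square)
    then have "(z * z + 1) / z = (2 * z - of_real (y\<^sup>2)) / z" by simp
    then show ?thesis using z0 by (simp add: add_divide_distrib diff_divide_distrib)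
  qed
  have "of_nat n * Complex t (- \<phi>) + of_real (pi\<^sup>2 / 12) / Complex t (- \<phi>) = of_real (lam t) * (z + 1 / z)"
  proof -
    have "of_nat n * Complex t (- \<phi>) = of_real (real n * t) * z" unfolding w by simp
    moreover have "of_real (pi\<^sup>2 / 12) / Complex t (- \<phi>) = of_real (lam t) * (1 / z)"
      unfolding w by (simp add: lam_def)
    ultimately show ?thesis unfolding A(5) by (simp add: distrib_left)
  qed
  also have "\<dots> = of_real (2 * (real n * t)) - of_real (lam t * y\<^sup>2) / z"
    unfolding zz A(5) by (simp add: right_diff_distrib)
  finally have e: "of_nat n * Complex t (- \<phi>) + of_real (pi\<^sup>2 / 12) / Complex t (- \<phi>) = of_real (2 * (real n * t)) - of_real (lam t * y\<^sup>2) / z" .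
  have "Q t n \<phi> = of_real kap * exp (of_nat n * Complex t (- \<phi>) + of_real (pi\<^sup>2 / 12) / Complex t (- \<phi>)) * exp r"
    unfolding Q_def r(1) by (simp add: exp_add)
  also have "\<dots> = of_real (kap * W t n) * exp (- (of_real (lam t * y\<^sup>2) / z)) * exp r"
    unfolding e W_def by (simp add: exp_diff exp_minus field_simps exp_of_real[symmetric] del: exp_of_real)
  finally show ?thesis using r(2) unfolding y_def z_def by blast
qed

lemma G_eq:
  assumes "admissible t n" "\<bar>\<phi>\<bar> \<le> t" "\<bar>\<theta>\<bar> \<le> 1/2"
  shows "\<exists>r. G t n \<theta> \<phi> = P t n \<theta> \<phi> * exp (\<i> * of_real (\<theta> * shift)) * exp r \<and> cmod r \<le> CB * (\<bar>\<theta>\<bar> + t) * \<bar>\<theta>\<bar>"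
proof -
  note A = admissibleD[OF assms(1)]
  obtain r where r: "gf n \<theta> (Complex t (- \<phi>)) = gf n 0 (Complex t (- \<phi>)) *
     exp (- of_real (\<theta>\<^sup>2) / (2 * of_nat N * Complex t (- \<phi>)) + \<i> * of_real (\<theta> * shift) + r)" "cmod r \<le> CB * (\<bar>\<theta>\<bar> + t) * \<bar>\<theta>\<bar>"
    using gf_ratio[OF assms] by blast
  have w: "Complex t (- \<phi>) = of_real t * Complex 1 (- (\<phi> / t))" using A(1) by (simp add: complex_eq_iff)
  have "- of_real (\<theta>\<^sup>2) / (2 * of_nat N * Complex t (- \<phi>)) = - (of_real (rho t \<theta>) / Complex 1 (- (\<phi> / t)))"
    unfolding w by (simp add: rho_def mult.assoc)
  then have "G t n \<theta> \<phi> = P t n \<theta> \<phi> * exp (\<i> * of_real (\<theta> * shift)) * exp r"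
    unfolding G_def P_def Q_def r(1) by (simp only: exp_add mult_ac)
  then show ?thesis using r(2) by blast
qed

end

text \<open>The \<phi>-Gaussian has width t^(3/2); every pointwise bound gains this factor upon
  integration over \<phi>.\<close>

lemma gaussian_scaled_le:
  assumes "0 < t" "0 < q"
  shows "integral {- t..t} (\<lambda>\<phi>. exp (- (pi\<^sup>2 / (12 * t) * (\<phi> / t)\<^sup>2 / q))) \<le> 2 * sqrt q * (t * sqrt t)"
proof -
  define c where "c = pi\<^sup>2 / (12 * t ^ 3 * q)"
  have c: "0 < c" using assms by (simp add: c_def)
  have e: "pi\<^sup>2 / (12 * t) * (\<phi> / t)\<^sup>2 / q = c * \<phi>\<^sup>2" for \<phi>
    using assms by (simp add: c_def field_simps power2_eq_square power3_eq_cube)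
  have "integral {- t..t} (\<lambda>\<phi>. exp (- (pi\<^sup>2 / (12 * t) * (\<phi> / t)\<^sup>2 / q))) \<le> sqrt (pi / c)"
    unfolding e by (rule gaussian_integral_le[OF c])
  also have "\<dots> \<le> sqrt ((2 * t)\<^sup>2 * (q * t))"
  proof (rule real_sqrt_le_mono)
    have "pi / c = 12 / pi * (t ^ 3 * q)" using assms by (simp add: c_def power2_eq_square)
    also have "\<dots> \<le> 4 * (t ^ 3 * q)" using assms pi_gt3 by (intro mult_right_mono) (auto simp: field_simps)
    finally show "pi / c \<le> (2 * t)\<^sup>2 * (q * t)" by (simp add: power2_eq_square power3_eq_cube algebra_simps)
  qed
  also have "\<dots> = 2 * sqrt q * (t * sqrt t)"
    using assms by (simp add: real_sqrt_mult)
  finally show ?thesis .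
qed

context bias_parameters
begin

lemma constants_nonneg: "0 < kap" "0 \<le> CA" "0 \<le> CB"
  by (auto simp: kap_def CA_def CB_def biasC_def)

lemma W_pos: "0 < W t n" by (simp add: W_def)

lemma rho_nonneg: "0 < t \<Longrightarrow> 0 \<le> rho t \<theta>" by (simp add: rho_def)

definition C1 :: real where "C1 = kap * exp CA"

lemma C1_pos: "0 < C1" using constants_nonneg by (simp add: C1_def)

lemma abs_div_le_1: "0 < t \<Longrightarrow> \<bar>\<phi>\<bar> \<le> t \<Longrightarrow> \<bar>\<phi> / t\<bar> \<le> (1::real)"
  by (simp add: abs_divide)

text \<open>exp (- lam y^2 / q) with y = \<phi> / t. The true profile is q = 1; larger q are weaker
  bounds, accepted in exchange for removing powers of y.\<close>

abbreviation gs :: "real \<Rightarrow> real \<Rightarrow> real \<Rightarrow> real" where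
  "gs q t \<phi> \<equiv> exp (- (pi\<^sup>2 / (12 * t) * (\<phi> / t)\<^sup>2 / q))"

lemma lam_gs: "exp (- (lam t * (\<phi> / t)\<^sup>2 / q)) = gs q t \<phi>" by (simp add: lam_def)

lemma norm_kW: "cmod (of_real (kap * W t n)) = kap * W t n"
  unfolding norm_of_real using constants_nonneg(1) W_pos[of t n] by simp

lemma norm_Q_le:
  assumes "admissible t n" "\<bar>\<phi>\<bar> \<le> t"
  shows "cmod (Q t n \<phi>) \<le> C1 * W t n * gs 2 t \<phi>"
proof -
  note A = admissibleD[OF assms(1)]
  obtain r where r: "Q t n \<phi> = of_real (kap * W t n) * exp (- (of_real (lam t * (\<phi> / t)\<^sup>2) / Complex 1 (- (\<phi> / t)))) * exp r" "cmod r \<le> CA * t"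
    using Q_eq[OF assms] by blast
  have "Re r \<le> CA * 1"
    using complex_Re_le_cmod[of r] r(2) mult_left_mono[OF A(3) constants_nonneg(2)] by linarith
  then have er: "cmod (exp r) \<le> exp CA" by simp
  have es: "cmod (exp (- (of_real (lam t * (\<phi> / t)\<^sup>2) / Complex 1 (- (\<phi> / t))))) \<le> gs 2 t \<phi>"
    unfolding lam_gs[symmetric] by (rule saddle_norm) (use A abs_div_le_1[OF A(1) assms(2)] in auto)
  have "cmod (Q t n \<phi>) = kap * W t n * (cmod (exp (- (of_real (lam t * (\<phi> / t)\<^sup>2) / Complex 1 (- (\<phi> / t))))) * cmod (exp r))"
    unfolding r(1) norm_mult norm_kW by simp
  also have "\<dots> \<le> kap * W t n * (gs 2 t \<phi> * exp CA)"
    by (intro mult_left_mono mult_mono es er) (use constants_nonneg(1) W_pos[of t n] in auto)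
  finally show ?thesis by (simp add: C1_def mult_ac)
qed

lemma Q_approx:
  assumes "admissible t n" "\<bar>\<phi>\<bar> \<le> t"
  shows "cmod (Q t n \<phi> - of_real (kap * W t n) * exp (- (of_real (lam t * (\<phi> / t)\<^sup>2) / Complex 1 (- (\<phi> / t))))) \<le> C1 * CA * W t n * t * gs 2 t \<phi>"
proof -
  note A = admissibleD[OF assms(1)]
  obtain r where r: "Q t n \<phi> = of_real (kap * W t n) * exp (- (of_real (lam t * (\<phi> / t)\<^sup>2) / Complex 1 (- (\<phi> / t)))) * exp r" "cmod r \<le> CA * t"
    using Q_eq[OF assms] by blast
  define E where "E = exp (- (of_real (lam t * (\<phi> / t)\<^sup>2) / Complex 1 (- (\<phi> / t))))"
  have "cmod r \<le> CA * 1"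
    using r(2) mult_left_mono[OF A(3) constants_nonneg(2)] by linarith
  then have er: "cmod (exp r - 1) \<le> CA * t * exp CA"
    by (intro order_trans[OF norm_exp_minus_one_le] mult_mono r(2)) (use constants_nonneg A in auto)
  have es: "cmod E \<le> gs 2 t \<phi>"
    unfolding lam_gs[symmetric] E_def by (rule saddle_norm) (use A abs_div_le_1[OF A(1) assms(2)] in auto)
  have "Q t n \<phi> - of_real (kap * W t n) * E = of_real (kap * W t n) * (E * (exp r - 1))"
    unfolding r(1) E_def[symmetric] by (simp add: algebra_simps)
  also have "cmod \<dots> = kap * W t n * (cmod E * cmod (exp r - 1))"
    unfolding norm_mult norm_kW by simp
  also have "\<dots> \<le> kap * W t n * (gs 2 t \<phi> * (CA * t * exp CA))"
    by (intro mult_left_mono mult_mono es er) (use constants_nonneg(1) W_pos[of t n] in auto)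
  finally show ?thesis by (simp add: C1_def E_def mult_ac)
qed

lemma norm_P_le:
  assumes "admissible t n" "\<bar>\<phi>\<bar> \<le> t"
  shows "cmod (P t n \<theta> \<phi>) \<le> C1 * W t n * exp (- (rho t \<theta> / 2)) * gs 2 t \<phi>"
proof -
  note A = admissibleD[OF assms(1)]
  have "cmod (exp (- (of_real (rho t \<theta>) / Complex 1 (- (\<phi> / t))))) \<le> exp (- (rho t \<theta> / 2))"
    by (rule saddle_norm[OF rho_nonneg[OF A(1)] abs_div_le_1[OF A(1) assms(2)]])
  then have "cmod (P t n \<theta> \<phi>) \<le> (C1 * W t n * gs 2 t \<phi>) * exp (- (rho t \<theta> / 2))"
    unfolding P_def norm_mult by (intro mult_mono norm_Q_le assms) (use C1_pos W_pos[of t n] in auto)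
  then show ?thesis by (simp add: mult_ac)
qed

lemma sqrt_exp_bound:
  fixes x :: real
  assumes "0 \<le> x"
  shows "sqrt x \<le> exp x"
proof -
  have "sqrt x * 1 \<le> 1 + x" using assms zero_le_power2[of "sqrt x - 1"] by (simp add: power2_diff)
  also have "\<dots> \<le> exp x" by (rule exp_ge_add_one_self)
  finally show ?thesis by simp
qed

text \<open>\<open>saddle_diff\<close> leaves a factor |y|. Under the Gaussian it is of order
  lam^(-1/2), that is sqrt t, at the price of passing from q = 2 to q = 4.\<close>

lemma P_approx:
  assumes "admissible t n" "\<bar>\<phi>\<bar> \<le> t"
  shows "cmod (P t n \<theta> \<phi> - of_real (exp (- rho t \<theta>)) * Q t n \<phi>) \<le> 12 * C1 * W t n * sqrt t * exp (- (rho t \<theta> / 4)) * gs 4 t \<phi>"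
proof -
  note A = admissibleD[OF assms(1)]
  define y where "y = \<phi> / t"
  have s: "cmod (exp (- (of_real (rho t \<theta>) / Complex 1 (- y))) - of_real (exp (- rho t \<theta>))) \<le> 4 * \<bar>y\<bar> * exp (- (rho t \<theta> / 4))"
    unfolding y_def by (rule saddle_diff[OF rho_nonneg[OF A(1)] abs_div_le_1[OF A(1) assms(2)]])
  have y: "\<bar>y\<bar> * gs 2 t \<phi> \<le> 3 * sqrt t * gs 4 t \<phi>"
  proof -
    define x where "x = lam t * y\<^sup>2 / 4"
    have x: "0 \<le> x" using A by (simp add: x_def)
    have "sqrt x = sqrt (lam t) / 2 * \<bar>y\<bar>" by (simp add: x_def real_sqrt_mult real_sqrt_divide)
    then have "\<bar>y\<bar> = 2 / sqrt (lam t) * sqrt x" using A(6) by (simp add: field_simps)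
    also have "\<dots> \<le> 3 * sqrt t * exp x"
    proof (intro mult_mono sqrt_exp_bound x)
      have "2 / sqrt (lam t) = sqrt (4 / lam t)" by (simp add: real_sqrt_divide)
      also have "\<dots> \<le> sqrt (9 * t)"
      proof (rule real_sqrt_le_mono)
        have "9 \<le> pi\<^sup>2" using power_mono[of 3 pi 2] pi_gt3 by simp
        then show "4 / lam t \<le> 9 * t" using A(1) by (simp add: lam_def field_simps)
      qed
      finally show "2 / sqrt (lam t) \<le> 3 * sqrt t" by (simp add: real_sqrt_mult)
    qed (use x A in auto)
    finally have "\<bar>y\<bar> * gs 2 t \<phi> \<le> 3 * sqrt t * exp x * gs 2 t \<phi>" by (intro mult_right_mono) auto
    also have "\<dots> = 3 * sqrt t * gs 4 t \<phi>"
      unfolding x_def y_def lam_gs[symmetric] by (simp add: exp_add[symmetric])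
    finally show ?thesis .
  qed
  have "P t n \<theta> \<phi> - of_real (exp (- rho t \<theta>)) * Q t n \<phi> = Q t n \<phi> * (exp (- (of_real (rho t \<theta>) / Complex 1 (- y))) - of_real (exp (- rho t \<theta>)))"
    by (simp add: P_def y_def algebra_simps)
  also have "cmod \<dots> \<le> (C1 * W t n * gs 2 t \<phi>) * (4 * \<bar>y\<bar> * exp (- (rho t \<theta> / 4)))"
    unfolding norm_mult by (intro mult_mono norm_Q_le assms s) (use C1_pos W_pos[of t n] in auto)
  also have "\<dots> = 4 * C1 * W t n * exp (- (rho t \<theta> / 4)) * (\<bar>y\<bar> * gs 2 t \<phi>)" by (simp add: mult_ac)
  also have "\<dots> \<le> 4 * C1 * W t n * exp (- (rho t \<theta> / 4)) * (3 * sqrt t * gs 4 t \<phi>)"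
    by (intro mult_left_mono y) (use C1_pos W_pos[of t n] in auto)
  finally show ?thesis by (simp add: mult_ac)
qed

lemma G_approx:
  assumes "admissible t n" "\<bar>\<phi>\<bar> \<le> t" "\<bar>\<theta>\<bar> \<le> 1/2"
  shows "cmod (G t n \<theta> \<phi> - exp (\<i> * of_real (\<theta> * shift)) * P t n \<theta> \<phi>)
    \<le> C1 * CB * exp CB * W t n * (\<bar>\<theta>\<bar> + t) * \<bar>\<theta>\<bar> * exp (- (rho t \<theta> / 2)) * gs 2 t \<phi>"
proof -
  note A = admissibleD[OF assms(1)]
  obtain r where r: "G t n \<theta> \<phi> = P t n \<theta> \<phi> * exp (\<i> * of_real (\<theta> * shift)) * exp r" "cmod r \<le> CB * (\<bar>\<theta>\<bar> + t) * \<bar>\<theta>\<bar>"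
    using G_eq[OF assms] by blast
  have "(\<bar>\<theta>\<bar> + t) * \<bar>\<theta>\<bar> \<le> 2 * (1/2)" by (intro mult_mono) (use assms A in auto)
  then have "CB * ((\<bar>\<theta>\<bar> + t) * \<bar>\<theta>\<bar>) \<le> CB * 1" by (intro mult_left_mono constants_nonneg) auto
  then have "cmod r \<le> CB" using r(2) by (simp add: mult.assoc)
  then have er: "cmod (exp r - 1) \<le> CB * (\<bar>\<theta>\<bar> + t) * \<bar>\<theta>\<bar> * exp CB"
    by (intro order_trans[OF norm_exp_minus_one_le] mult_mono r(2)) (use constants_nonneg A in auto)
  have "G t n \<theta> \<phi> - exp (\<i> * of_real (\<theta> * shift)) * P t n \<theta> \<phi> = exp (\<i> * of_real (\<theta> * shift)) * (P t n \<theta> \<phi> * (exp r - 1))"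
    unfolding r(1) by (simp add: algebra_simps)
  also have "cmod \<dots> = cmod (P t n \<theta> \<phi>) * cmod (exp r - 1)" by (simp add: norm_mult)
  also have "\<dots> \<le> (C1 * W t n * exp (- (rho t \<theta> / 2)) * gs 2 t \<phi>) * (CB * (\<bar>\<theta>\<bar> + t) * \<bar>\<theta>\<bar> * exp CB)"
    by (intro mult_mono norm_P_le assms er) (use C1_pos W_pos[of t n] in auto)
  finally show ?thesis by (simp add: mult_ac)
qed

section \<open>Integration over \<phi> on the central arc\<close>

lemma Complex_line: "Complex t (- \<phi>) = of_real t - \<i> * of_real \<phi>"
  by (simp add: complex_eq_iff)

lemma continuous_on_G: "continuous_on S (G t n \<theta>)"
  unfolding G_def [abs_def] bias_gf_def Complex_line by (intro continuous_intros)

lemma continuous_on_Q: "continuous_on S (Q t n)"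
  unfolding Q_def [abs_def] bias_gf_def Complex_line by (intro continuous_intros)

lemma continuous_on_saddle:
  assumes "0 < t" "continuous_on S f"
  shows "continuous_on S (\<lambda>\<phi>. of_real (f \<phi>) / Complex 1 (- (\<phi> / t)))"
proof (rule continuous_on_divide)
  show "continuous_on S (\<lambda>\<phi>. complex_of_real (f \<phi>))" by (intro continuous_intros assms)
  show "continuous_on S (\<lambda>\<phi>. Complex 1 (- (\<phi> / t)))"
    unfolding Complex_line by (intro continuous_intros) (use assms in simp)
  show "\<forall>\<phi>\<in>S. Complex 1 (- (\<phi> / t)) \<noteq> 0" by (simp add: complex_eq_iff)
qed

lemma continuous_on_P: "0 < t \<Longrightarrow> continuous_on S (P t n \<theta>)"
proof -
  assume t: "0 < t"
  show ?thesis
    unfolding P_def [abs_def] by (intro continuous_intros continuous_on_Q continuous_on_saddle t)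
qed

lemma P_uminus: "P t n \<theta> (- \<phi>) = cnj (P t n \<theta> \<phi>)"
proof -
  have c: "cnj (Complex t x) = Complex t (- x)" for t x by (simp add: complex_eq_iff)
  have "Q t n (- \<phi>) = cnj (Q t n \<phi>)"
    unfolding Q_def bias_gf_def by (simp add: c exp_cnj cnj_prod)
  moreover have "exp (- (of_real (rho t \<theta>) / Complex 1 (- (- \<phi> / t)))) = cnj (exp (- (of_real (rho t \<theta>) / Complex 1 (- (\<phi> / t)))))"
    by (simp add: c exp_cnj)
  ultimately show ?thesis by (simp add: P_def)
qed

definition V :: "real \<Rightarrow> nat \<Rightarrow> real \<Rightarrow> real" where
  "V t n \<theta> = integral {- t..t} (\<lambda>\<phi>. Re (P t n \<theta> \<phi>))"

text \<open>That this integral is real removes the mixed terms of odd order in \<open>\<phi>\<close> (such as \<open>\<theta>\<^sup>2 \<phi>\<close>), which are too large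
  to be treated as errors.\<close>

lemma integral_P: "0 < t \<Longrightarrow> integral {- t..t} (P t n \<theta>) = of_real (V t n \<theta>)"
proof -
  assume t: "0 < t"
  have i: "P t n \<theta> integrable_on {- t..t}"
    by (intro integrable_continuous_real continuous_on_P t)
  have "Re (integral {- t..t} (P t n \<theta>)) = V t n \<theta>"
    unfolding V_def using integral_linear[OF i bounded_linear_Re] by (simp add: o_def)
  moreover have "Im (integral {- t..t} (P t n \<theta>)) = integral {- t..t} (\<lambda>\<phi>. Im (P t n \<theta> \<phi>))"
    using integral_linear[OF i bounded_linear_Im] by (simp add: o_def)
  moreover have "integral {- t..t} (\<lambda>\<phi>. Im (P t n \<theta> \<phi>)) = 0"
    by (rule integral_odd_zero) (simp add: P_uminus)
  ultimately show ?thesis by (simp add: complex_eq_iff)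
qed

lemma norm_integral_gs_le:
  fixes f :: "real \<Rightarrow> 'a::euclidean_space"
  assumes t: "0 < t" and q: "0 < q" and f: "f integrable_on {- t..t}" and "0 \<le> B"
    and b: "\<And>\<phi>. \<bar>\<phi>\<bar> \<le> t \<Longrightarrow> norm (f \<phi>) \<le> B * gs q t \<phi>"
  shows "norm (integral {- t..t} f) \<le> B * (2 * sqrt q * (t * sqrt t))"
proof -
  have "norm (integral {- t..t} f) \<le> integral {- t..t} (\<lambda>\<phi>. B * gs q t \<phi>)"
    by (rule integral_norm_bound_integral[OF f])
       (use t q b in \<open>auto intro!: integrable_continuous_real continuous_intros\<close>)
  also have "\<dots> = B * integral {- t..t} (gs q t)" by simp
  also have "\<dots> \<le> B * (2 * sqrt q * (t * sqrt t))"
    by (intro mult_left_mono gaussian_scaled_le t q) fact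
  finally show ?thesis .
qed

text \<open>Under the \<theta>-Gaussian a factor |\<theta>| is worth sqrt t.\<close>

lemma abs_theta_exp_le:
  assumes "0 < t"
  shows "\<bar>\<theta>\<bar> * exp (- (rho t \<theta> / 4)) \<le> sqrt (8 * real N) * sqrt t"
proof -
  define x where "x = rho t \<theta> / 4"
  have x: "0 \<le> x" using rho_nonneg[OF assms] by (simp add: x_def)
  have "8 * real N * t * x = \<theta>\<^sup>2" using assms N_ge_2 by (simp add: x_def rho_def)
  then have "\<bar>\<theta>\<bar> = sqrt (8 * real N * t * x)" by simp
  also have "\<dots> = sqrt (8 * real N) * sqrt t * sqrt x" by (simp add: real_sqrt_mult)
  also have "\<dots> \<le> sqrt (8 * real N) * sqrt t * exp x"
    using assms by (intro mult_left_mono sqrt_exp_bound x) auto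
  finally have "\<bar>\<theta>\<bar> * exp (- x) \<le> sqrt (8 * real N) * sqrt t * exp x * exp (- x)" by (intro mult_right_mono) auto
  also have "\<dots> = sqrt (8 * real N) * sqrt t * (exp x * exp (- x))" by (simp only: mult.assoc)
  also have "exp x * exp (- x) = 1" by (simp add: exp_minus)
  finally show ?thesis by (simp add: x_def)
qed

definition C2 :: real where "C2 = C1 * CB * exp CB * (sqrt (8 * real N) + 1) * 3"

text \<open>Of the error (|\<theta>| + t) |\<theta>| the first factor is turned into sqrt t; the
  second is kept, since it has to cancel the later division by sin (\<theta>/2).\<close>

lemma central_G_integral:
  assumes "admissible t n" "\<bar>\<theta>\<bar> \<le> 1/2"
  shows "cmod (integral {- t..t} (G t n \<theta>) - exp (\<i> * of_real (\<theta> * shift)) * of_real (V t n \<theta>))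
     \<le> C2 * W t n * t\<^sup>2 * \<bar>\<theta>\<bar> * exp (- (rho t \<theta> / 4))"
proof -
  note A = admissibleD[OF assms(1)]
  define B where "B = C1 * CB * exp CB * W t n * (\<bar>\<theta>\<bar> + t) * \<bar>\<theta>\<bar> * exp (- (rho t \<theta> / 2))"
  have B0: "0 \<le> B" using C1_pos constants_nonneg W_pos[of t n] A by (simp add: B_def)
  have iG: "G t n \<theta> integrable_on {- t..t}" by (intro integrable_continuous_real continuous_on_G)
  have iP: "P t n \<theta> integrable_on {- t..t}" by (intro integrable_continuous_real continuous_on_P A)
  have iP2: "(\<lambda>\<phi>. exp (\<i> * of_real (\<theta> * shift)) * P t n \<theta> \<phi>) integrable_on {- t..t}"
    by (intro integrable_continuous_real continuous_intros continuous_on_P A)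
  have "integral {- t..t} (G t n \<theta>) - exp (\<i> * of_real (\<theta> * shift)) * of_real (V t n \<theta>)
     = integral {- t..t} (\<lambda>\<phi>. G t n \<theta> \<phi> - exp (\<i> * of_real (\<theta> * shift)) * P t n \<theta> \<phi>)"
    unfolding Henstock_Kurzweil_Integration.integral_diff[OF iG iP2] integral_P[OF A(1), symmetric] by simp
  also have "cmod \<dots> \<le> B * (2 * sqrt 2 * (t * sqrt t))"
    unfolding B_def
    by (rule norm_integral_gs_le[OF A(1) _ Henstock_Kurzweil_Integration.integrable_diff[OF iG iP2] B0[unfolded B_def] G_approx[OF assms(1) _ assms(2)]])
       simp_all
  also have "\<dots> \<le> B * (3 * (t * sqrt t))"
  proof (intro mult_left_mono mult_right_mono B0)
    have "sqrt 2 \<le> 3 / 2" by (rule real_le_lsqrt) (auto simp: power2_eq_square)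
    then show "2 * sqrt 2 \<le> 3" by simp
  qed (use A in auto)
  also have "B = C1 * CB * exp CB * W t n * \<bar>\<theta>\<bar> * exp (- (rho t \<theta> / 4)) * ((\<bar>\<theta>\<bar> + t) * exp (- (rho t \<theta> / 4)))"
    by (simp add: B_def exp_add[symmetric])
  also have "\<dots> * (3 * (t * sqrt t)) \<le> C1 * CB * exp CB * W t n * \<bar>\<theta>\<bar> * exp (- (rho t \<theta> / 4)) * ((sqrt (8 * real N) + 1) * sqrt t) * (3 * (t * sqrt t))"
  proof (intro mult_right_mono mult_left_mono)
    have "t \<le> sqrt t" using A by (intro real_le_rsqrt) (simp add: power2_eq_square)
    moreover have "t * exp (- (rho t \<theta> / 4)) \<le> t * 1" using A rho_nonneg[OF A(1), of \<theta>] by (intro mult_left_mono) auto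
    ultimately show "(\<bar>\<theta>\<bar> + t) * exp (- (rho t \<theta> / 4)) \<le> (sqrt (8 * real N) + 1) * sqrt t"
      using abs_theta_exp_le[OF A(1), of \<theta>] by (simp add: distrib_right)
  qed (use C1_pos constants_nonneg W_pos[of t n] A in auto)
  also have "\<dots> = C2 * W t n * (t * (sqrt t * sqrt t)) * \<bar>\<theta>\<bar> * exp (- (rho t \<theta> / 4))"
    by (simp add: C2_def mult_ac)
  also have "t * (sqrt t * sqrt t) = t\<^sup>2" using A by (simp add: power2_eq_square)
  finally show ?thesis .
qed

lemma rho_0: "rho t 0 = 0" by (simp add: rho_def)

lemma P_0: "P t n 0 = Q t n" by (simp add: P_def [abs_def] rho_0)

text \<open>Relative to \<open>main_int\<close> this is only sqrt t and has no factor \<theta>; the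
  missing factor comes later from sin (slope \<theta>), by which the real number \<open>V\<close> is
  multiplied.\<close>

lemma V_theta:
  assumes "admissible t n"
  shows "\<bar>V t n \<theta> - exp (- rho t \<theta>) * V t n 0\<bar> \<le> 48 * C1 * W t n * t\<^sup>2 * exp (- (rho t \<theta> / 4))"
proof -
  note A = admissibleD[OF assms(1)]
  define B where "B = 12 * C1 * W t n * sqrt t * exp (- (rho t \<theta> / 4))"
  have B0: "0 \<le> B" using C1_pos W_pos[of t n] A by (simp add: B_def)
  have iP: "P t n \<theta> integrable_on {- t..t}" by (intro integrable_continuous_real continuous_on_P A)
  have iQ: "(\<lambda>\<phi>. of_real (exp (- rho t \<theta>)) * Q t n \<phi>) integrable_on {- t..t}"
    by (intro integrable_continuous_real continuous_intros continuous_on_Q)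
  have "of_real (V t n \<theta> - exp (- rho t \<theta>) * V t n 0)
      = integral {- t..t} (\<lambda>\<phi>. P t n \<theta> \<phi> - of_real (exp (- rho t \<theta>)) * Q t n \<phi>)"
    unfolding Henstock_Kurzweil_Integration.integral_diff[OF iP iQ]
    using integral_P[OF A(1), of n \<theta>] integral_P[OF A(1), of n 0] by (simp add: P_0)
  then have "\<bar>V t n \<theta> - exp (- rho t \<theta>) * V t n 0\<bar> = cmod \<dots>" by (metis norm_of_real)
  also have "\<dots> \<le> B * (2 * sqrt 4 * (t * sqrt t))"
    unfolding B_def
    by (rule norm_integral_gs_le[OF A(1) _ Henstock_Kurzweil_Integration.integrable_diff[OF iP iQ] B0[unfolded B_def] P_approx[OF assms(1)]])
       simp_all
  also have "\<dots> = 48 * C1 * W t n * (t * (sqrt t * sqrt t)) * exp (- (rho t \<theta> / 4))"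
    by (simp add: B_def)
  also have "t * (sqrt t * sqrt t) = t\<^sup>2" using A by (simp add: power2_eq_square)
  finally show ?thesis .
qed

text \<open>The integral of the pure Gaussian kap W exp (- c \<phi>^2), c = pi^2 / (12 t^3), over
  the whole line: the leading value of 2 pi times the number of all sets of allowed parts with sum
  n.\<close>

definition main_int :: "real \<Rightarrow> nat \<Rightarrow> real" where
  "main_int t n = kap * W t n * sqrt (12 * t ^ 3 / pi)"

definition C3 :: real where "C3 = 3 * C1 * CA + 1200 * kap + 8 * kap"

text \<open>Here relative precision t is needed, because this quantity carries the leading term
  itself. It is available since \<open>saddle_Re\<close> has no first-order term in y. The three
  contributions are the error of \<open>Q\<close>, the deviation from the pure Gaussian, and the
  truncation at t.\<close>

lemma V_0:
  assumes "admissible t n"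
  shows "\<bar>V t n 0 - main_int t n\<bar> \<le> C3 * W t n * t\<^sup>2 * sqrt t"
proof -
  note A = admissibleD[OF assms(1)]
  define E where "E \<phi> = exp (- (of_real (lam t * (\<phi> / t)\<^sup>2) / Complex 1 (- (\<phi> / t))))" for \<phi>
  define c where "c = pi\<^sup>2 / (12 * t ^ 3)"
  have c0: "0 < c" using A by (simp add: c_def)
  have p9: "9 \<le> pi\<^sup>2" using power_mono[of 3 pi 2] pi_gt3 by simp
  have ce: "lam t * (\<phi> / t)\<^sup>2 = c * \<phi>\<^sup>2" for \<phi>
    using A(1) by (simp add: c_def lam_def field_simps power2_eq_square power3_eq_cube)
  have kW: "0 < kap * W t n" using constants_nonneg W_pos[of t n] by simp
  have cE: "continuous_on {- t..t} E"
    unfolding E_def by (intro continuous_intros continuous_on_saddle A(1)) (use A(1) in simp)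
  have iE: "E integrable_on {- t..t}" by (rule integrable_continuous_real[OF cE])
  have iQ: "Q t n integrable_on {- t..t}" by (intro integrable_continuous_real continuous_on_Q)
  have iE2: "(\<lambda>\<phi>. of_real (kap * W t n) * E \<phi>) integrable_on {- t..t}"
    by (intro integrable_continuous_real continuous_intros cE)
  have s2: "2 * sqrt 2 \<le> (3::real)"
  proof -
    have "sqrt 2 \<le> 3 / 2" by (rule real_le_lsqrt) (auto simp: power2_eq_square)
    then show ?thesis by simp
  qed
  have e1: "cmod (of_real (V t n 0) - of_real (kap * W t n) * integral {- t..t} E) \<le> 3 * C1 * CA * W t n * t\<^sup>2 * sqrt t"
  proof -
    define B where "B = C1 * CA * W t n * t"
    have B0: "0 \<le> B" using C1_pos constants_nonneg W_pos[of t n] A by (simp add: B_def)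
    have "of_real (V t n 0) - of_real (kap * W t n) * integral {- t..t} E
       = integral {- t..t} (\<lambda>\<phi>. Q t n \<phi> - of_real (kap * W t n) * E \<phi>)"
      unfolding Henstock_Kurzweil_Integration.integral_diff[OF iQ iE2]
      using integral_P[OF A(1), of n 0] by (simp add: P_0)
    also have "cmod \<dots> \<le> B * (2 * sqrt 2 * (t * sqrt t))"
      unfolding B_def
      by (rule norm_integral_gs_le[OF A(1) _ Henstock_Kurzweil_Integration.integrable_diff[OF iQ iE2] B0[unfolded B_def] Q_approx[OF assms(1), folded E_def]])
         simp_all
    also have "\<dots> \<le> B * (3 * (t * sqrt t))" using s2 A by (intro mult_left_mono mult_right_mono B0) auto
    also have "\<dots> = 3 * C1 * CA * W t n * t\<^sup>2 * sqrt t" by (simp add: B_def power2_eq_square)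
    finally show ?thesis .
  qed
  have e2: "\<bar>Re (integral {- t..t} E) - integral {- t..t} (\<lambda>\<phi>. exp (- (c * \<phi>\<^sup>2)))\<bar> \<le> 1200 * t\<^sup>2 * sqrt t"
  proof -
    have "Re (integral {- t..t} E) = integral {- t..t} (\<lambda>\<phi>. Re (E \<phi>))"
      using integral_linear[OF iE bounded_linear_Re] by (simp add: o_def)
    moreover have "(\<lambda>\<phi>. Re (E \<phi>)) integrable_on {- t..t}"
      using cE by (intro integrable_continuous_real continuous_intros)
    ultimately have eq: "Re (integral {- t..t} E) - integral {- t..t} (\<lambda>\<phi>. exp (- (c * \<phi>\<^sup>2)))
        = integral {- t..t} (\<lambda>\<phi>. Re (E \<phi>) - exp (- (c * \<phi>\<^sup>2)))" and
      ii: "(\<lambda>\<phi>. Re (E \<phi>) - exp (- (c * \<phi>\<^sup>2))) integrable_on {- t..t}"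
      using gaussian_integrable_on by (auto simp: Henstock_Kurzweil_Integration.integral_diff intro: Henstock_Kurzweil_Integration.integrable_diff)
    have "norm (integral {- t..t} (\<lambda>\<phi>. Re (E \<phi>) - exp (- (c * \<phi>\<^sup>2)))) \<le> 224 / lam t * (2 * sqrt 4 * (t * sqrt t))"
    proof (rule norm_integral_gs_le[OF A(1) _ ii])
      fix \<phi> assume "\<bar>\<phi>\<bar> \<le> t"
      then show "norm (Re (E \<phi>) - exp (- (c * \<phi>\<^sup>2))) \<le> 224 / lam t * gs 4 t \<phi>"
        unfolding E_def real_norm_def ce[symmetric] lam_gs[symmetric]
        by (intro saddle_Re A abs_div_le_1)
    qed (use A in auto)
    \<comment> \<open>224 * 12 / pi^2 is below 300, using only pi \<ge> 3.\<close>
    also have "224 / lam t \<le> 300 * t"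
      using A(1) p9 by (simp add: lam_def field_simps)
    then have "224 / lam t * (2 * sqrt 4 * (t * sqrt t)) \<le> 300 * t * (2 * sqrt 4 * (t * sqrt t))"
      using A by (intro mult_right_mono) auto
    also have "\<dots> = 1200 * t\<^sup>2 * sqrt t" by (simp add: power2_eq_square)
    finally show ?thesis unfolding eq by simp
  qed
  have pc: "sqrt (pi / c) = sqrt (12 * t ^ 3 / pi)" by (simp add: c_def power2_eq_square)
  have e3: "\<bar>integral {- t..t} (\<lambda>\<phi>. exp (- (c * \<phi>\<^sup>2))) - sqrt (12 * t ^ 3 / pi)\<bar> \<le> 8 * t\<^sup>2 * sqrt t"
  proof -
    have u: "integral {- t..t} (\<lambda>\<phi>. exp (- (c * \<phi>\<^sup>2))) \<le> sqrt (pi / c)" by (rule gaussian_integral_le[OF c0])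
    have l: "sqrt (pi / c) - exp (- (c * t\<^sup>2 / 2)) * sqrt (2 * pi / c) \<le> integral {- t..t} (\<lambda>\<phi>. exp (- (c * \<phi>\<^sup>2)))"
      by (rule gaussian_integral_ge[OF c0]) (use A in simp)
    have "exp (- (c * t\<^sup>2 / 2)) \<le> 8/3 * t"
    proof -
      have "c * t\<^sup>2 / 2 = (pi\<^sup>2 / 24) / t" using A(1) by (simp add: c_def field_simps power2_eq_square power3_eq_cube)
      then have "exp (- (c * t\<^sup>2 / 2)) \<le> fact 1 / (pi\<^sup>2 / 24) ^ 1 * t ^ 1"
        using exp_neg_inverse_le[of "pi\<^sup>2 / 24" t 1] A(1) by simp
      also have "\<dots> \<le> 8/3 * t" using A(1) p9 by (simp add: field_simps)
      finally show ?thesis .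
    qed
    moreover have "sqrt (2 * pi / c) \<le> 3 * (t * sqrt t)"
    proof -
      have "2 * pi / c = 24 / pi * t ^ 3" by (simp add: c_def power2_eq_square)
      also have "\<dots> \<le> 9 * t ^ 3" using A(1) pi_gt3 by (intro mult_right_mono) (auto simp: field_simps)
      also have "\<dots> = (3 * t)\<^sup>2 * t" by (simp add: power2_eq_square power3_eq_cube)
      finally have "sqrt (2 * pi / c) \<le> sqrt ((3 * t)\<^sup>2 * t)" by (rule real_sqrt_le_mono)
      then show ?thesis using A(1) by (simp add: real_sqrt_mult)
    qed
    ultimately have "exp (- (c * t\<^sup>2 / 2)) * sqrt (2 * pi / c) \<le> 8/3 * t * (3 * (t * sqrt t))"
      using A(1) c0 by (intro mult_mono) auto
    also have "\<dots> = 8 * t\<^sup>2 * sqrt t" by (simp add: power2_eq_square)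
    finally show ?thesis using u l unfolding pc by linarith
  qed
  define I where "I = Re (integral {- t..t} E)"
  define J where "J = integral {- t..t} (\<lambda>\<phi>. exp (- (c * \<phi>\<^sup>2)))"
  have f1: "\<bar>V t n 0 - kap * W t n * I\<bar> \<le> 3 * C1 * CA * W t n * t\<^sup>2 * sqrt t"
    using abs_Re_le_cmod[of "of_real (V t n 0) - of_real (kap * W t n) * integral {- t..t} E"] e1
    by (simp add: I_def)
  have f2: "\<bar>kap * W t n * (I - J)\<bar> \<le> kap * W t n * (1200 * t\<^sup>2 * sqrt t)"
    unfolding abs_mult[of "kap * W t n"] abs_of_pos[OF kW]
    by (rule mult_left_mono[OF _ less_imp_le[OF kW]]) (use e2 in \<open>simp add: I_def J_def\<close>)
  have f3: "\<bar>kap * W t n * (J - sqrt (12 * t ^ 3 / pi))\<bar> \<le> kap * W t n * (8 * t\<^sup>2 * sqrt t)"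
    unfolding abs_mult[of "kap * W t n"] abs_of_pos[OF kW]
    by (rule mult_left_mono[OF _ less_imp_le[OF kW]]) (use e3 in \<open>simp add: J_def\<close>)
  have "V t n 0 - main_int t n = (V t n 0 - kap * W t n * I) + kap * W t n * (I - J) + kap * W t n * (J - sqrt (12 * t ^ 3 / pi))"
    by (simp add: main_int_def algebra_simps)
  then have "\<bar>V t n 0 - main_int t n\<bar> \<le> 3 * C1 * CA * W t n * t\<^sup>2 * sqrt t + kap * W t n * (1200 * t\<^sup>2 * sqrt t) + kap * W t n * (8 * t\<^sup>2 * sqrt t)"
    using f1 f2 f3 by linarith
  also have "\<dots> = C3 * W t n * t\<^sup>2 * sqrt t" by (simp add: C3_def algebra_simps)
  finally show ?thesis .
qed

end

lemma abs_sin_minus_le: "\<bar>sin x - x\<bar> \<le> (x::real)\<^sup>2"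
proof -
  have "norm ((sin x - x) - (sin 0 - 0)) \<le> \<bar>x\<bar> * norm (x - 0)"
  proof (rule field_differentiable_bound[where S = "{- \<bar>x\<bar>..\<bar>x\<bar>}" and f' = "\<lambda>y. cos y - 1"])
    fix y assume y: "y \<in> {- \<bar>x\<bar>..\<bar>x\<bar>}"
    show "((\<lambda>x. sin x - x) has_field_derivative cos y - 1) (at y within {- \<bar>x\<bar>..\<bar>x\<bar>})"
      by (auto intro!: derivative_eq_intros)
    have "1 - cos y = 2 * (\<bar>sin (y / 2)\<bar> * \<bar>sin (y / 2)\<bar>)" using cos_double_sin[of "y / 2"] by (simp add: power2_eq_square)
    also have "\<dots> \<le> 2 * (\<bar>y / 2\<bar> * 1)"
      by (intro mult_left_mono mult_mono abs_sin_x_le_abs_x) auto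
    finally have "1 - cos y \<le> \<bar>y\<bar>" by simp
    then show "norm (cos y - 1) \<le> \<bar>x\<bar>" using y cos_le_one[of y] unfolding real_norm_def by auto
  qed auto
  then show ?thesis by (simp add: power2_eq_square)
qed

context bias_parameters
begin

section \<open>Assembling the asymptotics\<close>

text \<open>The true decay is exponential. The power 8 suffices: after division by a sine at
  \<theta> \<ge> t^4 a factor t^4 remains.\<close>

definition minor_bound :: "real \<Rightarrow> real \<Rightarrow> nat \<Rightarrow> bool" where
  "minor_bound C t n \<longleftrightarrow> 0 \<le> C \<and> (\<forall>\<theta> \<phi>. \<bar>\<theta>\<bar> \<le> pi \<and> \<bar>\<phi>\<bar> \<le> pi \<and> (t \<le> \<bar>\<phi>\<bar> \<or> 1/2 \<le> \<bar>\<theta>\<bar>) \<longrightarrow>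
     cmod (G t n \<theta> \<phi>) \<le> C * W t n * t ^ 8)"

text \<open>Taking absolute values bounds the integrand by its value at \<theta> = \<phi> = 0, which
  is O(W) by \<open>norm_Q_le\<close>, times exp (- S / 2); \<open>minor_arc_sum\<close> gives S
  \<ge> c / t.\<close>

lemma minor_bound_exists:
  "\<exists>C t1. 0 < t1 \<and> (\<forall>t n. admissible t n \<and> t \<le> t1 \<longrightarrow> minor_bound C t n)"
proof -
  obtain c t1 where c: "0 < c" "0 < t1" and minor: "\<And>t L \<theta> \<phi>. 0 < t \<Longrightarrow> t \<le> t1 \<Longrightarrow> 10 / t \<le> real L \<Longrightarrow> \<bar>\<theta>\<bar> \<le> pi \<Longrightarrow> \<bar>\<phi>\<bar> \<le> pi \<Longrightarrow> t \<le> \<bar>\<phi>\<bar> \<or> 1/2 \<le> \<bar>\<theta>\<bar> \<Longrightarrow>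
     c / t \<le> (\<Sum>m\<in>parts L. exp (- (real m * t)) * (sin ((\<theta> * of_int (bias_char \<alpha> \<beta> N m) + real m * \<phi>) / 2))\<^sup>2)"
    using minor_arc_sum[OF N_cases class_bounds, of K] by blast
  define C where "C = C1 * (fact 8 / (c / 2) ^ 8)"
  have C0: "0 \<le> C" using C1_pos c by (simp add: C_def)
  have "cmod (G t n \<theta> \<phi>) \<le> C * W t n * t ^ 8"
    if a: "admissible t n" and t1: "t \<le> t1" and th: "\<bar>\<theta>\<bar> \<le> pi" "\<bar>\<phi>\<bar> \<le> pi" "t \<le> \<bar>\<phi>\<bar> \<or> 1/2 \<le> \<bar>\<theta>\<bar>" for t n \<theta> \<phi>
  proof -
    note A = admissibleD[OF a]
    have "9 \<le> pi\<^sup>2" using power_mono[of 3 pi 2] pi_gt3 by simp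
    then have "10 \<le> lam t" using A(1,2) by (simp add: lam_def field_simps)
    \<comment> \<open>The number of blocks is n itself, and n t = lam t \<ge> 10.\<close>
    then have L: "10 / t \<le> real n" using A(1,5) by (simp add: field_simps)
    define S where "S = (\<Sum>m\<in>parts n. exp (- (real m * t)) * (sin ((\<theta> * of_int (bias_char \<alpha> \<beta> N m) + real m * \<phi>) / 2))\<^sup>2)"
    have S: "c / t \<le> S" unfolding S_def by (rule minor[OF A(1) t1 L th])
    have pos: "0 < (\<Prod>m\<in>parts n. 1 + exp (- (real m * t)))" by (intro prod_pos) (auto simp: add_pos_pos)
    have g0: "gf n 0 (Complex t (- 0)) = of_real (\<Prod>m\<in>parts n. 1 + exp (- (real m * t)))"
    proof -
      have "Complex t (- 0) = of_real t" by (simp add: complex_eq_iff)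
      then show ?thesis by (simp add: bias_gf_def exp_of_real[symmetric] del: exp_of_real)
    qed
    have en: "cmod (exp (of_nat n * Complex t (- x))) = exp (real n * t)" for x by simp
    have "cmod (Q t n 0) \<le> C1 * W t n * gs 2 t 0" by (rule norm_Q_le[OF a]) (use A in simp)
    then have q: "(\<Prod>m\<in>parts n. 1 + exp (- (real m * t))) * exp (real n * t) \<le> C1 * W t n"
      unfolding Q_def norm_mult g0 en norm_of_real using pos by simp
    have "cmod (G t n \<theta> \<phi>) \<le> (\<Prod>m\<in>parts n. 1 + exp (- (real m * t))) * exp (- S / 2) * exp (real n * t)"
      unfolding G_def norm_mult en S_def
      by (intro mult_right_mono norm_bias_gf_le) (use A in auto)
    also have "\<dots> = ((\<Prod>m\<in>parts n. 1 + exp (- (real m * t))) * exp (real n * t)) * exp (- S / 2)" by (simp only: mult_ac)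
    also have "\<dots> \<le> (C1 * W t n) * exp (- (c / 2 / t))"
      by (intro mult_mono q) (use S C1_pos W_pos[of t n] in auto)
    also have "\<dots> \<le> (C1 * W t n) * (fact 8 / (c / 2) ^ 8 * t ^ 8)"
      by (intro mult_left_mono exp_neg_inverse_le) (use c A C1_pos W_pos[of t n] in auto)
    finally show ?thesis by (simp only: C_def mult_ac)
  qed
  then show ?thesis using C0 c(2) unfolding minor_bound_def by blast
qed

abbreviation cc :: "nat \<Rightarrow> real \<Rightarrow> complex" where
  "cc n \<theta> \<equiv> char_coeff (bias_char \<alpha> \<beta> N) (parts n) n \<theta>"

lemma G_integral: "(G t n \<theta> has_integral (2 * of_real pi * cc n \<theta>)) {- pi..pi}"
  unfolding G_def [abs_def] by (rule has_integral_bias_gf) simp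

lemma cc_minor:
  assumes "admissible t n" "minor_bound C t n" "1/2 \<le> \<bar>\<theta>\<bar>" "\<bar>\<theta>\<bar> \<le> pi"
  shows "cmod (cc n \<theta>) \<le> C * W t n * t ^ 8"
proof -
  have "norm (integral {- pi..pi} (G t n \<theta>)) \<le> C * W t n * t ^ 8 * (pi - - pi)"
    by (rule integral_bound) (use assms in \<open>auto simp: minor_bound_def intro!: continuous_on_G\<close>)
  moreover have "integral {- pi..pi} (G t n \<theta>) = 2 * of_real pi * cc n \<theta>" by (rule integral_unique[OF G_integral])
  ultimately show ?thesis by (simp add: norm_mult)
qed

lemma cc_central:
  assumes "admissible t n" "minor_bound C t n" "\<bar>\<theta>\<bar> \<le> 1/2"
  shows "cmod (2 * of_real pi * cc n \<theta> - integral {- t..t} (G t n \<theta>)) \<le> 7 * C * W t n * t ^ 8"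
proof -
  note A = admissibleD[OF assms(1)]
  have th: "\<bar>\<theta>\<bar> \<le> pi" using assms(3) pi_gt3 by linarith
  have tp: "t \<le> pi" using A(3) pi_gt3 by linarith
  have B0: "0 \<le> C * W t n * t ^ 8" using assms(2) W_pos[of t n] A by (simp add: minor_bound_def)
  have i: "G t n \<theta> integrable_on {- pi..pi}" using G_integral by blast
  have i2: "G t n \<theta> integrable_on {- t..pi}" by (intro integrable_continuous_real continuous_on_G)
  have "integral {- pi..pi} (G t n \<theta>) = integral {- pi..- t} (G t n \<theta>) + integral {- t..pi} (G t n \<theta>)"
    by (rule Henstock_Kurzweil_Integration.integral_combine[symmetric, OF _ _ i]) (use A tp in auto)
  moreover have "integral {- t..pi} (G t n \<theta>) = integral {- t..t} (G t n \<theta>) + integral {t..pi} (G t n \<theta>)"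
    by (rule Henstock_Kurzweil_Integration.integral_combine[symmetric, OF _ _ i2]) (use A tp in auto)
  ultimately have e: "2 * of_real pi * cc n \<theta> - integral {- t..t} (G t n \<theta>) = integral {- pi..- t} (G t n \<theta>) + integral {t..pi} (G t n \<theta>)"
    using integral_unique[OF G_integral, of t n \<theta>] by simp
  have l: "norm (integral {- pi..- t} (G t n \<theta>)) \<le> C * W t n * t ^ 8 * (- t - - pi)"
    by (rule integral_bound) (use assms th tp A in \<open>auto simp: minor_bound_def intro!: continuous_on_G\<close>)
  have r: "norm (integral {t..pi} (G t n \<theta>)) \<le> C * W t n * t ^ 8 * (pi - t)"
    by (rule integral_bound) (use assms th tp A in \<open>auto simp: minor_bound_def intro!: continuous_on_G\<close>)
  have "cmod (2 * of_real pi * cc n \<theta> - integral {- t..t} (G t n \<theta>)) \<le> C * W t n * t ^ 8 * (- t - - pi) + C * W t n * t ^ 8 * (pi - t)"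
    unfolding e using norm_triangle_mono[OF l r] .
  also have "\<dots> = C * W t n * t ^ 8 * (2 * pi - 2 * t)" by (simp add: algebra_simps)
  also have "\<dots> \<le> C * W t n * t ^ 8 * 7"
    by (intro mult_left_mono B0) (use A(1) pi_less_4 pi_approx in simp)
  finally show ?thesis by (simp add: mult_ac)
qed

text \<open>The mean excess measured from the threshold 1/2 of the sign.\<close>

definition slope :: real where "slope = shift - 1/2"

text \<open>The sum of sin ((X - 1/2) \<theta>) over all sets with sum n, the numerator in
  \<open>sin_half_kernel_sum\<close>.\<close>

definition half_cc :: "nat \<Rightarrow> real \<Rightarrow> real" where
  "half_cc n \<theta> = Im (exp (- (\<i> * of_real (\<theta> / 2))) * cc n \<theta>)"

lemma C3_nonneg: "0 \<le> C3" using C1_pos constants_nonneg by (simp add: C3_def)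
lemma C2_nonneg: "0 \<le> C2" using C1_pos constants_nonneg by (simp add: C2_def)

definition C4 :: real where "C4 = C2 + \<bar>slope\<bar> * (48 * C1 + C3)"

lemma C4_nonneg: "0 \<le> C4" using C1_pos C2_nonneg C3_nonneg by (simp add: C4_def)

text \<open>Since \<open>V\<close> is real, the imaginary part of the phase times \<open>V\<close>
  is exactly sin (slope \<theta>) \<open>V\<close>. Thus the errors of \<open>V_theta\<close> and
  \<open>V_0\<close> acquire the factor |\<theta>|; only the minor arc error lacks it.\<close>

lemma half_cc_approx:
  assumes "admissible t n" "minor_bound C t n" "\<bar>\<theta>\<bar> \<le> 1/2"
  shows "\<bar>2 * pi * half_cc n \<theta> - sin (slope * \<theta>) * exp (- rho t \<theta>) * main_int t n\<bar>
    \<le> C4 * W t n * t\<^sup>2 * \<bar>\<theta>\<bar> * exp (- (rho t \<theta> / 4)) + 7 * C * W t n * t ^ 8"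
proof -
  note A = admissibleD[OF assms(1)]
  define e where "e = exp (- (\<i> * of_real (\<theta> / 2)))"
  define x where "x = exp (\<i> * of_real (\<theta> * shift)) * of_real (V t n \<theta>)"
  have ne: "cmod e = 1" by (simp add: e_def)
  have "cmod (2 * of_real pi * cc n \<theta> - x) \<le> cmod (2 * of_real pi * cc n \<theta> - integral {- t..t} (G t n \<theta>)) + cmod (integral {- t..t} (G t n \<theta>) - x)"
    using norm_triangle_ineq[of "2 * of_real pi * cc n \<theta> - integral {- t..t} (G t n \<theta>)" "integral {- t..t} (G t n \<theta>) - x"] by simp
  also have "\<dots> \<le> 7 * C * W t n * t ^ 8 + C2 * W t n * t\<^sup>2 * \<bar>\<theta>\<bar> * exp (- (rho t \<theta> / 4))"
    unfolding x_def by (intro add_mono cc_central central_G_integral assms)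
  finally have 1: "cmod (e * (2 * of_real pi * cc n \<theta> - x)) \<le> 7 * C * W t n * t ^ 8 + C2 * W t n * t\<^sup>2 * \<bar>\<theta>\<bar> * exp (- (rho t \<theta> / 4))"
    by (simp add: norm_mult ne)
  have "e * x = exp (\<i> * of_real (slope * \<theta>)) * of_real (V t n \<theta>)"
    unfolding e_def x_def by (simp add: slope_def exp_add[symmetric] algebra_simps diff_divide_distrib)
  then have "Im (e * x) = sin (slope * \<theta>) * V t n \<theta>" by (simp add: Im_exp)
  moreover have "Im (e * (2 * of_real pi * cc n \<theta>)) = 2 * pi * half_cc n \<theta>"
    by (simp add: half_cc_def e_def algebra_simps)
  ultimately have "2 * pi * half_cc n \<theta> - sin (slope * \<theta>) * V t n \<theta> = Im (e * (2 * of_real pi * cc n \<theta> - x))"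
    by (simp add: right_diff_distrib)
  then have 2: "\<bar>2 * pi * half_cc n \<theta> - sin (slope * \<theta>) * V t n \<theta>\<bar> \<le> 7 * C * W t n * t ^ 8 + C2 * W t n * t\<^sup>2 * \<bar>\<theta>\<bar> * exp (- (rho t \<theta> / 4))"
    using order_trans[OF abs_Im_le_cmod 1] by simp
  have r0: "0 \<le> rho t \<theta>" by (rule rho_nonneg[OF A(1)])
  have v: "\<bar>V t n \<theta> - exp (- rho t \<theta>) * main_int t n\<bar> \<le> (48 * C1 + C3) * W t n * t\<^sup>2 * exp (- (rho t \<theta> / 4))"
  proof -
    have "\<bar>exp (- rho t \<theta>) * (V t n 0 - main_int t n)\<bar> \<le> exp (- (rho t \<theta> / 4)) * (C3 * W t n * t\<^sup>2 * 1)"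
    proof -
      have "\<bar>V t n 0 - main_int t n\<bar> \<le> C3 * W t n * t\<^sup>2 * 1"
        by (rule order_trans[OF V_0[OF assms(1)]], intro mult_left_mono) (use A C3_nonneg W_pos[of t n] in auto)
      then show ?thesis unfolding abs_mult by (intro mult_mono) (use r0 in auto)
    qed
    moreover have "V t n \<theta> - exp (- rho t \<theta>) * main_int t n = (V t n \<theta> - exp (- rho t \<theta>) * V t n 0) + exp (- rho t \<theta>) * (V t n 0 - main_int t n)"
      by (simp add: algebra_simps)
    ultimately have "\<bar>V t n \<theta> - exp (- rho t \<theta>) * main_int t n\<bar> \<le> 48 * C1 * W t n * t\<^sup>2 * exp (- (rho t \<theta> / 4)) + exp (- (rho t \<theta> / 4)) * (C3 * W t n * t\<^sup>2 * 1)"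
      using V_theta[OF assms(1), of \<theta>] by linarith
    then show ?thesis by (simp add: algebra_simps)
  qed
  have "\<bar>sin (slope * \<theta>) * (V t n \<theta> - exp (- rho t \<theta>) * main_int t n)\<bar> \<le> (\<bar>slope\<bar> * \<bar>\<theta>\<bar>) * ((48 * C1 + C3) * W t n * t\<^sup>2 * exp (- (rho t \<theta> / 4)))"
    unfolding abs_mult by (intro mult_mono v) (use abs_sin_x_le_abs_x[of "slope * \<theta>"] in \<open>auto simp: abs_mult\<close>)
  then have 3: "\<bar>sin (slope * \<theta>) * V t n \<theta> - sin (slope * \<theta>) * exp (- rho t \<theta>) * main_int t n\<bar> \<le> (\<bar>slope\<bar> * \<bar>\<theta>\<bar>) * ((48 * C1 + C3) * W t n * t\<^sup>2 * exp (- (rho t \<theta> / 4)))"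
    by (simp add: right_diff_distrib mult.assoc)
  have "\<bar>2 * pi * half_cc n \<theta> - sin (slope * \<theta>) * exp (- rho t \<theta>) * main_int t n\<bar>
      \<le> (7 * C * W t n * t ^ 8 + C2 * W t n * t\<^sup>2 * \<bar>\<theta>\<bar> * exp (- (rho t \<theta> / 4))) + (\<bar>slope\<bar> * \<bar>\<theta>\<bar>) * ((48 * C1 + C3) * W t n * t\<^sup>2 * exp (- (rho t \<theta> / 4)))"
    using 2 3 by linarith
  also have "\<dots> = C4 * W t n * t\<^sup>2 * \<bar>\<theta>\<bar> * exp (- (rho t \<theta> / 4)) + 7 * C * W t n * t ^ 8"
    by (simp add: C4_def algebra_simps)
  finally show ?thesis .
qed

section \<open>Counting sets of parts through the sign kernel\<close>

definition sets_n :: "nat \<Rightarrow> nat set set" where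
  "sets_n n = {A. A \<subseteq> parts n \<and> (\<Sum>m\<in>A. m) = n}"

lemma finite_sets_n: "finite (sets_n n)"
  by (rule finite_subset[of _ "Pow (parts n)"]) (auto simp: sets_n_def)

definition excess :: "nat set \<Rightarrow> int" where "excess A = (\<Sum>m\<in>A. bias_char \<alpha> \<beta> N m)"

lemma cc_sets: "cc n \<theta> = (\<Sum>A\<in>sets_n n. exp (\<i> * of_real (\<theta> * of_int (excess A))))"
  by (simp add: char_coeff_def sets_n_def excess_def)

lemma excess_le:
  assumes "A \<in> sets_n n"
  shows "\<bar>excess A\<bar> \<le> int n"
proof -
  have A: "A \<subseteq> parts n" "(\<Sum>m\<in>A. m) = n" using assms by (auto simp: sets_n_def)
  have "\<bar>excess A\<bar> \<le> (\<Sum>m\<in>A. \<bar>bias_char \<alpha> \<beta> N m\<bar>)" unfolding excess_def by (rule sum_abs)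
  also have "\<dots> \<le> (\<Sum>m\<in>A. int m)"
  proof (rule sum_mono)
    fix m assume "m \<in> A"
    then have "1 \<le> m" using A(1) by auto
    then show "\<bar>bias_char \<alpha> \<beta> N m\<bar> \<le> int m" by (auto simp: bias_char_def)
  qed
  also have "\<dots> = int n" by (simp only: of_nat_sum[symmetric] A(2))
  finally show ?thesis .
qed

lemma d_eq: "d K \<alpha> \<beta> N n = card {A \<in> sets_n n. 0 < excess A}"
proof -
  have le: "n \<le> N * n" using N_ge_2 by simp
  have "x \<in> parts n" if "x \<in> {K<..n}" for x
    using that le unfolding greaterThanAtMost_iff atLeastAtMost_iff by linarith
  then have "{K<..n} \<subseteq> parts n" by blast
  then have "d K \<alpha> \<beta> N n = card {A. A \<subseteq> parts n \<and> (\<Sum>m\<in>A. m) = n \<and> 0 < (\<Sum>m\<in>A. bias_char \<alpha> \<beta> N m)}"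
    by (intro d_eq_card not_cong) auto
  also have "{A. A \<subseteq> parts n \<and> (\<Sum>m\<in>A. m) = n \<and> 0 < (\<Sum>m\<in>A. bias_char \<alpha> \<beta> N m)} = {A \<in> sets_n n. 0 < excess A}"
    by (auto simp: sets_n_def excess_def)
  finally show ?thesis .
qed

definition kernel_sum :: "nat \<Rightarrow> real \<Rightarrow> real" where
  "kernel_sum n \<theta> = (\<Sum>A\<in>sets_n n. sgn_kernel (excess A) \<theta>)"

lemma continuous_on_kernel_sum: "continuous_on S (kernel_sum n)"
  unfolding kernel_sum_def [abs_def] by (intro continuous_on_sum continuous_on_sgn_kernel)

lemma sin_half_kernel_sum: "sin (\<theta> / 2) * kernel_sum n \<theta> = half_cc n \<theta>"
proof -
  have "half_cc n \<theta> = (\<Sum>A\<in>sets_n n. Im (exp (- (\<i> * of_real (\<theta> / 2))) * exp (\<i> * of_real (\<theta> * of_int (excess A)))))"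
    unfolding half_cc_def cc_sets sum_distrib_left by (rule Im_sum)
  also have "\<dots> = (\<Sum>A\<in>sets_n n. sin (of_int (excess A) * \<theta> - \<theta> / 2))"
    by (rule sum.cong[OF refl]) (simp add: exp_add[symmetric] Im_exp mult.commute)
  finally show ?thesis by (simp add: kernel_sum_def sum_distrib_left sin_half_sgn_kernel)
qed

lemma abs_kernel_sum_le: "\<bar>kernel_sum n \<theta>\<bar> \<le> real (card (sets_n n)) * (2 * real n + 1)"
proof -
  have "\<bar>kernel_sum n \<theta>\<bar> \<le> (\<Sum>A\<in>sets_n n. \<bar>sgn_kernel (excess A) \<theta>\<bar>)" unfolding kernel_sum_def by (rule sum_abs)
  also have "\<dots> \<le> (\<Sum>A\<in>sets_n n. 2 * real n + 1)"
  proof (rule sum_mono)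
    fix A assume "A \<in> sets_n n"
    then have "\<bar>real_of_int (excess A)\<bar> \<le> real n" using excess_le[of A n] by linarith
    then show "\<bar>sgn_kernel (excess A) \<theta>\<bar> \<le> 2 * real n + 1" using abs_sgn_kernel_le[of "excess A" \<theta>] by linarith
  qed
  finally show ?thesis by simp
qed

lemma two_d_eq: "2 * real (d K \<alpha> \<beta> N n) = real (card (sets_n n)) + integral {0..pi} (kernel_sum n) / pi"
  unfolding d_eq kernel_sum_def [abs_def] by (rule two_card_pos_eq[OF finite_sets_n])

lemma card_approx:
  assumes "admissible t n" "minor_bound C t n"
  shows "\<bar>2 * pi * real (card (sets_n n)) - main_int t n\<bar> \<le> (C3 + 7 * C) * W t n * t\<^sup>2 * sqrt t"
proof -
  note A = admissibleD[OF assms(1)]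
  have C: "0 \<le> C" using assms(2) by (simp add: minor_bound_def)
  have cc0: "cc n 0 = of_real (real (card (sets_n n)))" unfolding cc_sets by simp
  \<comment> \<open>At \<theta> = 0 the error bound of \<open>central_G_integral\<close> is zero, so
    the approximation is an equality.\<close>
  have "integral {- t..t} (G t n 0) = of_real (V t n 0)" using central_G_integral[OF assms(1), of 0] by simp
  then have "cmod (of_real (2 * pi * real (card (sets_n n)) - V t n 0)) \<le> 7 * C * W t n * t ^ 8"
    using cc_central[OF assms, of 0] unfolding cc0 by simp
  then have 1: "\<bar>2 * pi * real (card (sets_n n)) - V t n 0\<bar> \<le> 7 * C * W t n * t ^ 8" unfolding norm_of_real .
  have "t ^ 8 = t\<^sup>2 * t ^ 6" by (simp add: power_add[symmetric])
  also have "\<dots> \<le> t\<^sup>2 * sqrt t"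
  proof (intro mult_left_mono)
    have "t ^ 6 \<le> t ^ 1" using A by (intro power_decreasing) auto
    also have "t ^ 1 \<le> sqrt t" using A by (intro real_le_rsqrt) (simp add: power2_eq_square)
    finally show "t ^ 6 \<le> sqrt t" .
  qed auto
  finally have "7 * C * W t n * t ^ 8 \<le> 7 * C * W t n * (t\<^sup>2 * sqrt t)"
    using C W_pos[of t n] by (intro mult_left_mono) auto
  then have "\<bar>2 * pi * real (card (sets_n n)) - main_int t n\<bar> \<le> 7 * C * W t n * (t\<^sup>2 * sqrt t) + C3 * W t n * t\<^sup>2 * sqrt t"
    using 1 V_0[OF assms(1)] by linarith
  then show ?thesis by (simp add: algebra_simps)
qed

lemma main_int_le:
  assumes "0 < t"
  shows "0 \<le> main_int t n" "main_int t n \<le> 2 * kap * W t n * (t * sqrt t)"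
proof -
  show "0 \<le> main_int t n" using assms constants_nonneg(1) W_pos[of t n] by (simp add: main_int_def)
  have "12 * t ^ 3 / pi \<le> (2 * t)\<^sup>2 * t"
    using assms pi_gt3 by (simp add: field_simps power2_eq_square power3_eq_cube)
  then have "sqrt (12 * t ^ 3 / pi) \<le> sqrt ((2 * t)\<^sup>2 * t)" by (rule real_sqrt_le_mono)
  also have "\<dots> = 2 * (t * sqrt t)" using assms by (simp add: real_sqrt_mult)
  finally have "kap * W t n * sqrt (12 * t ^ 3 / pi) \<le> kap * W t n * (2 * (t * sqrt t))"
    using constants_nonneg(1) W_pos[of t n] by (intro mult_left_mono) auto
  then show "main_int t n \<le> 2 * kap * W t n * (t * sqrt t)" by (simp add: main_int_def mult_ac)
qed

lemma card_le:
  assumes "admissible t n" "minor_bound C t n"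
  shows "real (card (sets_n n)) \<le> (2 * kap + C3 + 7 * C) * W t n * (t * sqrt t)"
proof -
  note A = admissibleD[OF assms(1)]
  have C: "0 \<le> C" using assms(2) by (simp add: minor_bound_def)
  have "t\<^sup>2 * sqrt t \<le> t * sqrt t" using A by (intro mult_right_mono) (auto simp: power2_eq_square)
  then have "(C3 + 7 * C) * W t n * (t\<^sup>2 * sqrt t) \<le> (C3 + 7 * C) * W t n * (t * sqrt t)"
    using C C3_nonneg W_pos[of t n] by (intro mult_left_mono) auto
  then have "2 * pi * real (card (sets_n n)) \<le> (2 * kap + C3 + 7 * C) * W t n * (t * sqrt t)"
    using card_approx[OF assms] main_int_le(2)[OF A(1), of n] by (simp add: algebra_simps)
  moreover have "1 * real (card (sets_n n)) \<le> 2 * pi * real (card (sets_n n))"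
    using pi_gt3 by (intro mult_right_mono) auto
  ultimately show ?thesis by simp
qed

section \<open>Integration over \<theta>\<close>

lemma quarter_le_sin_half: "0 \<le> \<theta> \<Longrightarrow> \<theta> \<le> pi \<Longrightarrow> \<theta> / 4 \<le> sin (\<theta> / 2)"
  using half_le_sin[of "\<theta> / 2"] by simp

text \<open>For small \<theta> the quotient sin (slope \<theta>) / sin (\<theta>/2) is nearly 2
  slope; division by the 2 pi of Fourier inversion gives slope / pi.\<close>

definition target :: "real \<Rightarrow> nat \<Rightarrow> real \<Rightarrow> real" where
  "target t n \<theta> = slope * main_int t n / pi * exp (- rho t \<theta>)"

definition C5 :: real where
  "C5 = C4 + 8 * (slope\<^sup>2 + \<bar>slope\<bar>) * kap * sqrt (8 * real N)"

text \<open>Division of \<open>half_cc_approx\<close> by sin (\<theta>/2) \<ge> \<theta>/4 cancels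
  the retained |\<theta>|, and \<theta> \<ge> t^4 keeps t^8 / \<theta> below t^4. Replacing the
  quotient of sines by 2 slope costs O(|\<theta>|), worth sqrt t under the Gaussian.\<close>

lemma kernel_sum_central:
  assumes "admissible t n" "minor_bound C t n" "t ^ 4 \<le> \<theta>" "\<theta> \<le> 1/2"
  shows "\<bar>kernel_sum n \<theta> - target t n \<theta>\<bar> \<le> C5 * W t n * t\<^sup>2 * exp (- (rho t \<theta> / 4)) + 7 * C * W t n * t ^ 4"
proof -
  note A = admissibleD[OF assms(1)]
  have C: "0 \<le> C" using assms(2) by (simp add: minor_bound_def)
  have t4: "0 < t ^ 4" using A by simp
  have th: "0 < \<theta>" using t4 assms(3) by linarith
  define s where "s = sin (\<theta> / 2)"
  have s: "\<theta> / 4 \<le> s" unfolding s_def by (rule quarter_le_sin_half) (use th assms pi_gt3 in linarith)+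
  have s0: "0 < s" using s th by linarith
  define M where "M = main_int t n"
  define e where "e = exp (- rho t \<theta>)"
  define e4 where "e4 = exp (- (rho t \<theta> / 4))"
  have e0: "0 \<le> e" "0 \<le> e4" by (auto simp: e_def e4_def)
  have M: "0 \<le> M" "M \<le> 2 * kap * W t n * (t * sqrt t)" using main_int_le[OF A(1), of n] by (auto simp: M_def)
  have r0: "0 \<le> rho t \<theta>" by (rule rho_nonneg[OF A(1)])
  have ks: "kernel_sum n \<theta> = half_cc n \<theta> / s"
    using sin_half_kernel_sum[of \<theta> n] s0 by (simp add: s_def field_simps)
  have e1: "\<bar>half_cc n \<theta> / s - sin (slope * \<theta>) * e * M / (2 * pi * s)\<bar> \<le> C4 * W t n * t\<^sup>2 * e4 + 7 * C * W t n * t ^ 4"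
  proof -
    have "half_cc n \<theta> / s - sin (slope * \<theta>) * e * M / (2 * pi * s) = (2 * pi * half_cc n \<theta> - sin (slope * \<theta>) * e * M) / (2 * pi * s)"
      using s0 by (simp add: diff_divide_distrib)
    also have "\<bar>\<dots>\<bar> = \<bar>2 * pi * half_cc n \<theta> - sin (slope * \<theta>) * e * M\<bar> / (2 * pi * s)"
      using s0 by (simp add: abs_divide abs_mult)
    also have "\<dots> \<le> (C4 * W t n * t\<^sup>2 * \<theta> * e4 + 7 * C * W t n * t ^ 8) / \<theta>"
    proof (rule frac_le)
      have "\<bar>\<theta>\<bar> \<le> 1/2" using th assms(4) by simp
      from half_cc_approx[OF assms(1,2) this]
      show "\<bar>2 * pi * half_cc n \<theta> - sin (slope * \<theta>) * e * M\<bar> \<le> C4 * W t n * t\<^sup>2 * \<theta> * e4 + 7 * C * W t n * t ^ 8"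
        using th by (simp add: e_def e4_def M_def)
      have "\<theta> = 4 * (\<theta> / 4)" by simp
      also have "\<dots> \<le> (2 * pi) * s" using s th pi_gt3 by (intro mult_mono) auto
      finally show "\<theta> \<le> 2 * pi * s" .
    qed (use th C C4_nonneg W_pos[of t n] e0 in auto)
    also have "\<dots> = C4 * W t n * t\<^sup>2 * e4 + 7 * C * W t n * (t ^ 8 / \<theta>)"
      using th by (simp add: add_divide_distrib)
    also have "\<dots> \<le> C4 * W t n * t\<^sup>2 * e4 + 7 * C * W t n * t ^ 4"
    proof -
      have "t ^ 8 / \<theta> \<le> t ^ 8 / t ^ 4" using assms(3) t4 th by (intro divide_left_mono) auto
      also have "\<dots> = t ^ 4" using A(1) by (simp add: field_simps power_add[symmetric])
      finally have "7 * C * W t n * (t ^ 8 / \<theta>) \<le> 7 * C * W t n * t ^ 4"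
        using C W_pos[of t n] by (intro mult_left_mono) auto
      then show ?thesis by simp
    qed
    finally show ?thesis .
  qed
  have e2: "\<bar>sin (slope * \<theta>) * e * M / (2 * pi * s) - slope * M / pi * e\<bar> \<le> 8 * (slope\<^sup>2 + \<bar>slope\<bar>) * kap * sqrt (8 * real N) * W t n * t\<^sup>2 * e4"
  proof -
    have "sin (slope * \<theta>) - 2 * slope * s = (sin (slope * \<theta>) - slope * \<theta>) - 2 * slope * (s - \<theta> / 2)"
      by (simp add: algebra_simps)
    then have "\<bar>sin (slope * \<theta>) - 2 * slope * s\<bar> \<le> \<bar>sin (slope * \<theta>) - slope * \<theta>\<bar> + \<bar>2 * slope * (s - \<theta> / 2)\<bar>"
      by (simp only: abs_triangle_ineq4)
    also have "\<dots> \<le> (slope * \<theta>)\<^sup>2 + 2 * \<bar>slope\<bar> * (\<theta> / 2)\<^sup>2"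
    proof (intro add_mono abs_sin_minus_le)
      have "\<bar>s - \<theta> / 2\<bar> \<le> (\<theta> / 2)\<^sup>2" unfolding s_def by (rule abs_sin_minus_le)
      then show "\<bar>2 * slope * (s - \<theta> / 2)\<bar> \<le> 2 * \<bar>slope\<bar> * (\<theta> / 2)\<^sup>2"
        unfolding abs_mult by (intro mult_mono) auto
    qed
    also have "\<dots> \<le> (slope\<^sup>2 + \<bar>slope\<bar>) * \<theta> * \<theta>"
    proof -
      have "2 * \<bar>slope\<bar> * (\<theta> / 2)\<^sup>2 = \<bar>slope\<bar> * (\<theta> * \<theta>) / 2" by (simp add: power2_eq_square)
      also have "\<dots> \<le> \<bar>slope\<bar> * (\<theta> * \<theta>)" using th by simp
      finally show ?thesis by (simp add: power_mult_distrib power2_eq_square algebra_simps)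
    qed
    finally have n: "\<bar>sin (slope * \<theta>) - 2 * slope * s\<bar> \<le> (slope\<^sup>2 + \<bar>slope\<bar>) * \<theta> * \<theta>" .
    have "sin (slope * \<theta>) * e * M / (2 * pi * s) - slope * M / pi * e = (sin (slope * \<theta>) - 2 * slope * s) / s * (e * M / (2 * pi))"
      using s0 by (simp add: field_simps)
    also have "\<bar>\<dots>\<bar> = \<bar>sin (slope * \<theta>) - 2 * slope * s\<bar> / s * (e * M / (2 * pi))"
      using s0 e0 M by (simp add: abs_mult abs_divide)
    also have "\<dots> \<le> ((slope\<^sup>2 + \<bar>slope\<bar>) * \<theta> * \<theta>) / (\<theta> / 4) * (e * M / 1)"
      by (intro mult_mono frac_le n s) (use th e0 M pi_gt3 in auto)
    also have "\<dots> = 4 * (slope\<^sup>2 + \<bar>slope\<bar>) * M * (\<theta> * e)" using th by simp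
    also have "\<dots> \<le> 4 * (slope\<^sup>2 + \<bar>slope\<bar>) * (2 * kap * W t n * (t * sqrt t)) * ((sqrt (8 * real N) * sqrt t) * e4)"
    proof (rule mult_mono)
      show "4 * (slope\<^sup>2 + \<bar>slope\<bar>) * M \<le> 4 * (slope\<^sup>2 + \<bar>slope\<bar>) * (2 * kap * W t n * (t * sqrt t))"
        by (intro mult_left_mono M) auto
      have "e \<le> e4 * e4" unfolding e_def e4_def exp_add[symmetric] using r0 by simp
      then have "\<theta> * e \<le> \<theta> * (e4 * e4)" using th by (intro mult_left_mono) auto
      also have "\<dots> = (\<bar>\<theta>\<bar> * e4) * e4" using th by simp
      also have "\<dots> \<le> (sqrt (8 * real N) * sqrt t) * e4"
        using abs_theta_exp_le[OF A(1), of \<theta>] e0 by (intro mult_right_mono) (auto simp: e4_def)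
      finally show "\<theta> * e \<le> (sqrt (8 * real N) * sqrt t) * e4" .
    qed (use M A th e0 constants_nonneg W_pos[of t n] in auto)
    also have "\<dots> = 8 * (slope\<^sup>2 + \<bar>slope\<bar>) * kap * sqrt (8 * real N) * W t n * (t * (sqrt t * sqrt t)) * e4"
      by (simp add: mult_ac)
    also have "t * (sqrt t * sqrt t) = t\<^sup>2" using A by (simp add: power2_eq_square)
    finally show ?thesis .
  qed
  have "\<bar>half_cc n \<theta> / s - slope * M / pi * e\<bar> \<le> (C4 * W t n * t\<^sup>2 * e4 + 7 * C * W t n * t ^ 4) + 8 * (slope\<^sup>2 + \<bar>slope\<bar>) * kap * sqrt (8 * real N) * W t n * t\<^sup>2 * e4"
    using e1 e2 by linarith
  also have "\<dots> = C5 * W t n * t\<^sup>2 * e4 + 7 * C * W t n * t ^ 4" by (simp add: C5_def algebra_simps)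
  finally show ?thesis
    unfolding ks target_def M_def[symmetric] e_def[symmetric] e4_def[symmetric] .
qed

lemma C5_nonneg: "0 \<le> C5" using C4_nonneg constants_nonneg by (simp add: C5_def)

lemma rho_gaussian: "0 < t \<Longrightarrow> rho t \<theta> / q = (1 / (2 * real N * t * q)) * \<theta>\<^sup>2"
  by (simp add: rho_def)

lemma continuous_on_rho: "0 < t \<Longrightarrow> continuous_on S (rho t)"
  unfolding rho_def [abs_def] using N_ge_2 by (intro continuous_intros) auto

lemma power_le_sqrt:
  fixes t :: real
  assumes "0 \<le> t" "t \<le> 1" "1 \<le> k"
  shows "t ^ k \<le> sqrt t"
proof -
  have "t ^ k \<le> t ^ 1" using assms by (intro power_decreasing) auto
  also have "t ^ 1 \<le> sqrt t" using assms by (intro real_le_rsqrt) (simp add: power2_eq_square mult_left_le)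
  finally show ?thesis .
qed

text \<open>The \<theta>-Gaussian has width of order sqrt t, which improves the pointwise W t^2 to
  the permitted W t^(5/2).\<close>

lemma kernel_sum_integral_central:
  assumes "admissible t n" "minor_bound C t n"
  shows "\<bar>integral {t ^ 4..1/2} (kernel_sum n) - integral {t ^ 4..1/2} (target t n)\<bar> \<le> (C5 * sqrt (8 * pi * real N) + 7 * C) * W t n * t\<^sup>2 * sqrt t"
proof -
  note A = admissibleD[OF assms(1)]
  have C: "0 \<le> C" using assms(2) by (simp add: minor_bound_def)
  have t4: "t ^ 4 \<le> 1/2" "0 < t ^ 4"
  proof -
    have "t ^ 4 \<le> t ^ 1" using A by (intro power_decreasing) auto
    then show "t ^ 4 \<le> 1/2" using A(2) by simp
  qed (use A in simp)
  define B where "B = C5 * W t n * t\<^sup>2"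
  define c where "c = 1 / (2 * real N * t * 4)"
  have c0: "0 < c" using A N_ge_2 by (simp add: c_def)
  have B0: "0 \<le> B" using C5_nonneg W_pos[of t n] by (simp add: B_def)
  have ct: "continuous_on S (target t n)" for S
    unfolding target_def [abs_def] by (intro continuous_intros continuous_on_rho A)
  have iK: "kernel_sum n integrable_on {t ^ 4..1/2}" by (intro integrable_continuous_real continuous_on_kernel_sum)
  have iT: "target t n integrable_on {t ^ 4..1/2}" by (intro integrable_continuous_real ct)
  have iD: "(\<lambda>\<theta>. kernel_sum n \<theta> - target t n \<theta>) integrable_on {t ^ 4..1/2}"
    by (rule Henstock_Kurzweil_Integration.integrable_diff[OF iK iT])
  have iG: "(\<lambda>\<theta>. B * exp (- (c * \<theta>\<^sup>2))) integrable_on {t ^ 4..1/2}"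
    by (intro integrable_continuous_real continuous_intros)
  have "norm (integral {t ^ 4..1/2} (\<lambda>\<theta>. kernel_sum n \<theta> - target t n \<theta>))
     \<le> integral {t ^ 4..1/2} (\<lambda>\<theta>. B * exp (- (c * \<theta>\<^sup>2)) + 7 * C * W t n * t ^ 4)"
  proof (rule integral_norm_bound_integral[OF iD])
    show "(\<lambda>\<theta>. B * exp (- (c * \<theta>\<^sup>2)) + 7 * C * W t n * t ^ 4) integrable_on {t ^ 4..1/2}"
      by (intro integrable_continuous_real continuous_intros)
    fix \<theta> assume "\<theta> \<in> {t ^ 4..1/2}"
    then show "norm (kernel_sum n \<theta> - target t n \<theta>) \<le> B * exp (- (c * \<theta>\<^sup>2)) + 7 * C * W t n * t ^ 4"
      using kernel_sum_central[OF assms, of \<theta>] unfolding rho_gaussian[OF A(1)] by (simp add: B_def c_def)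
  qed
  also have "\<dots> = B * integral {t ^ 4..1/2} (\<lambda>\<theta>. exp (- (c * \<theta>\<^sup>2))) + 7 * C * W t n * t ^ 4 * (1/2 - t ^ 4)"
    using t4 by (subst Henstock_Kurzweil_Integration.integral_add[OF iG]) auto
  also have "\<dots> \<le> B * (sqrt (8 * pi * real N) * sqrt t) + 7 * C * W t n * t ^ 4 * 1"
  proof (intro add_mono mult_left_mono B0)
    have "integral {t ^ 4..1/2} (\<lambda>\<theta>. exp (- (c * \<theta>\<^sup>2))) \<le> sqrt (pi / c)" by (rule gaussian_integral_le[OF c0])
    also have "pi / c = 8 * pi * real N * t" by (simp add: c_def)
    finally show "integral {t ^ 4..1/2} (\<lambda>\<theta>. exp (- (c * \<theta>\<^sup>2))) \<le> sqrt (8 * pi * real N) * sqrt t"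
      by (simp add: real_sqrt_mult)
    show "1/2 - t ^ 4 \<le> 1" using t4(2) by linarith
  qed (use A C W_pos[of t n] in auto)
  also have "\<dots> \<le> B * (sqrt (8 * pi * real N) * sqrt t) + 7 * C * W t n * (t\<^sup>2 * sqrt t)"
  proof -
    have "t ^ 4 = t\<^sup>2 * t ^ 2" by (simp add: power_add[symmetric])
    also have "\<dots> \<le> t\<^sup>2 * sqrt t" using A by (intro mult_left_mono power_le_sqrt) auto
    finally show ?thesis using C W_pos[of t n] by (auto intro!: mult_left_mono)
  qed
  also have "\<dots> = (C5 * sqrt (8 * pi * real N) + 7 * C) * W t n * t\<^sup>2 * sqrt t"
    by (simp add: B_def algebra_simps)
  finally show ?thesis
    unfolding Henstock_Kurzweil_Integration.integral_diff[OF iK iT] by simp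
qed

text \<open>Completion to a half-line: the piece below t^4 has length at most t, and the
  exponentially small tail beyond 1/2 is estimated by O(t). What remains is half of the full
  Gaussian integral sqrt (2 pi N t).\<close>

lemma target_integral:
  assumes "admissible t n"
  shows "\<bar>integral {t ^ 4..1/2} (target t n) - slope * main_int t n / pi * (sqrt (2 * pi * real N * t) / 2)\<bar>
     \<le> \<bar>slope\<bar> * (2 * kap) * (1 + 8 * real N * sqrt (4 * pi * real N)) * W t n * t\<^sup>2 * sqrt t"
proof -
  note A = admissibleD[OF assms(1)]
  have t4: "t ^ 4 \<le> 1/2" "0 < t ^ 4" "t ^ 4 \<le> t"
  proof -
    have "t ^ 4 \<le> t ^ 1" using A by (intro power_decreasing) auto
    then show "t ^ 4 \<le> t" by simp
    then show "t ^ 4 \<le> 1/2" using A(2) by simp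
  qed (use A in simp)
  define c where "c = 1 / (2 * real N * t * 1)"
  have c0: "0 < c" using A N_ge_2 by (simp add: c_def)
  define g where "g \<theta> = exp (- (c * \<theta>\<^sup>2))" for \<theta>
  have cg: "continuous_on S g" for S unfolding g_def by (intro continuous_intros)
  have tg: "target t n \<theta> = slope * main_int t n / pi * g \<theta>" for \<theta>
    using rho_gaussian[OF A(1), of \<theta> 1] by (simp add: target_def g_def c_def)
  have full: "\<bar>integral {0..1/2} g - sqrt (pi / c) / 2\<bar> \<le> 8 * real N * t * sqrt (4 * pi * real N)"
  proof -
    have h: "integral {0..1/2} g = integral {- (1/2)..1/2} g / 2"
      by (rule integral_even_half) (auto simp: g_def intro!: continuous_intros)
    have u: "integral {- (1/2)..1/2} g \<le> sqrt (pi / c)" unfolding g_def by (rule gaussian_integral_le[OF c0])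
    have l: "sqrt (pi / c) - exp (- (c * (1/2)\<^sup>2 / 2)) * sqrt (2 * pi / c) \<le> integral {- (1/2)..1/2} g"
      unfolding g_def by (rule gaussian_integral_ge[OF c0]) simp
    have "exp (- (c * (1/2)\<^sup>2 / 2)) \<le> 16 * real N * t"
    proof -
      have "c * (1/2)\<^sup>2 / 2 = 1 / (16 * real N) / t" by (simp add: c_def power2_eq_square)
      moreover have "exp (- (1 / (16 * real N) / t)) \<le> fact 1 / (1 / (16 * real N)) ^ 1 * t ^ 1"
        by (rule exp_neg_inverse_le) (use A(1) N_ge_2 in auto)
      ultimately show ?thesis by (simp only: power_one_right fact_1 divide_divide_eq_right mult_1 div_by_1)
    qed
    moreover have "sqrt (2 * pi / c) \<le> sqrt (4 * pi * real N)"
    proof (rule real_sqrt_le_mono)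
      have "2 * pi / c = 4 * pi * real N * t" by (simp add: c_def)
      also have "\<dots> \<le> 4 * pi * real N * 1" using A by (intro mult_left_mono) auto
      finally show "2 * pi / c \<le> 4 * pi * real N" by simp
    qed
    ultimately have "exp (- (c * (1/2)\<^sup>2 / 2)) * sqrt (2 * pi / c) \<le> 16 * real N * t * sqrt (4 * pi * real N)"
      using A c0 by (intro mult_mono) auto
    then show ?thesis unfolding h using u l by (simp add: abs_le_iff)
  qed
  have small: "\<bar>integral {0..t ^ 4} g\<bar> \<le> t"
  proof -
    have "norm (integral {0..t ^ 4} g) \<le> 1 * (t ^ 4 - 0)"
      by (rule integral_bound) (use t4 c0 cg in \<open>auto simp: g_def\<close>)
    then show ?thesis using t4 by simp
  qed
  have comb: "integral {0..t ^ 4} g + integral {t ^ 4..1/2} g = integral {0..1/2} g"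
    by (rule Henstock_Kurzweil_Integration.integral_combine) (use t4 in \<open>auto intro!: integrable_continuous_real cg\<close>)
  have pc: "sqrt (pi / c) = sqrt (2 * pi * real N * t)" by (simp add: c_def mult_ac)
  have ig: "\<bar>integral {t ^ 4..1/2} g - sqrt (2 * pi * real N * t) / 2\<bar> \<le> (1 + 8 * real N * sqrt (4 * pi * real N)) * t"
    using full small comb unfolding pc by (simp add: algebra_simps)
  have "integral {t ^ 4..1/2} (target t n) - slope * main_int t n / pi * (sqrt (2 * pi * real N * t) / 2)
     = slope * main_int t n / pi * (integral {t ^ 4..1/2} g - sqrt (2 * pi * real N * t) / 2)"
    unfolding tg [abs_def] by (simp add: right_diff_distrib)
  also have "\<bar>\<dots>\<bar> = \<bar>slope\<bar> * (main_int t n / pi) * \<bar>integral {t ^ 4..1/2} g - sqrt (2 * pi * real N * t) / 2\<bar>"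
    using main_int_le(1)[OF A(1), of n] by (simp add: abs_mult abs_divide)
  also have "\<dots> \<le> \<bar>slope\<bar> * (2 * kap * W t n * (t * sqrt t)) * ((1 + 8 * real N * sqrt (4 * pi * real N)) * t)"
  proof (intro mult_mono ig mult_left_mono)
    have "main_int t n / pi \<le> main_int t n / 1"
      using main_int_le(1)[OF A(1), of n] pi_gt3 by (intro divide_left_mono) auto
    then show "main_int t n / pi \<le> 2 * kap * W t n * (t * sqrt t)" using main_int_le(2)[OF A(1), of n] by simp
  qed (use main_int_le(1)[OF A(1), of n] A constants_nonneg W_pos[of t n] in auto)
  also have "\<dots> = \<bar>slope\<bar> * (2 * kap) * (1 + 8 * real N * sqrt (4 * pi * real N)) * W t n * t\<^sup>2 * sqrt t"
    by (simp add: power2_eq_square mult_ac)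
  finally show ?thesis .
qed

lemma n_le: "admissible t n \<Longrightarrow> real n * t\<^sup>2 \<le> 1"
proof -
  assume "admissible t n"
  moreover have "pi\<^sup>2 \<le> 12"
  proof -
    have "pi * pi \<le> 3.2 * 3.2" using pi_approx by (intro mult_mono) auto
    then show ?thesis by (simp add: power2_eq_square)
  qed
  ultimately show ?thesis by (simp add: admissible_def)
qed

text \<open>Near \<open>\<theta> = 0\<close> the minor arc error \<open>O(t\<^sup>8)\<close> cannot be divided by \<open>sin (\<theta> / 2)\<close>, but there the trivial bound
  on the kernel suffices.\<close>

lemma kernel_sum_integral_small:
  assumes "admissible t n" "minor_bound C t n"
  shows "\<bar>integral {0..t ^ 4} (kernel_sum n)\<bar> \<le> 3 * (2 * kap + C3 + 7 * C) * W t n * t\<^sup>2 * sqrt t"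
proof -
  note A = admissibleD[OF assms(1)]
  have C: "0 \<le> C" using assms(2) by (simp add: minor_bound_def)
  define D where "D = (2 * kap + C3 + 7 * C) * W t n * (t * sqrt t)"
  have D0: "0 \<le> D" using C C3_nonneg constants_nonneg W_pos[of t n] A by (simp add: D_def)
  have "norm (integral {0..t ^ 4} (kernel_sum n)) \<le> D * (3 * real n) * (t ^ 4 - 0)"
  proof (rule integral_bound)
    fix \<theta> :: real
    have "real (card (sets_n n)) * (2 * real n + 1) \<le> D * (3 * real n)"
      by (intro mult_mono) (use card_le[OF assms] A D0 in \<open>auto simp: D_def\<close>)
    then show "norm (kernel_sum n \<theta>) \<le> D * (3 * real n)" using abs_kernel_sum_le[of n \<theta>] by simp
  qed (use A in \<open>auto intro!: continuous_on_kernel_sum\<close>)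
  \<comment> \<open>Of the length t^4 one factor t^2 pays for the n in the trivial bound on the
    kernel, the other is the gain.\<close>
  also have "\<dots> = D * 3 * ((real n * t\<^sup>2) * t\<^sup>2)" by (simp add: power_add[symmetric])
  also have "\<dots> \<le> D * 3 * (1 * t\<^sup>2)"
    by (intro mult_left_mono mult_right_mono n_le assms) (use D0 in auto)
  also have "\<dots> = 3 * (2 * kap + C3 + 7 * C) * W t n * (t\<^sup>2 * sqrt t) * t" by (simp add: D_def)
  also have "\<dots> \<le> 3 * (2 * kap + C3 + 7 * C) * W t n * (t\<^sup>2 * sqrt t) * 1"
    by (intro mult_left_mono) (use A C C3_nonneg constants_nonneg W_pos[of t n] in auto)
  finally show ?thesis by (simp add: mult.assoc)
qed

lemma kernel_sum_integral_large:
  assumes "admissible t n" "minor_bound C t n"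
  shows "\<bar>integral {1/2..pi} (kernel_sum n)\<bar> \<le> 32 * C * W t n * t\<^sup>2 * sqrt t"
proof -
  note A = admissibleD[OF assms(1)]
  have C: "0 \<le> C" using assms(2) by (simp add: minor_bound_def)
  have p: "1/2 \<le> pi" using pi_gt3 by simp
  have B0: "0 \<le> 8 * (C * W t n * t ^ 8)" using C W_pos[of t n] A by simp
  have "norm (integral {1/2..pi} (kernel_sum n)) \<le> 8 * (C * W t n * t ^ 8) * (pi - 1/2)"
  proof (rule integral_bound[OF p continuous_on_kernel_sum])
    fix \<theta> assume "\<theta> \<in> {1/2..pi}"
    then have th: "1/2 \<le> \<theta>" "\<theta> \<le> pi" by auto
    have "\<bar>half_cc n \<theta>\<bar> \<le> cmod (exp (- (\<i> * of_real (\<theta> / 2))) * cc n \<theta>)" unfolding half_cc_def by (rule abs_Im_le_cmod)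
    also have "\<dots> = cmod (cc n \<theta>)" by (simp add: norm_mult)
    also have "\<dots> \<le> C * W t n * t ^ 8" by (rule cc_minor[OF assms]) (use th in auto)
    finally have h: "\<bar>half_cc n \<theta>\<bar> \<le> C * W t n * t ^ 8" .
    have "\<theta> / 4 \<le> sin (\<theta> / 2)" by (rule quarter_le_sin_half) (use th in auto)
    then have s: "1/8 \<le> sin (\<theta> / 2)" using th by simp
    then have "1/8 * \<bar>kernel_sum n \<theta>\<bar> \<le> sin (\<theta> / 2) * \<bar>kernel_sum n \<theta>\<bar>" by (intro mult_right_mono) auto
    also have "\<dots> = \<bar>half_cc n \<theta>\<bar>" using s unfolding sin_half_kernel_sum[symmetric] by (simp add: abs_mult)
    finally show "norm (kernel_sum n \<theta>) \<le> 8 * (C * W t n * t ^ 8)" using h by simp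
  qed
  also have "\<dots> \<le> 8 * (C * W t n * t ^ 8) * 4"
    by (intro mult_left_mono B0) (use pi_less_4 in simp)
  also have "\<dots> = 32 * C * W t n * (t\<^sup>2 * t ^ 6)" by (simp add: power_add[symmetric])
  also have "\<dots> \<le> 32 * C * W t n * (t\<^sup>2 * sqrt t)"
    by (intro mult_left_mono power_le_sqrt) (use A C W_pos[of t n] in auto)
  finally show ?thesis by (simp add: mult.assoc)
qed

definition C6 :: "real \<Rightarrow> real" where
  "C6 C = (C3 + 7 * C) + 3 * (2 * kap + C3 + 7 * C) + (C5 * sqrt (8 * pi * real N) + 7 * C)
     + \<bar>slope\<bar> * (2 * kap) * (1 + 8 * real N * sqrt (4 * pi * real N)) + 32 * C"

text \<open>The \<theta>-range is cut at t^4 and 1/2: the trivial bound below, the Gaussian target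
  in between, the minor arc bound above. The total error is smaller than \<open>main_int\<close> by
  a factor t, that is O(1 / sqrt n).\<close>

lemma two_d_approx:
  assumes "admissible t n" "minor_bound C t n"
  shows "\<bar>2 * real (d K \<alpha> \<beta> N n) - main_int t n / (2 * pi) * (1 + slope * sqrt (2 * real N * t / pi))\<bar> \<le> C6 C * W t n * t\<^sup>2 * sqrt t"
proof -
  note A = admissibleD[OF assms(1)]
  have C: "0 \<le> C" using assms(2) by (simp add: minor_bound_def)
  define U where "U = W t n * t\<^sup>2 * sqrt t"
  have U0: "0 \<le> U" using W_pos[of t n] A by (simp add: U_def)
  have t4: "t ^ 4 \<le> 1/2" "0 < t ^ 4"
  proof -
    have "t ^ 4 \<le> t ^ 1" using A by (intro power_decreasing) auto
    then show "t ^ 4 \<le> 1/2" using A(2) by simp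
  qed (use A in simp)
  define g where "g = kernel_sum n"
  have ig: "g integrable_on {a..b}" for a b unfolding g_def by (intro integrable_continuous_real continuous_on_kernel_sum)
  have "integral {0..pi} g = integral {0..t ^ 4} g + integral {t ^ 4..pi} g"
    by (rule Henstock_Kurzweil_Integration.integral_combine[symmetric, OF _ _ ig]) (use t4 pi_gt3 in linarith)+
  moreover have "integral {t ^ 4..pi} g = integral {t ^ 4..1/2} g + integral {1/2..pi} g"
    by (rule Henstock_Kurzweil_Integration.integral_combine[symmetric, OF _ _ ig]) (use t4 pi_gt3 in linarith)+
  ultimately have split: "integral {0..pi} g = integral {0..t ^ 4} g + integral {t ^ 4..1/2} g + integral {1/2..pi} g" by simp
  define Y where "Y = slope * main_int t n / pi * (sqrt (2 * pi * real N * t) / 2)"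
  define R where "R = 3 * (2 * kap + C3 + 7 * C) * U + (C5 * sqrt (8 * pi * real N) + 7 * C) * U
     + \<bar>slope\<bar> * (2 * kap) * (1 + 8 * real N * sqrt (4 * pi * real N)) * U + 32 * C * U"
  have "\<bar>integral {0..pi} g - Y\<bar> \<le> R"
  proof -
    have 1: "\<bar>integral {0..t ^ 4} g\<bar> \<le> 3 * (2 * kap + C3 + 7 * C) * U"
      using kernel_sum_integral_small[OF assms] by (simp add: g_def U_def mult.assoc)
    have 2: "\<bar>integral {t ^ 4..1/2} g - integral {t ^ 4..1/2} (target t n)\<bar> \<le> (C5 * sqrt (8 * pi * real N) + 7 * C) * U"
      using kernel_sum_integral_central[OF assms] by (simp add: g_def U_def mult.assoc)
    have 3: "\<bar>integral {t ^ 4..1/2} (target t n) - Y\<bar> \<le> \<bar>slope\<bar> * (2 * kap) * (1 + 8 * real N * sqrt (4 * pi * real N)) * U"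
      using target_integral[OF assms(1)] by (simp add: Y_def U_def mult.assoc)
    have 4: "\<bar>integral {1/2..pi} g\<bar> \<le> 32 * C * U"
      using kernel_sum_integral_large[OF assms] by (simp add: g_def U_def mult.assoc)
    show ?thesis unfolding split R_def using 1 2 3 4 by linarith
  qed
  then have i: "\<bar>integral {0..pi} g / pi - Y / pi\<bar> \<le> R"
  proof -
    assume h: "\<bar>integral {0..pi} g - Y\<bar> \<le> R"
    have "\<bar>integral {0..pi} g / pi - Y / pi\<bar> = \<bar>integral {0..pi} g - Y\<bar> / pi"
      by (simp add: diff_divide_distrib[symmetric] abs_divide)
    also have "\<dots> \<le> \<bar>integral {0..pi} g - Y\<bar> / 1" using pi_gt3 by (intro divide_left_mono) auto
    finally show ?thesis using h by simp
  qed
  have c: "\<bar>real (card (sets_n n)) - main_int t n / (2 * pi)\<bar> \<le> (C3 + 7 * C) * U"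
  proof -
    have "\<bar>real (card (sets_n n)) - main_int t n / (2 * pi)\<bar> = \<bar>2 * pi * real (card (sets_n n)) - main_int t n\<bar> / (2 * pi)"
    proof -
      have "real (card (sets_n n)) - main_int t n / (2 * pi) = (2 * pi * real (card (sets_n n)) - main_int t n) / (2 * pi)"
        by (simp add: diff_divide_distrib)
      then show ?thesis by (simp add: abs_divide)
    qed
    also have "\<dots> \<le> \<bar>2 * pi * real (card (sets_n n)) - main_int t n\<bar> / 1" using pi_gt3 by (intro divide_left_mono) auto
    finally show ?thesis using card_approx[OF assms] by (simp add: U_def mult.assoc)
  qed
  have sq: "sqrt (2 * pi * real N * t) / pi = sqrt (2 * real N * t / pi)"
  proof -
    have "2 * real N * t / pi = 2 * pi * real N * t / pi\<^sup>2" by (simp add: power2_eq_square)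
    then show ?thesis by (simp add: real_sqrt_divide)
  qed
  have Y: "Y / pi = main_int t n / (2 * pi) * (slope * sqrt (2 * real N * t / pi))"
    unfolding sq[symmetric] by (simp add: Y_def mult_ac)
  have "2 * real (d K \<alpha> \<beta> N n) = real (card (sets_n n)) + integral {0..pi} g / pi"
    unfolding g_def by (rule two_d_eq)
  then have "2 * real (d K \<alpha> \<beta> N n) - main_int t n / (2 * pi) * (1 + slope * sqrt (2 * real N * t / pi))
     = (real (card (sets_n n)) - main_int t n / (2 * pi)) + (integral {0..pi} g / pi - Y / pi)"
    unfolding Y by (simp add: distrib_left)
  then have "\<bar>2 * real (d K \<alpha> \<beta> N n) - main_int t n / (2 * pi) * (1 + slope * sqrt (2 * real N * t / pi))\<bar> \<le> (C3 + 7 * C) * U + R"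
    using i c by linarith
  also have "\<dots> = C6 C * W t n * t\<^sup>2 * sqrt t" unfolding R_def C6_def U_def by (simp add: algebra_simps)
  finally show ?thesis .
qed

section \<open>Explicit form of the expansion in n\<close>

lemma shift_eq: "slope = (- real N + real \<beta> - real \<alpha> + real N * (real (e_vec K N \<beta>) - real (e_vec K N \<alpha>))) / (2 * real N)"
  using N_ge_2 by (simp add: slope_def shift_def first_part_def field_simps)

definition main_term :: "nat \<Rightarrow> real" where
  "main_term n = exp (pi * sqrt (real n / 3)) / (2 ^ (K + 3) * 3 powr (1/4) * real n powr (3/4))"

lemma kap_eq: "kap = 1 / (2 ^ K * sqrt 2)"
proof -
  have "kap = exp (- (real K * ln 2)) * exp (- (ln 2 / 2))"
    by (simp add: kap_def exp_add[symmetric] algebra_simps)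
  also have "exp (- (real K * ln 2)) = 1 / 2 ^ K" by (simp add: exp_minus exp_of_nat_mult inverse_eq_divide)
  also have "exp (- (ln 2 / 2)) = 1 / sqrt (2 :: real)"
    using ln_sqrt[of 2] by (simp add: exp_minus inverse_eq_divide flip: ln_sqrt)
  finally show ?thesis by simp
qed

text \<open>The divisor is 4 pi because \<open>main_int\<close> / (2 pi) approximates twice the
  wanted number.\<close>

lemma main_int_eq:
  assumes n: "1 \<le> n" and t: "t = pi / sqrt (12 * real n)"
  shows "main_int t n / (4 * pi) = main_term n"
proof -
  have n0: "0 < real n" using n by simp
  have nt: "2 * (real n * t) = pi * sqrt (real n / 3)"
  proof -
    have "sqrt (12 * real n) = 2 * sqrt (3 * real n)" using real_sqrt_mult[of 4 "3 * real n"] by simp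
    then have "2 * (real n * t) = pi * (real n / sqrt (3 * real n))" unfolding t by simp
    also have "real n / sqrt (3 * real n) = sqrt (real n / 3)"
      using n0 by (simp add: real_sqrt_mult real_sqrt_divide field_simps)
    finally show ?thesis .
  qed
  define x where "x = 3 powr (1/4) * real n powr (3/4)"
  have x: "0 < x" using n0 by (simp add: x_def)
  have x4: "x ^ 4 = 3 * real n ^ 3"
  proof -
    have "x ^ 4 = (3 powr (1/4)) ^ 4 * (real n powr (3/4)) ^ 4" by (simp add: x_def power_mult_distrib)
    also have "(3 powr (1/4)) ^ 4 = (3::real)" by (simp add: powr_power)
    also have "(real n powr (3/4)) ^ 4 = real n ^ 3" using n0 by (simp add: powr_power powr_numeral)
    finally show ?thesis .
  qed
  \<comment> \<open>Both sides are positive and contain fourth roots, so their fourth powers, which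
    are rational expressions in n and pi, are compared.\<close>
  have "sqrt (12 * t ^ 3 / pi) / (4 * pi * sqrt 2) = 1 / (8 * x)"
  proof (rule power_eq_imp_eq_base[of _ 4])
    have "(sqrt (12 * t ^ 3 / pi)) ^ 4 = (12 * t ^ 3 / pi)\<^sup>2"
    proof -
      have "0 \<le> 12 * t ^ 3 / pi" unfolding t using n0 by simp
      then have "(sqrt (12 * t ^ 3 / pi))\<^sup>2 = 12 * t ^ 3 / pi" by simp
      then show ?thesis using power_mult[of "sqrt (12 * t ^ 3 / pi)" 2 2] by simp
    qed
    also have "\<dots> = 144 * (t\<^sup>2) ^ 3 / pi\<^sup>2" by (simp add: power_divide power_mult_distrib power_mult[symmetric])
    also have "t\<^sup>2 = pi\<^sup>2 / (12 * real n)" unfolding t using n0 by (simp add: power_divide)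
    finally have a: "(sqrt (12 * t ^ 3 / pi)) ^ 4 = 144 * (pi\<^sup>2 / (12 * real n)) ^ 3 / pi\<^sup>2" .
    have "(sqrt 2) ^ 4 = (4 :: real)"
      using power_mult[of "sqrt 2 :: real" 2 2] by simp
    then show "(sqrt (12 * t ^ 3 / pi) / (4 * pi * sqrt 2)) ^ 4 = (1 / (8 * x)) ^ 4"
      unfolding power_divide power_mult_distrib a x4 using n0 by (simp add: field_simps power2_eq_square power3_eq_cube eval_nat_numeral)
  qed (use x n0 t in auto)
  then have s: "sqrt (12 * t ^ 3 / pi) / (4 * pi) / sqrt 2 = 1 / (8 * x)" by simp
  have "main_int t n / (4 * pi) = W t n / 2 ^ K * (sqrt (12 * t ^ 3 / pi) / (4 * pi) / sqrt 2)"
    by (simp add: main_int_def kap_eq)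
  also have "\<dots> = W t n / (2 ^ (K + 3) * x)" unfolding s by (simp add: power_add)
  also have "\<dots> = main_term n" unfolding W_def nt main_term_def x_def by (simp add: mult.assoc)
  finally show ?thesis .
qed

lemma slope_term_eq:
  assumes n: "1 \<le> n" and t: "t = pi / sqrt (12 * real n)"
  shows "slope * sqrt (2 * real N * t / pi) = (- real N + real \<beta> - real \<alpha> + real N * (real (e_vec K N \<beta>) - real (e_vec K N \<alpha>))) / (2 * 3 powr (1/4) * sqrt (real N) * real n powr (1/4))"
proof -
  have n0: "0 < real n" "0 < real N" using n N_ge_2 by auto
  define x where "x = 3 powr (1/4) * real n powr (1/4)"
  have x: "0 < x" using n0 by (simp add: x_def)
  have x4: "x ^ 4 = 3 * real n" using n0 by (simp add: x_def power_mult_distrib powr_power)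
  have "x\<^sup>2 = sqrt (3 * real n)"
  proof (rule real_sqrt_unique[symmetric])
    show "(x\<^sup>2)\<^sup>2 = 3 * real n" using x4 by (simp add: power_mult[symmetric])
  qed simp
  moreover have "sqrt (12 * real n) = 2 * sqrt (3 * real n)" using real_sqrt_mult[of 4 "3 * real n"] by simp
  ultimately have "2 * real N * t / pi = real N / x\<^sup>2" unfolding t by simp
  then have "sqrt (2 * real N * t / pi) = sqrt (real N) / x" using x by (simp add: real_sqrt_divide)
  then have "slope * sqrt (2 * real N * t / pi) = (slope * (2 * real N)) * (sqrt (real N) / (2 * real N * x))"
    using n0 by simp
  also have "sqrt (real N) / (2 * real N * x) = 1 / (2 * sqrt (real N) * x)"
    using n0 x by (simp add: field_simps)
  also have "slope * (2 * real N) = - real N + real \<beta> - real \<alpha> + real N * (real (e_vec K N \<beta>) - real (e_vec K N \<alpha>))"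
    unfolding shift_eq using n0 by simp
  finally show ?thesis by (simp add: x_def mult_ac)
qed

lemma asymptotic_expansion:
  "\<exists>E :: nat \<Rightarrow> real. E \<in> O(\<lambda>n. 1 / sqrt (real n)) \<and>
    (\<forall>\<^sub>F n in sequentially.
       real (d K \<alpha> \<beta> N n) =
         exp (pi * sqrt (real n / 3)) / (2 ^ (K + 3) * 3 powr (1/4) * real n powr (3/4)) *
         (1 + (- real N + real \<beta> - real \<alpha> +
                 real N * (real (e_vec K N \<beta>) - real (e_vec K N \<alpha>))) /
              (2 * 3 powr (1/4) * sqrt (real N) * real n powr (1/4)) + E n))"
proof -
  obtain C t1 where t1: "0 < t1" and mb: "\<And>t n. admissible t n \<Longrightarrow> t \<le> t1 \<Longrightarrow> minor_bound C t n"
    using minor_bound_exists by blast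
  define c2 where "c2 n = (- real N + real \<beta> - real \<alpha> + real N * (real (e_vec K N \<beta>) - real (e_vec K N \<alpha>))) / (2 * 3 powr (1/4) * sqrt (real N) * real n powr (1/4))" for n
  \<comment> \<open>With \<open>E\<close> defined as the exact relative remainder, the identity
    holds for every n \<ge> 1 and the whole content lies in the bound on \<open>E\<close>.\<close>
  define E where "E n = real (d K \<alpha> \<beta> N n) / main_term n - (1 + c2 n)" for n
  define T where "T n = pi / sqrt (12 * real n)" for n :: nat
  define B where "B = \<bar>C6 C\<bar> * (2 * pi) / (kap * sqrt (12 / pi))"
  \<comment> \<open>Below \<open>t2\<close> the saddle is both admissible and small enough for the
    minor arc bound; \<open>T n\<close> tends to 0, so this holds eventually.\<close>
  define t2 where "t2 = min t1 (1 / (24 * real N))"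
  have t2: "0 < t2" using t1 N_ge_2 by (simp add: t2_def)
  have "(\<lambda>n. T n) \<longlonglongrightarrow> 0"
    unfolding T_def
    by (intro real_tendsto_divide_at_top[OF tendsto_const] filterlim_compose[OF sqrt_at_top]
          filterlim_tendsto_pos_mult_at_top[OF tendsto_const] filterlim_real_sequentially) simp
  then have "\<forall>\<^sub>F n in sequentially. T n < t2" using order_tendstoD(2) t2 by blast
  then have ev: "\<forall>\<^sub>F n in sequentially. T n < t2 \<and> 1 \<le> n"
    using eventually_ge_at_top[of 1] by eventually_elim auto
  have mp: "0 < main_term n" if "1 \<le> n" for n using that by (simp add: main_term_def)
  have bound: "\<bar>E n\<bar> \<le> B * T n" if a: "T n < t2" "1 \<le> n" for n
  proof -
    define t where "t = T n"
    have t0: "0 < t" using a by (simp add: t_def T_def)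
    have "real n * t\<^sup>2 = pi\<^sup>2 / 12" using a by (simp add: t_def T_def power_divide)
    then have adm: "admissible t n" using a t0 by (simp add: admissible_def t_def t2_def)
    have m: "minor_bound C t n" by (rule mb[OF adm]) (use a in \<open>simp add: t_def t2_def\<close>)
    have mi: "main_int t n / (4 * pi) = main_term n" by (rule main_int_eq[OF a(2)]) (simp add: t_def T_def)
    then have mi2: "main_int t n / (2 * pi) = 2 * main_term n" by simp
    have c: "slope * sqrt (2 * real N * t / pi) = c2 n" unfolding c2_def by (rule slope_term_eq[OF a(2)]) (simp add: t_def T_def)
    have "\<bar>2 * real (d K \<alpha> \<beta> N n) - 2 * main_term n * (1 + c2 n)\<bar> \<le> C6 C * W t n * t\<^sup>2 * sqrt t"
      using two_d_approx[OF adm m] unfolding mi2 c .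
    also have "\<dots> \<le> \<bar>C6 C\<bar> * (W t n * t\<^sup>2 * sqrt t)"
      using W_pos[of t n] t0 mult_right_mono[OF abs_ge_self[of "C6 C"], of "W t n * t\<^sup>2 * sqrt t"] by (simp add: mult.assoc)
    \<comment> \<open>The error size W t^(5/2) is a constant times \<open>main_term\<close> n times
      t, so the relative error is O(t) = O(1 / sqrt n).\<close>
    also have "W t n * t\<^sup>2 * sqrt t = 4 * pi * main_term n * t / (kap * sqrt (12 / pi))"
    proof -
      have "12 * t ^ 3 / pi = 12 / pi * (t\<^sup>2 * t)" by (simp add: power2_eq_square power3_eq_cube)
      then have "sqrt (12 * t ^ 3 / pi) = sqrt (12 / pi) * (t * sqrt t)" using t0 by (simp only: real_sqrt_mult real_sqrt_abs abs_of_pos)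
      then have "4 * pi * main_term n = kap * W t n * (sqrt (12 / pi) * (t * sqrt t))"
        unfolding mi[symmetric] main_int_def by simp
      then have "4 * pi * main_term n * t = (kap * sqrt (12 / pi)) * (W t n * t\<^sup>2 * sqrt t)" by (simp add: power2_eq_square mult_ac)
      moreover have "kap * sqrt (12 / pi) \<noteq> 0" using constants_nonneg by simp
      ultimately show ?thesis by (metis nonzero_mult_div_cancel_left)
    qed
    finally have e: "\<bar>2 * real (d K \<alpha> \<beta> N n) - 2 * main_term n * (1 + c2 n)\<bar> \<le> 2 * main_term n * (B * t)"
      by (simp add: B_def mult_ac)
    have "2 * real (d K \<alpha> \<beta> N n) - 2 * main_term n * (1 + c2 n) = 2 * main_term n * E n"
      using mp[OF a(2)] by (simp add: E_def field_simps)
    then have "2 * main_term n * \<bar>E n\<bar> \<le> 2 * main_term n * (B * t)" using e mp[OF a(2)] by (simp add: abs_mult)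
    then show ?thesis using mp[OF a(2)] by (simp add: t_def)
  qed
  have "E \<in> O(\<lambda>n. 1 / sqrt (real n))"
  proof (rule bigoI)
    show "\<forall>\<^sub>F n in sequentially. norm (E n) \<le> (B * pi) * norm (1 / sqrt (real n))"
      using ev
    proof eventually_elim
      case (elim n)
      have "0 \<le> B" using constants_nonneg by (simp add: B_def)
      moreover have "T n \<le> pi * (1 / sqrt (real n))"
        using elim unfolding T_def by (auto intro!: divide_left_mono)
      ultimately have "B * T n \<le> B * (pi * (1 / sqrt (real n)))" by (intro mult_left_mono)
      then show ?case using bound[of n] elim by simp
    qed
  qed
  moreover have "\<forall>\<^sub>F n in sequentially. real (d K \<alpha> \<beta> N n) = main_term n * (1 + c2 n + E n)"
    using eventually_ge_at_top[of 1]
  proof eventually_elim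
    case (elim n)
    then show ?case using mp[of n] by (simp add: E_def)
  qed
  ultimately show ?thesis unfolding main_term_def c2_def by blast
qed

end

theorem theorem1p2:
  fixes N K \<alpha> \<beta> :: nat
  assumes "N = 2 \<or> N \<ge> 5"
    and "1 \<le> \<alpha>" "\<alpha> \<le> N" "1 \<le> \<beta>" "\<beta> \<le> N" "\<alpha> \<noteq> \<beta>"
  shows "\<exists>E :: nat \<Rightarrow> real. E \<in> O(\<lambda>n. 1 / sqrt (real n)) \<and>
    (\<forall>\<^sub>F n in sequentially.
       real (d K \<alpha> \<beta> N n) =
         exp (pi * sqrt (real n / 3)) / (2 ^ (K + 3) * 3 powr (1/4) * real n powr (3/4)) *
         (1 + (- real N + real \<beta> - real \<alpha> +
                 real N * (real (e_vec K N \<beta>) - real (e_vec K N \<alpha>))) /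
              (2 * 3 powr (1/4) * sqrt (real N) * real n powr (1/4)) + E n))"
proof -
  interpret bias_parameters N K \<alpha> \<beta> using assms by unfold_locales auto
  show ?thesis by (rule asymptotic_expansion)
qed

end
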